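(* Let $n\ge3$. An infinite non-periodic cutting sequence $w$ of a linear trajectory in the regular $2n$-gon determines the direction of the trajectory uniquely via a Farey itinerary. That is: setting $w_0:=w$, for every $k\in\mathbb{N}$ the word $w_k$ is admissible in a unique diagram $d_k\in\{0,\dots,2n-1\}$, where $w_{k+1}:=(\pi_{d_k}\cdot w_k)'$; and there is a unique $\theta\in[0,\pi]$ whose itinerary under the $2n$-gon Farey map $F^{(n)}$ is $d_0,d_1,d_2,\dots$, and every trajectory $\tau$ (with direction taken in $[0,\pi]$) with $c(\tau)=w$ has direction $\theta$.
   Context: **Polygon and cutting sequences.** Let $O_{2n}\subset\mathbb{R}^2$ be a regular $2n$-gon centred at the origin with two horizontal sides, opposite sides identified by translation. The pairs of opposite sides are labelled in clockwise order $L_1,\dots,L_n$, with $L_1$ the horizontal pair. A (bi-infinite) linear trajectory in direction $\theta$ moves with constant velocity making angle $\theta$ with the horizontal; when it hits a side it re-enters $O_{2n}$ at the corresponding point of the opposite side with the same velocity; it never hits a vertex and is defined for all times. Its cutting sequence $c(\tau)$ is the bi-infinite word in $\{L_1,\dots,L_n\}$ of labels of sides crossed (considered up to shift). Rotation by $\pi$ preserves labels, so directions are taken in $[0,\pi]$. **Diagrams.** For $0\le i\le 2n-1$ let $\nu_i$ be the linear isometry of $O_{2n}$ acting on directions by $\theta\mapsto\theta-i\pi/2n$ (rotation) if $i$ is even and by $\theta\mapsto(i+1)\pi/2n-\theta$ (reflection) if $i$ is odd; it maps $[i\pi/2n,(i+1)\pi/2n]$ to $[0,\pi/2n]$. Let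 $\pi_i$ be the permutation of labels induced by $\nu_i$ ($\pi_i(L)=L'$ iff $\nu_i$ maps sides labelled $L$ to sides labelled $L'$), acting on words letter by letter. A word is admissible in diagram $0$ if each pair $L_iL_j$ of consecutive letters satisfies $i+j\in\{n+1,n+2\}$; it is admissible in diagram $i$ if $\pi_i\cdot w$ is admissible in diagram $0$. **Derivation.** A letter occurrence in a bi-infinite word is sandwiched if the letters immediately before and after it are equal; the derived sequence $w'$ keeps only the sandwiched letters of $w$. **Farey map.** Let $\gamma_n=\begin{pmatrix}-1&2\cot(\pi/2n)\\0&1\end{pmatrix}$. For $\theta\in[i\pi/2n,(i+1)\pi/2n]$, $F^{(n)}(\theta)\in(0,\pi]$ is the angle such that $\gamma_n\nu_i(\cos\theta,\sin\theta)^T$ is parallel to $(\cos F^{(n)}(\theta),\sin F^{(n)}(\theta))^T$ (the branches agree at common endpoints). Let $\Sigma^n_i=[i\pi/2n,(i+1)\pi/2n)$ for $0\le i\le 2n-2$ and $\Sigma^n_{2n-1}=[(2n-1)\pi/2n,\pi]$. The itinerary of $\theta$ is the sequence $s_0,s_1,\dots$ with $(F^{(n)})^j(\theta)\in\Sigma^n_{s_j}$ for all $j\in\mathbb{N}$. *)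

theory Defs
  imports "HOL-Analysis.Analysis"
begin

text \<open>
  The plane is identified with \<^typ>\<open>complex\<close>; the direction making angle \<open>\<theta>\<close> with the
  horizontal is \<open>cis \<theta>\<close>. The parameter \<open>R\<close> is the circumradius of the regular \<open>2n\<close>-gon, so every
  size of polygon is covered.
\<close>

subsection \<open>The regular polygon with opposite sides identified\<close>

text \<open>
  Vertices and sides are numbered clockwise by \<open>0, \<dots>, 2n - 1\<close>. Side \<open>j\<close> joins vertices \<open>j\<close> and
  \<open>j + 1\<close> and has outer normal \<open>cis (pi / 2 - j * pi / n)\<close>: side \<open>0\<close> is the upper horizontal side
  and side \<open>j + n\<close> is opposite to side \<open>j\<close>.
\<close>

definition vertex :: "nat \<Rightarrow> real \<Rightarrow> nat \<Rightarrow> complex" where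
  "vertex n R j = of_real R * cis (pi / 2 + pi / (2 * real n) - real j * pi / real n)"

definition ngon :: "nat \<Rightarrow> real \<Rightarrow> complex set" where
  "ngon n R = convex hull (vertex n R ` {..<2 * n})"

definition side :: "nat \<Rightarrow> real \<Rightarrow> nat \<Rightarrow> complex set" where
  "side n R j = closed_segment (vertex n R j) (vertex n R (Suc j))"

definition open_side :: "nat \<Rightarrow> real \<Rightarrow> nat \<Rightarrow> complex set" where
  "open_side n R j = open_segment (vertex n R j) (vertex n R (Suc j))"

text \<open>The label \<open>L\<^sub>l\<close> is represented by the number \<open>l \<in> {1..n}\<close>.\<close>

definition side_label :: "nat \<Rightarrow> nat \<Rightarrow> nat" where
  "side_label n j = j mod n + 1"

text \<open>
  Twice the midpoint of side \<open>j\<close>, i.e. the vector from the opposite side to side \<open>j\<close>.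
\<close>

definition side_translation :: "nat \<Rightarrow> real \<Rightarrow> nat \<Rightarrow> complex" where
  "side_translation n R j = vertex n R j + vertex n R (Suc j)"


subsection \<open>Linear trajectories and cutting sequences\<close>

text \<open>
  \<open>p\<close> is the position as a function of time and \<open>t\<close> the increasing enumeration of the times at which
  a side is hit. At such a time \<open>p\<close> takes the value at the re-entry point. Since side \<open>j\<close> is hit in
  its relative interior, vertices are excluded; since the intervals \<open>[t k, t (k + 1))\<close> cover
  the real line, the trajectory is defined for all times.
\<close>

definition linear_trajectory ::
  "nat \<Rightarrow> real \<Rightarrow> real \<Rightarrow> (real \<Rightarrow> complex) \<Rightarrow> (int \<Rightarrow> real) \<Rightarrow> bool" where
  "linear_trajectory n R \<theta> p t \<longleftrightarrow>
     strict_mono t \<and> (\<forall>s. \<exists>k. t k \<le> s \<and> s < t (k + 1)) \<and>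
     (\<exists>v>0. \<forall>k.
        (\<forall>s. t k < s \<and> s < t (k + 1) \<longrightarrow>
           p s = p (t k) + of_real (v * (s - t k)) * cis \<theta> \<and> p s \<in> interior (ngon n R)) \<and>
        (\<exists>j<2 * n. \<exists>q\<in>open_side n R j.
           q = p (t k) + of_real (v * (t (k + 1) - t k)) * cis \<theta> \<and>
           p (t (k + 1)) = q - side_translation n R j))"

text \<open>
  The exit side and the re-entry side carry the same label, so the label crossed at time \<open>t k\<close> can be
  read off from \<open>p (t k)\<close>. Shifting the enumeration \<open>t\<close> shifts \<open>w\<close>; quantifying over \<open>t\<close> therefore
  takes cutting sequences up to shift.
\<close>

definition cutting_sequence ::
  "nat \<Rightarrow> real \<Rightarrow> (real \<Rightarrow> complex) \<Rightarrow> (int \<Rightarrow> real) \<Rightarrow> (int \<Rightarrow> nat) \<Rightarrow> bool" where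
  "cutting_sequence n R p t w \<longleftrightarrow>
     (\<forall>k. \<exists>j<2 * n. p (t k) \<in> side n R j \<and> w k = side_label n j)"

definition periodic_word :: "(int \<Rightarrow> 'a) \<Rightarrow> bool" where
  "periodic_word w \<longleftrightarrow> (\<exists>m>0. \<forall>k. w (k + m) = w k)"


subsection \<open>Diagrams\<close>

definition sector_isometry :: "nat \<Rightarrow> nat \<Rightarrow> complex \<Rightarrow> complex" where
  "sector_isometry n i z =
     (if even i then cis (- (real i * pi / (2 * real n))) * z
      else cis ((real i + 1) * pi / (2 * real n)) * cnj z)"

definition label_perm :: "nat \<Rightarrow> real \<Rightarrow> nat \<Rightarrow> nat \<Rightarrow> nat" where
  "label_perm n R i l =
     (THE l'. \<forall>j<2 * n. side_label n j = l \<longrightarrow>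
        (\<exists>j'<2 * n. side_label n j' = l' \<and> sector_isometry n i ` side n R j = side n R j'))"

definition admissible0 :: "nat \<Rightarrow> (int \<Rightarrow> nat) \<Rightarrow> bool" where
  "admissible0 n w \<longleftrightarrow> (\<forall>k. w k + w (k + 1) \<in> {n + 1, n + 2})"

definition admissible :: "nat \<Rightarrow> real \<Rightarrow> nat \<Rightarrow> (int \<Rightarrow> nat) \<Rightarrow> bool" where
  "admissible n R i w \<longleftrightarrow> admissible0 n (label_perm n R i \<circ> w)"


subsection \<open>Derivation\<close>

definition sandwiched :: "(int \<Rightarrow> 'a) \<Rightarrow> int set" where
  "sandwiched w = {k. w (k - 1) = w (k + 1)}"

text \<open>
  \<open>w'\<close> is the bi-infinite word of sandwiched letters of \<open>w\<close>, read in order. It is unique up to shift,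
  and it exists iff the sandwiched positions are unbounded in both directions.
\<close>

definition derived_sequence :: "(int \<Rightarrow> 'a) \<Rightarrow> (int \<Rightarrow> 'a) \<Rightarrow> bool" where
  "derived_sequence w w' \<longleftrightarrow>
     (\<exists>f :: int \<Rightarrow> int. strict_mono f \<and> range f = sandwiched w \<and> w' = w \<circ> f)"


subsection \<open>The Farey map and itineraries\<close>

text \<open>The action of the matrix with rows \<open>(-1, 2 cot (pi / 2n))\<close> and \<open>(0, 1)\<close>.\<close>

definition farey_matrix :: "nat \<Rightarrow> complex \<Rightarrow> complex" where
  "farey_matrix n z = Complex (- Re z + 2 * cot (pi / (2 * real n)) * Im z) (Im z)"

definition closed_sector :: "nat \<Rightarrow> nat \<Rightarrow> real set" where
  "closed_sector n i = {real i * pi / (2 * real n) .. (real i + 1) * pi / (2 * real n)}"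

definition farey_map :: "nat \<Rightarrow> real \<Rightarrow> real" where
  "farey_map n \<theta> =
     (THE \<phi>. 0 < \<phi> \<and> \<phi> \<le> pi \<and>
        (\<forall>i<2 * n. \<theta> \<in> closed_sector n i \<longrightarrow>
           (\<exists>c::real. c \<noteq> 0 \<and>
              farey_matrix n (sector_isometry n i (cis \<theta>)) = of_real c * cis \<phi>)))"

definition sector :: "nat \<Rightarrow> nat \<Rightarrow> real set" where
  "sector n i =
     (if Suc i = 2 * n then {real i * pi / (2 * real n) .. pi}
      else {real i * pi / (2 * real n) ..< (real i + 1) * pi / (2 * real n)})"

definition itinerary :: "nat \<Rightarrow> real \<Rightarrow> (nat \<Rightarrow> nat) \<Rightarrow> bool" where
  "itinerary n \<theta> s \<longleftrightarrow> (\<forall>j. s j < 2 * n \<and> (farey_map n ^^ j) \<theta> \<in> sector n (s j))"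

end

theory Submission
  imports Defs
begin

text \<open>
  A trajectory is recorded by the word of labels that it crosses together with the offsets, the signed
  transversal distances at which it passes the midpoints of the crossed sides. Offsets and letters
  satisfy a linear recurrence whose coefficients depend on the direction (\<open>trajectory_codes\<close>), and from
  then on only this recurrence is used. In a direction strictly between \<open>0\<close> and \<open>\<pi> / 2n\<close> it allows only pairs
  of consecutive letters with sum \<open>n + 1\<close> or \<open>n + 2\<close>, that is, those of diagram \<open>0\<close>. On the boundary of the
  sector only one of the two sums is left and the word has period two. With the dihedral symmetry
  of the polygon, a nonperiodic word has its direction inside a sector and is admissible in the diagram
  of that sector.

  Why deriving a word applies the Farey map to the direction: the Farey matrix is the derivative of an affine
  automorphism of the surface that fixes the midpoints of the sides. A sandwiched letter is crossed so
  close to the midpoint that the trajectory also crosses, near the same midpoint, the segment that the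
  automorphism maps to the side with this label. In the recurrence this is
  a pair of trigonometric identities (\<open>pair_width_farey\<close>, \<open>pair_centres_farey\<close>): the sandwiched letters,
  with the negatives of their offsets, satisfy the recurrence of the image direction (\<open>derived_codes\<close>).
  Offsets and letters determine past and future, and bounded offsets over a periodic word are periodic, so
  that derived words of nonperiodic words are nonperiodic. Renormalization can be iterated forever.

  The diagram is unique for the following reason. Counting labels from zero, diagram \<open>i\<close> restricts the sums of
  consecutive letters to \<open>- i\<close> and \<open>- i - 1\<close> modulo \<open>n\<close>. Two diagrams whose indices differ modulo \<open>n\<close> share at most
  one residue, which would make the word periodic. The diagrams \<open>i\<close> and \<open>i + n\<close> differ only in their
  loops, and a nonperiodic word does contain a doubled letter (\<open>double_letter_occurs\<close>): otherwise the
  alphabets of its renormalizations stabilize and the direction is eventually moved by powers of a single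
  parabolic map, which drive it out of the base sector.

  An itinerary determines the direction (\<open>itinerary_injective\<close>). Two vectors that follow the same itinerary
  are moved by the same linear maps of determinant \<open>\<plusminus>1\<close>. Their cross product keeps its absolute value while
  their inner product, which is nonnegative, decreases at every step by at least a fixed multiple of
  it. So the cross product vanishes. Finally the unique diagrams of the renormalized words are the sectors
  visited by the direction of any trajectory with that word (\<open>itinerary_of_coding\<close>).
\<close>

section \<open>Codings by signed offsets\<close>

text \<open>
  The outer normal of a side labelled \<open>l\<close> has direction \<open>\<plusminus>\<i>\<close> times the conjugate of this number.
  Hence, for a unit vector \<open>v\<close> and up to a common sign, the imaginary part of \<open>v * letter_dir n l\<close>
  is the component of \<open>v\<close> along that normal, and the real part is the signed distance of the tip of the
  unit normal from the line through the centre in direction \<open>v\<close>.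
\<close>

definition letter_dir :: "nat \<Rightarrow> nat \<Rightarrow> complex" where
  "letter_dir n l = cis ((real l - 1) * pi / real n)"

text \<open>
  Of the two opposite sides with a given label, a trajectory leaves the polygon through the one whose
  outer normal has positive component along its direction; the sign selects this side.
\<close>

definition centre :: "complex \<Rightarrow> real" where
  "centre z = sgn (Im z) * Re z"

text \<open>
  The word \<open>w\<close> read off from a trajectory in direction \<open>v\<close> together with the offsets \<open>\<delta> k\<close>, the signed
  distances, transversally to \<open>v\<close> and in units of the apothem, at which the trajectory passes the
  midpoint of the \<open>k\<close>-th side that it crosses. The second clause says that it stays within that side.
  The third holds because the transversal coordinate is constant inside the polygon and drops by twice
  that of the midpoint when the trajectory passes to the opposite side. These are the orbits of
  an exchange of \<open>n\<close> intervals with the order of the intervals reversed.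
\<close>

definition codes :: "nat \<Rightarrow> complex \<Rightarrow> (int \<Rightarrow> nat) \<Rightarrow> (int \<Rightarrow> real) \<Rightarrow> bool" where
  "codes n v w \<delta> \<longleftrightarrow>
     (\<forall>k. w k \<in> {1..n} \<and>
          \<bar>\<delta> k\<bar> < tan (pi / (2 * real n)) * \<bar>Im (v * letter_dir n (w k))\<bar> \<and>
          \<delta> k - \<delta> (k + 1) = centre (v * letter_dir n (w k)) + centre (v * letter_dir n (w (k + 1))))"

text \<open>
  The directions strictly between \<open>0\<close> and \<open>pi / (2 * real n)\<close>, written linearly so that no angle has
  to be extracted from the image of a vector under the Farey matrix.
\<close>

definition base_cone :: "nat \<Rightarrow> complex \<Rightarrow> bool" where
  "base_cone n u \<longleftrightarrow> 0 < Im u \<and> cot (pi / (2 * real n)) * Im u < Re u"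

lemma codesD:
  assumes "codes n v w \<delta>"
  shows "w k \<in> {1..n}"
    and "\<bar>\<delta> k\<bar> < tan (pi / (2 * real n)) * \<bar>Im (v * letter_dir n (w k))\<bar>"
    and "\<delta> k - \<delta> (k + 1) = centre (v * letter_dir n (w k)) + centre (v * letter_dir n (w (k + 1)))"
  using assms unfolding codes_def by blast+

lemma half_angle_bounds:
  assumes "n \<ge> 3"
  shows "0 < pi / (2 * real n)" "pi / (2 * real n) < pi / 4"
    "0 < sin (pi / (2 * real n))" "0 < cos (pi / (2 * real n))"
    "0 < tan (pi / (2 * real n))" "0 < cot (pi / (2 * real n))"
proof -
  have n: "real n \<ge> 3" using assms by simp
  show 1: "0 < pi / (2 * real n)" using n by simp
  show 2: "pi / (2 * real n) < pi / 4"
    using n pi_gt_zero by (intro divide_strict_left_mono) auto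
  show s: "0 < sin (pi / (2 * real n))" using 1 2 pi_gt_zero by (intro sin_gt_zero) linarith+
  show c: "0 < cos (pi / (2 * real n))" using 1 2 pi_gt_zero by (intro cos_gt_zero) linarith+
  show "0 < tan (pi / (2 * real n))" "0 < cot (pi / (2 * real n))"
    using s c by (auto simp: tan_def cot_def)
qed

lemma centre_minus [simp]: "centre (- z) = centre z"
  by (simp add: centre_def sgn_minus)

lemma centre_cnj: "centre (cnj z) = - centre z"
  by (simp add: centre_def sgn_minus)

text \<open>
  A trajectory and its image under rotation by \<open>\<pi>\<close> cross sides with the same labels at the same
  offsets from the midpoints.
\<close>

lemma codes_minus: "codes n (- v) w \<delta> = codes n v w \<delta>"
  unfolding codes_def mult_minus_left centre_minus uminus_complex.sel abs_minus_cancel ..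

text \<open>
  Running a trajectory backwards reverses its word; rotating by \<open>\<pi>\<close> restores the direction and
  changes the sign of the offsets. Statements about the past thus follow from those about the future.
\<close>

lemma codes_reverse:
  assumes "codes n v w \<delta>"
  shows "codes n v (\<lambda>k. w (- k)) (\<lambda>k. - \<delta> (- k))"
proof -
  have "- \<delta> (- k) + \<delta> (- (k + 1))
      = centre (v * letter_dir n (w (- k))) + centre (v * letter_dir n (w (- (k + 1))))" for k
    using codesD(3)[OF assms, of "- k - 1"] by simp
  then show ?thesis using codesD(1,2)[OF assms] unfolding codes_def by simp
qed

section \<open>Transitions in the base sector\<close>

text \<open>
  The only pairs of letters that can follow each other in the base sector have sum \<open>n + 1\<close> or \<open>n + 2\<close>.
  For such a pair the two angles are mirror images of each other, about \<open>pi / 2 - pi / (2 * real n)\<close>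
  in the first case and about \<open>pi / 2\<close> in the second, and sums over the pair factorize.
\<close>

lemma letter_dir_pair_lower:
  assumes "n \<ge> 3" "l + m = n + 1" "l \<le> n" "m \<le> n"
  defines "x \<equiv> (real l - 1) * pi / real n" and "b \<equiv> pi / (2 * real n)"
  shows "letter_dir n m = cis (pi - 2 * b - x)"
    and "0 < sin (x + b)"
    and "Re (z * letter_dir n l) + Re (z * letter_dir n m) = 2 * sin (x + b) * (Re z * sin b - Im z * cos b)"
    and "Im (z * letter_dir n l) + Im (z * letter_dir n m) = 2 * sin (x + b) * (Im z * sin b + Re z * cos b)"
proof -
  have n: "real n > 0" using assms(1) by simp
  have m: "real m = real n + 1 - real l" using assms(2) by linarith
  have "(real m - 1) * pi / real n = pi - 2 * b - x"
    using n by (simp add: m x_def b_def field_simps)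
  then show e: "letter_dir n m = cis (pi - 2 * b - x)" by (simp add: letter_dir_def)
  have l: "real l \<ge> 1" "real l \<le> real n" using assms by auto
  have eq: "x + b = (2 * real l - 1) * b" using n by (simp add: x_def b_def field_simps)
  have b: "0 < b" unfolding b_def using half_angle_bounds(1)[OF assms(1)] .
  have "(2 * real l - 1) * b < 2 * real n * b"
    using l b by (intro mult_strict_right_mono) auto
  also have "\<dots> = pi" using n by (simp add: b_def)
  finally show "0 < sin (x + b)" using l b unfolding eq by (intro sin_gt_zero) auto
  have c: "cos x + cos (pi - 2 * b - x) = 2 * sin (x + b) * sin b"
  proof -
    have "cos (pi - 2 * b - x) = cos (pi - ((x + b) + b))" by (simp add: algebra_simps)
    also have "\<dots> = - (cos (x + b) * cos b - sin (x + b) * sin b)"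
      by (simp only: cos_pi_minus cos_add[of "x + b" b])
    finally show ?thesis using cos_diff[of "x + b" b] by (simp only: add_diff_cancel_right')
  qed
  have s: "sin x + sin (pi - 2 * b - x) = 2 * sin (x + b) * cos b"
  proof -
    have "sin (pi - 2 * b - x) = sin (pi - ((x + b) + b))" by (simp add: algebra_simps)
    also have "\<dots> = sin (x + b) * cos b + cos (x + b) * sin b"
      by (simp only: sin_pi_minus sin_add[of "x + b" b])
    finally show ?thesis using sin_diff[of "x + b" b] by (simp only: add_diff_cancel_right')
  qed
  have "Re (z * letter_dir n l) + Re (z * letter_dir n m)
      = Re z * (cos x + cos (pi - 2 * b - x)) - Im z * (sin x + sin (pi - 2 * b - x))"
    unfolding e by (simp add: letter_dir_def x_def algebra_simps)
  then show "Re (z * letter_dir n l) + Re (z * letter_dir n m) = 2 * sin (x + b) * (Re z * sin b - Im z * cos b)"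
    unfolding c s by (simp add: algebra_simps)
  have "Im (z * letter_dir n l) + Im (z * letter_dir n m)
      = Im z * (cos x + cos (pi - 2 * b - x)) + Re z * (sin x + sin (pi - 2 * b - x))"
    unfolding e by (simp add: letter_dir_def x_def algebra_simps)
  then show "Im (z * letter_dir n l) + Im (z * letter_dir n m) = 2 * sin (x + b) * (Im z * sin b + Re z * cos b)"
    unfolding c s by (simp add: algebra_simps)
qed

lemma letter_dir_pair_upper:
  assumes "n \<ge> 3" "l + m = n + 2" "l \<le> n" "m \<le> n"
  defines "x \<equiv> (real l - 1) * pi / real n"
  shows "letter_dir n m = cis (pi - x)"
    and "0 < sin x"
    and "Re (z * letter_dir n l) + Re (z * letter_dir n m) = - 2 * Im z * sin x"
    and "Im (z * letter_dir n l) + Im (z * letter_dir n m) = 2 * Re z * sin x"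
proof -
  have n: "real n > 0" using assms(1) by simp
  have m: "real m = real n + 2 - real l" using assms(2) by linarith
  have "(real m - 1) * pi / real n = pi - x"
    using n by (simp add: m x_def field_simps)
  then show e: "letter_dir n m = cis (pi - x)" by (simp add: letter_dir_def)
  have l: "real l \<ge> 2" "real l \<le> real n" using assms by auto
  show "0 < sin x" unfolding x_def using l n
    by (intro sin_gt_zero) (auto simp: field_simps add_strict_increasing)
  show "Re (z * letter_dir n l) + Re (z * letter_dir n m) = - 2 * Im z * sin x"
    unfolding e by (simp add: letter_dir_def x_def)
  show "Im (z * letter_dir n l) + Im (z * letter_dir n m) = 2 * Re z * sin x"
    unfolding e by (simp add: letter_dir_def x_def)
qed

lemma letter_angle_bounds:
  assumes "n \<ge> 3" "l \<in> {1..n}"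
  shows "0 \<le> (real l - 1) * pi / real n"
    "(real l - 1) * pi / real n \<le> pi - 2 * (pi / (2 * real n))"
proof -
  show "0 \<le> (real l - 1) * pi / real n" using assms by simp
  have "(real l - 1) * pi / real n \<le> (real n - 1) * pi / real n"
    using assms by (intro divide_right_mono mult_right_mono) auto
  also have "\<dots> = pi - 2 * (pi / (2 * real n))" using assms by (simp add: field_simps)
  finally show "(real l - 1) * pi / real n \<le> pi - 2 * (pi / (2 * real n))" .
qed

lemma Im_letter_dir_pos:
  assumes n: "n \<ge> 3" and l: "l \<in> {1..n}" and u: "base_cone n u"
  shows "0 < Im (u * letter_dir n l)"
proof -
  define x where "x = (real l - 1) * pi / real n"
  define b where "b = pi / (2 * real n)"
  note b = half_angle_bounds[OF n, folded b_def]
  have x: "0 \<le> x" "x \<le> pi - 2 * b"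
    using letter_angle_bounds[OF n l] by (auto simp: x_def b_def)
  have sx: "0 \<le> sin x" using x b by (intro sin_ge_zero) auto
  have sxb: "0 < sin (x + b)" using x b by (intro sin_gt_zero) auto
  have Y: "0 < Im u" and XY: "cot b * Im u < Re u" using u by (auto simp: base_cone_def b_def)
  have "0 < Im u * (sin (x + b) / sin b)" using Y sxb b by simp
  also have "\<dots> = Im u * cos x + cot b * Im u * sin x"
    using b by (simp add: sin_add cot_def field_simps)
  also have "\<dots> \<le> Im u * cos x + Re u * sin x"
    using mult_right_mono[OF less_imp_le[OF XY] sx] by simp
  finally show ?thesis by (simp add: letter_dir_def x_def algebra_simps)
qed

lemma base_cone_cis:
  assumes n: "n \<ge> 3" and c: "0 < c" and \<theta>: "- pi < \<theta>" "\<theta> \<le> pi"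
  shows "base_cone n (of_real c * cis \<theta>) \<longleftrightarrow> 0 < \<theta> \<and> \<theta> < pi / (2 * real n)"
proof -
  define b where "b = pi / (2 * real n)"
  note b = half_angle_bounds[OF n, folded b_def]
  have "base_cone n (of_real c * cis \<theta>) \<longleftrightarrow> 0 < sin \<theta> \<and> cot b * sin \<theta> < cos \<theta>"
    using c by (simp add: base_cone_def b_def zero_less_mult_iff mult.left_commute)
  also have "\<dots> \<longleftrightarrow> 0 < sin \<theta> \<and> 0 < sin (b - \<theta>)"
    using b by (simp add: cot_def field_simps sin_diff)
  also have "\<dots> \<longleftrightarrow> 0 < \<theta> \<and> \<theta> < b"
  proof safe
    assume s: "0 < sin \<theta>" "0 < sin (b - \<theta>)"
    show t: "0 < \<theta>"
    proof (rule ccontr)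
      assume "\<not> 0 < \<theta>"
      then have "sin \<theta> \<le> 0" using \<theta> sin_ge_zero[of "-\<theta>"] by simp
      then show False using s by simp
    qed
    show "\<theta> < b"
    proof (rule ccontr)
      assume "\<not> \<theta> < b"
      then have "0 \<le> sin (\<theta> - b)" using \<theta> b by (intro sin_ge_zero) auto
      then show False using s sin_minus[of "b - \<theta>"] by simp
    qed
  next
    assume "0 < \<theta>" "\<theta> < b"
    then show "0 < sin \<theta>" "0 < sin (b - \<theta>)" using b by (auto intro!: sin_gt_zero)
  qed
  finally show ?thesis by (simp add: b_def)
qed

lemma base_cone_polar:
  assumes n: "n \<ge> 3" and u: "base_cone n u"
  obtains c \<theta> where "0 < c" "0 < \<theta>" "\<theta> < pi / (2 * real n)" "u = of_real c * cis \<theta>"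
proof -
  have "u \<noteq> 0" using u by (auto simp: base_cone_def)
  then have eq: "u = of_real (cmod u) * cis (Arg u)" and c: "0 < cmod u"
    by (simp_all add: cis_Arg sgn_eq)
  have "base_cone n (of_real (cmod u) * cis (Arg u))" using u eq by simp
  then have "0 < Arg u \<and> Arg u < pi / (2 * real n)"
    using base_cone_cis[OF n c, of "Arg u"] mpi_less_Arg[of u] Arg_le_pi[of u] by blast
  then show ?thesis using that c eq by blast
qed

text \<open>
  The offsets before and after a transition from \<open>l\<close> to \<open>m\<close> differ by the sum of the two centres and
  are bounded by the two half-widths. By the sum-to-product formulas both sums contain the
  same positive factor, and with \<open>\<psi>\<close> the mean of the two angles plus \<open>\<theta>\<close> what remains is
  \<open>\<bar>cos \<psi>\<bar> < tan \<beta> * sin \<psi>\<close> for \<open>\<beta> = pi / (2 * real n)\<close>, that is, \<open>\<psi>\<close> lies within \<open>\<beta>\<close> of the right angle.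
  Since \<open>\<psi> = (l + m - 2) * \<beta> + \<theta>\<close>, this pins down \<open>l + m\<close>.
\<close>

lemma transition_angle:
  assumes n: "n \<ge> 3" and c: "0 < c"
    and \<theta>: "0 \<le> \<theta>" "\<theta> \<le> pi / (2 * real n)"
    and w: "codes n (of_real c * cis \<theta>) w \<delta>"
  shows "\<bar>(real (w k) + real (w (k + 1)) - 2 - real n) * (pi / (2 * real n)) + \<theta>\<bar> < pi / (2 * real n)"
proof -
  define b where "b = pi / (2 * real n)"
  note b = half_angle_bounds[OF n, folded b_def]
  define x where "x = (real (w k) - 1) * pi / real n"
  define y where "y = (real (w (k + 1)) - 1) * pi / real n"
  have x: "0 \<le> x" "x \<le> pi - 2 * b" and y: "0 \<le> y" "y \<le> pi - 2 * b"
    using letter_angle_bounds[OF n codesD(1)[OF w]] by (auto simp: x_def y_def b_def)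
  have pos: "0 \<le> sin (x + \<theta>)" "0 \<le> sin (y + \<theta>)"
    using x y \<theta> b by (auto intro!: sin_ge_zero simp: b_def)
  have prod: "of_real c * cis \<theta> * letter_dir n (w k) = of_real c * cis (x + \<theta>)"
    "of_real c * cis \<theta> * letter_dir n (w (k + 1)) = of_real c * cis (y + \<theta>)"
    by (simp_all add: letter_dir_def x_def y_def cis_mult add.commute mult.assoc)
  have d1: "\<bar>\<delta> k\<bar> < tan b * (c * sin (x + \<theta>))"
    using codesD(2)[OF w, of k] pos c unfolding prod by (simp add: b_def abs_mult)
  have d2: "\<bar>\<delta> (k + 1)\<bar> < tan b * (c * sin (y + \<theta>))"
    using codesD(2)[OF w, of "k + 1"] pos c unfolding prod by (simp add: b_def abs_mult)
  have sp: "0 < sin (x + \<theta>)" "0 < sin (y + \<theta>)"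
    using d1 d2 pos by (auto simp: less_le)
  have d3: "\<delta> k - \<delta> (k + 1) = c * cos (x + \<theta>) + c * cos (y + \<theta>)"
    using codesD(3)[OF w, of k] sp c unfolding prod by (simp add: centre_def sgn_mult)
  define \<psi> where "\<psi> = (x + y) / 2 + \<theta>"
  have cD: "0 < cos ((x - y) / 2)"
    using x y b by (intro cos_gt_zero_pi) auto
  have cs: "cos (x + \<theta>) + cos (y + \<theta>) = 2 * cos \<psi> * cos ((x - y) / 2)"
    unfolding cos_plus_cos \<psi>_def by (simp add: field_simps)
  have ss: "sin (x + \<theta>) + sin (y + \<theta>) = 2 * sin \<psi> * cos ((x - y) / 2)"
    unfolding sin_plus_sin \<psi>_def by (simp add: field_simps)
  have "\<bar>c * (cos (x + \<theta>) + cos (y + \<theta>))\<bar> < tan b * (c * (sin (x + \<theta>) + sin (y + \<theta>)))"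
    using d1 d2 d3 by (simp add: distrib_left)
  then have "(2 * c * cos ((x - y) / 2)) * \<bar>cos \<psi>\<bar> < (2 * c * cos ((x - y) / 2)) * (tan b * sin \<psi>)"
    unfolding cs ss using c cD by (simp add: abs_mult mult_ac)
  then have "\<bar>cos \<psi>\<bar> < tan b * sin \<psi>" using c cD by (simp only: mult_less_cancel_left_pos mult_pos_pos zero_less_numeral)
  then have *: "\<bar>cos \<psi>\<bar> * cos b < sin b * sin \<psi>" using b by (simp add: tan_def field_simps)
  have \<psi>: "0 \<le> \<psi>" using x y \<theta> by (simp add: \<psi>_def)
  have \<psi>': "\<psi> \<le> pi - b"
  proof -
    have "\<psi> = x / 2 + y / 2 + \<theta>" by (simp add: \<psi>_def add_divide_distrib)
    moreover have "x / 2 \<le> pi / 2 - b" "y / 2 \<le> pi / 2 - b" using x y by simp_all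
    moreover have "\<theta> \<le> b" using \<theta> by (simp add: b_def)
    ultimately show ?thesis by linarith
  qed
  note \<psi> = \<psi> \<psi>'
  have "cos \<psi> * cos b \<le> \<bar>cos \<psi>\<bar> * cos b" "- cos \<psi> * cos b \<le> \<bar>cos \<psi>\<bar> * cos b"
    using b mult_right_mono[OF abs_ge_self, of "cos b" "cos \<psi>"]
      mult_right_mono[OF abs_ge_minus_self, of "cos b" "cos \<psi>"] by linarith+
  then have neg: "cos (\<psi> + b) < 0" and pos': "0 < cos (\<psi> - b)"
    using * by (auto simp: cos_add cos_diff mult.commute)
  have "pi / 2 < \<psi> + b"
  proof (rule ccontr)
    assume "\<not> pi / 2 < \<psi> + b"
    then have "0 \<le> cos (\<psi> + b)" using \<psi> b by (intro cos_ge_zero) auto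
    then show False using neg by simp
  qed
  moreover have "\<psi> - b < pi / 2"
  proof (rule ccontr)
    assume "\<not> \<psi> - b < pi / 2"
    then have "0 \<le> cos (pi - (\<psi> - b))" using \<psi> b by (intro cos_ge_zero) auto
    then show False using pos' by simp
  qed
  moreover have "(real (w k) + real (w (k + 1)) - 2 - real n) * b + \<theta> = \<psi> - pi / 2"
    using n by (simp add: \<psi>_def x_def y_def b_def field_simps)
  ultimately show ?thesis unfolding b_def[symmetric] by (auto simp: abs_less_iff)
qed

lemma transition_sums:
  assumes n: "n \<ge> 3" and u: "base_cone n u" and w: "codes n u w \<delta>"
  shows "w k + w (k + 1) = n + 1 \<or> w k + w (k + 1) = n + 2"
proof -
  obtain c \<theta> where c: "0 < c" "0 < \<theta>" "\<theta> < pi / (2 * real n)" "u = of_real c * cis \<theta>"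
    using base_cone_polar[OF n u] .
  define b where "b = pi / (2 * real n)"
  have b: "0 < b" using half_angle_bounds[OF n] by (simp add: b_def)
  define j :: int where "j = int (w k) + int (w (k + 1)) - 2 - int n"
  have "\<bar>of_int j * b + \<theta>\<bar> < b"
    using transition_angle[of n c \<theta> w \<delta> k] n c w by (simp add: j_def b_def)
  then have 1: "of_int j * b < 1 * b" "(-2) * b < of_int j * b" using c by (auto simp: b_def abs_less_iff)
  have "real_of_int j < 1" "-2 < real_of_int j"
    using 1 b by (simp_all only: mult_less_cancel_right_pos)
  then have "j = 0 \<or> j = -1" by linarith
  then show ?thesis unfolding j_def by linarith
qed

text \<open>
  On the boundary of the sector a single value of the sum of consecutive letters remains, so the word
  alternates between two letters.
\<close>

lemma boundary_direction_periodic: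
  assumes n: "n \<ge> 3" and c: "0 < c" and \<theta>: "\<theta> = 0 \<or> \<theta> = pi / (2 * real n)"
    and w: "codes n (of_real c * cis \<theta>) w \<delta>"
  shows "periodic_word w"
proof -
  define b where "b = pi / (2 * real n)"
  have b: "0 < b" using half_angle_bounds[OF n] by (simp add: b_def)
  define s where "s = (if \<theta> = 0 then n + 2 else n + 1)"
  have "w k + w (k + 1) = s" for k
  proof -
    define j :: int where "j = int (w k) + int (w (k + 1)) - 2 - int n"
    have 1: "\<bar>of_int j * b + \<theta>\<bar> < b"
      using transition_angle[of n c \<theta> w \<delta> k] n c w \<theta> b by (auto simp: j_def b_def)
    show ?thesis
    proof (cases "\<theta> = 0")
      case True
      then have "real_of_int j * b < 1 * b" "(-1) * b < of_int j * b" using 1 by (auto simp: abs_less_iff)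
      then have "real_of_int j < 1" "-1 < real_of_int j" using b by (simp_all only: mult_less_cancel_right_pos)
      then show ?thesis using True by (simp add: j_def s_def)
    next
      case False
      then have "real_of_int j * b < 0 * b" "(-2) * b < of_int j * b" using 1 \<theta> by (auto simp: abs_less_iff b_def)
      then have "real_of_int j < 0" "-2 < real_of_int j" using b by (simp_all only: mult_less_cancel_right_pos)
      then show ?thesis using False by (simp add: j_def s_def)
    qed
  qed
  then have "w (k + 2) = w k" for k
    by (metis (no_types, lifting) add.commute add.assoc add_left_cancel one_add_one)
  then show ?thesis unfolding periodic_word_def by (intro exI[of _ 2]) simp
qed

section \<open>Derivation is renormalization by the Farey matrix\<close>

text \<open>
  The Farey matrix is the derivative of an affine automorphism of the surface: reflect the polygon in
  the vertical axis and apply a Dehn twist in each horizontal cylinder (a double one in the cylinder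
  formed by the middle strip if \<open>n\<close> is even). The automorphism fixes the midpoints of all sides. Comparing
  displacements between midpoints before and after gives these identities. The signs on the right are
  opposite to those of the normal components of the image direction at sandwiched letters
  of the two kinds, in accordance with the change of sign of the offsets.
\<close>

lemma pair_centres_farey:
  assumes n: "n \<ge> 3" and lm: "l \<in> {1..n}" "m \<in> {1..n}"
  shows "l + m = n + 1 \<Longrightarrow> Re (u * letter_dir n l) + Re (u * letter_dir n m)
      = - (Re (farey_matrix n u * letter_dir n l) + Re (farey_matrix n u * letter_dir n m))"
    and "l + m = n + 2 \<Longrightarrow> Re (u * letter_dir n l) + Re (u * letter_dir n m)
      = Re (farey_matrix n u * letter_dir n l) + Re (farey_matrix n u * letter_dir n m)"
proof -
  define b where "b = pi / (2 * real n)"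
  note b = half_angle_bounds[OF n, folded b_def]
  have f: "Re (farey_matrix n u) = 2 * cot b * Im u - Re u" "Im (farey_matrix n u) = Im u"
    by (simp_all add: farey_matrix_def b_def)
  show "Re (u * letter_dir n l) + Re (u * letter_dir n m)
      = - (Re (farey_matrix n u * letter_dir n l) + Re (farey_matrix n u * letter_dir n m))"
    if "l + m = n + 1"
  proof -
    have ln: "l \<le> n" "m \<le> n" using lm by auto
    show ?thesis
      unfolding letter_dir_pair_lower(3)[OF n that ln] b_def[symmetric] f
      using b by (simp add: cot_def field_simps)
  qed
  show "Re (u * letter_dir n l) + Re (u * letter_dir n m)
      = Re (farey_matrix n u * letter_dir n l) + Re (farey_matrix n u * letter_dir n m)"
    if "l + m = n + 2"
  proof -
    have ln: "l \<le> n" "m \<le> n" using lm by auto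
    show ?thesis unfolding letter_dir_pair_upper(3)[OF n that ln] f ..
  qed
qed

text \<open>
  A letter \<open>l\<close> between two occurrences of \<open>m\<close> is crossed at an offset at most the half-width of \<open>m\<close>
  minus the absolute displacement of the transition. This bound is the half-width of \<open>l\<close> for
  the image direction.
\<close>

lemma pair_width_farey:
  assumes n: "n \<ge> 3" and lm: "l \<in> {1..n}" "m \<in> {1..n}"
  defines "t \<equiv> tan (pi / (2 * real n))"
  shows "l + m = n + 1 \<Longrightarrow> t * Im (u * letter_dir n m) - (Re (u * letter_dir n l) + Re (u * letter_dir n m))
      = t * Im (farey_matrix n u * letter_dir n l)"
    and "l + m = n + 2 \<Longrightarrow> t * Im (u * letter_dir n m) + (Re (u * letter_dir n l) + Re (u * letter_dir n m))
      = - t * Im (farey_matrix n u * letter_dir n l)"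
proof -
  define b where "b = pi / (2 * real n)"
  define x where "x = (real l - 1) * pi / real n"
  note b = half_angle_bounds[OF n, folded b_def]
  have f: "Im (farey_matrix n u * letter_dir n l) = (2 * cot b * Im u - Re u) * sin x + Im u * cos x"
    by (simp add: farey_matrix_def b_def letter_dir_def x_def)
  have l: "Im (u * letter_dir n l) = Im u * cos x + Re u * sin x"
    by (simp add: letter_dir_def x_def)
  show "t * Im (u * letter_dir n m) - (Re (u * letter_dir n l) + Re (u * letter_dir n m))
      = t * Im (farey_matrix n u * letter_dir n l)" if "l + m = n + 1"
  proof -
    have ln: "l \<le> n" "m \<le> n" using lm by auto
    note p = letter_dir_pair_lower[OF n that ln, folded x_def b_def]
    have m: "Im (u * letter_dir n m) = 2 * sin (x + b) * (Im u * sin b + Re u * cos b)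
        - (Im u * cos x + Re u * sin x)"
      using p(4)[of u] l by linarith
    have "sin b * (2 * sin (x + b) * (Im u * sin b + Re u * cos b) - (Im u * cos x + Re u * sin x))
        - cos b * (2 * sin (x + b) * (Re u * sin b - Im u * cos b))
        = 2 * sin (x + b) * Im u * ((sin b)\<^sup>2 + (cos b)\<^sup>2) - sin b * (Im u * cos x + Re u * sin x)"
      unfolding power2_eq_square by (simp add: algebra_simps del: sin_cos_squared_add3)
    also have "\<dots> = 2 * cos b * Im u * sin x + sin b * (Im u * cos x - Re u * sin x)"
      by (simp add: sin_add algebra_simps)
    finally have "sin b * Im (u * letter_dir n m) - cos b * (Re (u * letter_dir n l) + Re (u * letter_dir n m))
        = 2 * cos b * Im u * sin x + sin b * (Im u * cos x - Re u * sin x)"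
      unfolding m p(3) .
    also have "\<dots> = sin b * Im (farey_matrix n u * letter_dir n l)"
      unfolding f using b by (simp add: cot_def field_simps)
    finally have eq: "sin b * Im (u * letter_dir n m)
        - cos b * (Re (u * letter_dir n l) + Re (u * letter_dir n m))
        = sin b * Im (farey_matrix n u * letter_dir n l)" .
    have "p / q * A - B = p / q * F" if "p * A - q * B = p * F" "0 < q" for p q A B F :: real
      using that by (simp add: field_simps)
    from this[OF eq b(4)] show ?thesis unfolding t_def b_def[symmetric] tan_def .
  qed
  show "t * Im (u * letter_dir n m) + (Re (u * letter_dir n l) + Re (u * letter_dir n m))
      = - t * Im (farey_matrix n u * letter_dir n l)" if "l + m = n + 2"
  proof -
    have ln: "l \<le> n" "m \<le> n" using lm by auto
    note p = letter_dir_pair_upper[OF n that ln, folded x_def]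
    have m: "Im (u * letter_dir n m) = 2 * Re u * sin x - (Im u * cos x + Re u * sin x)"
      using p(4)[of u] l by linarith
    show ?thesis unfolding m p(3) f t_def b_def[symmetric] using b
      by (simp add: tan_def cot_def field_simps)
  qed
qed

text \<open>
  Passing from \<open>m\<close> to \<open>l\<close> and on to \<open>m\<close> again displaces the offset twice by the same amount \<open>S\<close>, so the
  offsets \<open>\<delta> k + S\<close> and \<open>\<delta> k - S\<close> both fit into the side labelled \<open>m\<close>. The sign of the new width
  tells through which of the two kinds of transition a sandwiched letter is reached; it depends on the
  letter alone.
\<close>

lemma sandwiched_width:
  assumes n: "n \<ge> 3" and u: "base_cone n u" and w: "codes n u w \<delta>" and k: "k \<in> sandwiched w"
  defines "t \<equiv> tan (pi / (2 * real n))"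
  shows "w k + w (k + 1) = n + 1 \<Longrightarrow> \<bar>\<delta> k\<bar> < t * Im (farey_matrix n u * letter_dir n (w k))"
    and "w k + w (k + 1) = n + 2 \<Longrightarrow> \<bar>\<delta> k\<bar> < - t * Im (farey_matrix n u * letter_dir n (w k))"
proof -
  define S where "S = Re (u * letter_dir n (w k)) + Re (u * letter_dir n (w (k + 1)))"
  have pos: "0 < Im (u * letter_dir n (w j))" for j
    using Im_letter_dir_pos[OF n codesD(1)[OF w] u] .
  have same: "w (k - 1) = w (k + 1)" using k by (simp add: sandwiched_def)
  have "\<delta> k - \<delta> (k + 1) = S"
    using codesD(3)[OF w, of k] pos by (simp add: centre_def S_def)
  moreover have "\<delta> (k - 1) - \<delta> k = S"
    using codesD(3)[OF w, of "k - 1"] pos same by (simp add: centre_def S_def)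
  moreover have "\<bar>\<delta> (k + 1)\<bar> < t * Im (u * letter_dir n (w (k + 1)))"
    "\<bar>\<delta> (k - 1)\<bar> < t * Im (u * letter_dir n (w (k + 1)))"
    using codesD(2)[OF w, of "k + 1"] codesD(2)[OF w, of "k - 1"] pos[of "k + 1"] same
    by (simp_all add: t_def)
  ultimately have *: "\<bar>\<delta> k\<bar> + \<bar>S\<bar> < t * Im (u * letter_dir n (w (k + 1)))" by linarith
  show "\<bar>\<delta> k\<bar> < t * Im (farey_matrix n u * letter_dir n (w k))" if "w k + w (k + 1) = n + 1"
    using * pair_width_farey(1)[OF n codesD(1)[OF w] codesD(1)[OF w] that, of u]
    unfolding S_def t_def by linarith
  show "\<bar>\<delta> k\<bar> < - t * Im (farey_matrix n u * letter_dir n (w k))" if "w k + w (k + 1) = n + 2"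
    using * pair_width_farey(2)[OF n codesD(1)[OF w] codesD(1)[OF w] that, of u]
    unfolding S_def t_def by linarith
qed

lemma int_set_enumeration:
  fixes S :: "int set"
  assumes up: "\<And>k. \<exists>s\<in>S. k < s" and down: "\<And>k. \<exists>s\<in>S. s < k"
  obtains f :: "int \<Rightarrow> int" where "strict_mono f" "range f = S"
proof -
  define P where "P = {m::nat. int m \<in> S}"
  define N where "N = {m::nat. - int m - 1 \<in> S}"
  have infP: "infinite P"
    unfolding infinite_nat_iff_unbounded
  proof
    fix m
    obtain s where "s \<in> S" "int m < s" using up by blast
    then show "\<exists>n>m. n \<in> P" by (intro exI[of _ "nat s"]) (auto simp: P_def)
  qed
  have infN: "infinite N"
    unfolding infinite_nat_iff_unbounded
  proof
    fix m
    obtain s where "s \<in> S" "s < - int m - 1" using down by blast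
    then show "\<exists>n>m. n \<in> N" by (intro exI[of _ "nat (- s - 1)"]) (auto simp: N_def)
  qed
  define f where "f i = (if 0 \<le> i then int (enumerate P (nat i)) else - int (enumerate N (nat (- i - 1))) - 1)" for i
  have "strict_mono f"
  proof (rule strict_monoI)
    fix i j :: int assume "i < j"
    consider "0 \<le> i" | "i < 0" "0 \<le> j" | "j < 0" by linarith
    then show "f i < f j"
    proof cases
      case 1
      then show ?thesis using \<open>i < j\<close> infP by (auto simp: f_def intro!: enumerate_mono)
    next
      case 2
      then show ?thesis by (simp add: f_def)
    next
      case 3
      then have "nat (- j - 1) < nat (- i - 1)" using \<open>i < j\<close> by simp
      then show ?thesis using 3 \<open>i < j\<close> infN enumerate_mono[of "nat (- j - 1)" "nat (- i - 1)" N] by (simp add: f_def)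
    qed
  qed
  moreover have "range f = S"
  proof safe
    fix i
    show "f i \<in> S" using enumerate_in_set[OF infP, of "nat i"] enumerate_in_set[OF infN, of "nat (- i - 1)"]
      by (auto simp: f_def P_def N_def)
  next
    fix s assume s: "s \<in> S"
    show "s \<in> range f"
    proof (cases "0 \<le> s")
      case True
      then have "nat s \<in> P" using s by (simp add: P_def)
      then obtain i where "enumerate P i = nat s" using range_enumerate[OF infP] by (metis rangeE)
      then have "f (int i) = s" using True by (simp add: f_def)
      then show ?thesis by blast
    next
      case False
      then have "nat (- s - 1) \<in> N" using s by (simp add: N_def)
      then obtain i where "enumerate N i = nat (- s - 1)" using range_enumerate[OF infN] by (metis rangeE)
      then have "f (- int i - 1) = s" using False by (simp add: f_def)
      then show ?thesis by blast
    qed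
  qed
  ultimately show ?thesis using that by blast
qed

text \<open>
  While no letter is sandwiched the two sums of consecutive letters alternate, and read from a suitable
  position on the word climbs by one every two steps; this cannot go on with \<open>n\<close> letters.
\<close>

lemma sandwiched_unbounded_above:
  assumes n: "n \<ge> 3" and u: "base_cone n u" and w: "codes n u w \<delta>"
  shows "\<exists>s\<in>sandwiched w. k < s"
proof (rule ccontr)
  assume none: "\<not> (\<exists>s\<in>sandwiched w. k < s)"
  define s where "s i = w i + w (i + 1)" for i
  have s: "s i = n + 1 \<or> s i = n + 2" for i
    unfolding s_def by (rule transition_sums[OF n u w])
  have alt: "s (i + 1) \<noteq> s i" if "k \<le> i" for i
  proof -
    have "i + 1 \<notin> sandwiched w" using none that by auto
    then show ?thesis by (simp add: sandwiched_def s_def)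
  qed
  obtain j where j: "k \<le> j" "s j = n + 1"
    using s[of k] s[of "k + 1"] alt[of k] by (metis dual_order.refl zle_add1_eq_le zless_add1_eq)
  have "s (j + 2 * int m) = n + 1 \<and> w (j + 2 * int m) = w j + m" for m
  proof (induction m)
    case 0
    then show ?case using j by simp
  next
    case (Suc m)
    define i where "i = j + 2 * int m"
    have i: "k \<le> i" "s i = n + 1" "w i = w j + m" using Suc j by (auto simp: i_def)
    have 1: "s (i + 1) = n + 2" using alt[of i] i s[of "i + 1"] by simp
    then have 2: "s (i + 2) = n + 1" using alt[of "i + 1"] i s[of "i + 2"] by (simp add: add.assoc)
    have "w (i + 2) = w i + 1" using 1 i(2) by (simp add: s_def add.assoc)
    then show ?case using 2 i by (simp add: i_def algebra_simps)
  qed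
  from this[of n] codesD(1)[OF w, of "j + 2 * int n"] codesD(1)[OF w, of j] show False by auto
qed

lemma sandwiched_reverse: "k \<in> sandwiched (\<lambda>i. w (- i)) \<longleftrightarrow> - k \<in> sandwiched w"
  by (auto simp: sandwiched_def)

lemma sandwiched_unbounded_below:
  assumes n: "n \<ge> 3" and u: "base_cone n u" and w: "codes n u w \<delta>"
  shows "\<exists>s\<in>sandwiched w. s < k"
proof -
  obtain s where "s \<in> sandwiched (\<lambda>i. w (- i))" "- k < s"
    using sandwiched_unbounded_above[OF n u codes_reverse[OF w]] by blast
  then show ?thesis by (intro bexI[of _ "- s"]) (auto simp: sandwiched_reverse)
qed

text \<open>
  Between consecutive sandwiched letters the two kinds of transitions alternate. The identities for
  pairs express each displacement by centres for the image direction, with opposite signs for the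
  two kinds, so the contributions of all intermediate letters cancel. The offsets change sign because the
  Farey matrix reverses orientation.
\<close>

lemma derived_codes:
  assumes n: "n \<ge> 3" and u: "base_cone n u" and w: "codes n u w \<delta>"
    and f: "strict_mono f" "range f = sandwiched w"
  shows "codes n (farey_matrix n u) (w \<circ> f) (\<lambda>k. - \<delta> (f k))"
proof -
  define v where "v = farey_matrix n u"
  define s where "s i = w i + w (i + 1)" for i
  have s: "s i = n + 1 \<or> s i = n + 2" for i
    unfolding s_def by (rule transition_sums[OF n u w])
  \<comment> \<open>the centre of \<open>l\<close> for the image direction, with the sign prescribed by a transition of sum \<open>\<sigma>\<close>\<close>
  define G where "G \<sigma> l = (if \<sigma> = n + 1 then Re (v * letter_dir n l) else - Re (v * letter_dir n l))" for \<sigma> l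
  have t: "0 < tan (pi / (2 * real n))" using half_angle_bounds[OF n] by simp
  have width: "\<bar>\<delta> k\<bar> < tan (pi / (2 * real n)) * \<bar>Im (v * letter_dir n (w k))\<bar>"
    and centre: "centre (v * letter_dir n (w k)) = G (s k) (w k)" if k: "k \<in> sandwiched w" for k
  proof -
    consider (lower) "s k = n + 1" "\<bar>\<delta> k\<bar> < tan (pi / (2 * real n)) * Im (v * letter_dir n (w k))"
      | (upper) "s k = n + 2" "\<bar>\<delta> k\<bar> < tan (pi / (2 * real n)) * (- Im (v * letter_dir n (w k)))"
      using s[of k] sandwiched_width[OF n u w k] unfolding s_def v_def
      by (metis mult_minus_left mult_minus_right)
    then have "\<bar>\<delta> k\<bar> < tan (pi / (2 * real n)) * \<bar>Im (v * letter_dir n (w k))\<bar>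
        \<and> centre (v * letter_dir n (w k)) = G (s k) (w k)"
    proof cases
      case lower
      then have "0 < tan (pi / (2 * real n)) * Im (v * letter_dir n (w k))" by linarith
      then have "0 < Im (v * letter_dir n (w k))" using t by (simp only: zero_less_mult_pos)
      then show ?thesis using lower by (simp add: centre_def G_def)
    next
      case upper
      then have "0 < tan (pi / (2 * real n)) * (- Im (v * letter_dir n (w k)))" by linarith
      then have "0 < - Im (v * letter_dir n (w k))" using t by (simp only: zero_less_mult_pos)
      then show ?thesis using upper by (simp add: centre_def G_def)
    qed
    then show "\<bar>\<delta> k\<bar> < tan (pi / (2 * real n)) * \<bar>Im (v * letter_dir n (w k))\<bar>"
      "centre (v * letter_dir n (w k)) = G (s k) (w k)" by blast+
  qed
  have step: "\<delta> (i + 1) - \<delta> i = G (s i) (w i) + G (s i) (w (i + 1))" for i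
  proof -
    have "\<delta> i - \<delta> (i + 1) = Re (u * letter_dir n (w i)) + Re (u * letter_dir n (w (i + 1)))"
      using codesD(3)[OF w, of i] Im_letter_dir_pos[OF n codesD(1)[OF w] u] by (simp add: centre_def)
    then show ?thesis
      using s[of i] pair_centres_farey[OF n codesD(1)[OF w, of i] codesD(1)[OF w, of "i + 1"], of u]
      unfolding G_def s_def v_def by auto
  qed
  have "- \<delta> (f k) - - \<delta> (f (k + 1)) = centre (v * letter_dir n (w (f k))) + centre (v * letter_dir n (w (f (k + 1))))" for k
  proof -
    have lt: "f k < f (k + 1)" using f(1) by (simp add: strict_mono_def)
    have gap: "i \<notin> sandwiched w" if "f k < i" "i < f (k + 1)" for i
    proof
      assume "i \<in> sandwiched w"
      then obtain j where "i = f j" using f(2) by auto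
      then show False using that f(1) by (simp add: strict_mono_less)
    qed
    have tele: "i \<le> f (k + 1) \<longrightarrow> \<delta> i - \<delta> (f k) = G (s (f k)) (w (f k)) + G (s (i - 1)) (w i)" if "f k < i" for i
      using that
    proof (induction rule: int_gr_induct)
      case base
      then show ?case using step[of "f k"] by simp
    next
      case (step i)
      show ?case
      proof
        assume "i + 1 \<le> f (k + 1)"
        then have "s (i - 1) \<noteq> s i"
          using gap[of i] step.hyps by (auto simp: sandwiched_def s_def)
        then have "G (s (i - 1)) (w i) + G (s i) (w i) = 0"
          using s[of i] s[of "i - 1"] by (auto simp: G_def)
        then show "\<delta> (i + 1) - \<delta> (f k) = G (s (f k)) (w (f k)) + G (s (i + 1 - 1)) (w (i + 1))"
          using step.IH \<open>i + 1 \<le> f (k + 1)\<close> \<open>\<And>i. \<delta> (i + 1) - \<delta> i = _ i\<close>[of i] by simp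
      qed
    qed
    have "f k \<in> sandwiched w" and S: "f (k + 1) \<in> sandwiched w" using f(2) by auto
    moreover from S have "s (f (k + 1) - 1) = s (f (k + 1))" by (simp add: sandwiched_def s_def)
    ultimately show ?thesis using tele[of "f (k + 1)"] lt centre by simp
  qed
  moreover have "\<bar>- \<delta> (f k)\<bar> < tan (pi / (2 * real n)) * \<bar>Im (v * letter_dir n (w (f k)))\<bar>" for k
    using width[of "f k"] f(2) by auto
  ultimately show ?thesis
    using codesD(1)[OF w] unfolding codes_def v_def by simp
qed

text \<open>
  The exit sides with labels \<open>l\<close> and \<open>l + 1\<close> share a vertex: their transversal shadows abut.
\<close>

lemma adjacent_letters_touch:
  assumes n: "n \<ge> 3"
  shows "Re (z * letter_dir n l) - Re (z * letter_dir n (l + 1))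
    = tan (pi / (2 * real n)) * (Im (z * letter_dir n l) + Im (z * letter_dir n (l + 1)))"
proof -
  define b where "b = pi / (2 * real n)"
  note b = half_angle_bounds[OF n, folded b_def]
  define q where "q = z * letter_dir n l"
  have "(real (l + 1) - 1) * pi / real n = (real l - 1) * pi / real n + (b + b)"
    using n by (simp add: b_def field_simps)
  then have "letter_dir n (l + 1) = letter_dir n l * cis (b + b)"
    unfolding letter_dir_def cis_mult by simp
  then have e: "z * letter_dir n (l + 1) = q * cis (b + b)" by (simp add: q_def mult.assoc)
  have c: "1 - cos (b + b) = 2 * (sin b * sin b)" "1 + cos (b + b) = 2 * (cos b * cos b)"
    using sin_cos_squared_add[of b] unfolding cos_add power2_eq_square by linarith+
  have s: "sin (b + b) = 2 * (sin b * cos b)" unfolding sin_add by simp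
  have "Re q - Re (q * cis (b + b)) = Re q * (1 - cos (b + b)) + Im q * sin (b + b)"
    by (simp add: algebra_simps)
  also have "\<dots> = 2 * sin b * (Re q * sin b + Im q * cos b)"
    unfolding c s by (simp add: algebra_simps)
  finally have re: "Re q - Re (q * cis (b + b)) = 2 * sin b * (Re q * sin b + Im q * cos b)" .
  have "Im q + Im (q * cis (b + b)) = Im q * (1 + cos (b + b)) + Re q * sin (b + b)"
    by (simp add: algebra_simps)
  also have "\<dots> = 2 * cos b * (Re q * sin b + Im q * cos b)"
    unfolding c s by (simp add: algebra_simps)
  finally have im: "Im q + Im (q * cis (b + b)) = 2 * cos b * (Re q * sin b + Im q * cos b)" .
  show ?thesis using b unfolding e q_def[symmetric] b_def[symmetric] tan_def re im
    by simp
qed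

section \<open>States determine words\<close>

text \<open>
  The transversal shadows of the exit sides are disjoint, so letter and offset determine where the
  trajectory goes next.
\<close>

lemma next_state_determined:
  assumes n: "n \<ge> 3" and u: "base_cone n u" and w: "codes n u w \<delta>"
    and ij: "w i = w j" "\<delta> i = \<delta> j"
  shows "w (i + 1) = w (j + 1) \<and> \<delta> (i + 1) = \<delta> (j + 1)"
proof -
  have pos: "0 < Im (u * letter_dir n (w j))" for j
    using Im_letter_dir_pos[OF n codesD(1)[OF w] u] .
  have eq: "\<delta> (i + 1) + Re (u * letter_dir n (w (i + 1))) = \<delta> (j + 1) + Re (u * letter_dir n (w (j + 1)))"
    using codesD(3)[OF w, of i] codesD(3)[OF w, of j] pos ij by (simp add: centre_def)
  have wd: "\<bar>\<delta> k\<bar> < tan (pi / (2 * real n)) * Im (u * letter_dir n (w k))" for k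
    using codesD(2)[OF w, of k] pos[of k] by simp
  have apart: "w b \<noteq> w a + 1"
    if "\<delta> a + Re (u * letter_dir n (w a)) = \<delta> b + Re (u * letter_dir n (w b))" for a b
  proof
    assume b: "w b = w a + 1"
    have "Re (u * letter_dir n (w a)) - Re (u * letter_dir n (w b))
        = tan (pi / (2 * real n)) * Im (u * letter_dir n (w a)) + tan (pi / (2 * real n)) * Im (u * letter_dir n (w b))"
      unfolding b adjacent_letters_touch[OF n] by (rule distrib_left)
    then show False using that wd[of a] wd[of b] by linarith
  qed
  have "w (j + 1) \<noteq> w (i + 1) + 1" "w (i + 1) \<noteq> w (j + 1) + 1"
    using apart[OF eq] apart[OF eq[symmetric]] by blast+
  moreover have "w (i + 1) = w (j + 1) \<or> w (j + 1) = w (i + 1) + 1 \<or> w (i + 1) = w (j + 1) + 1"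
    using transition_sums[OF n u w, of i] transition_sums[OF n u w, of j] ij by linarith
  ultimately show ?thesis using eq by auto
qed

lemma repeated_state_periodic:
  assumes n: "n \<ge> 3" and u: "base_cone n u" and w: "codes n u w \<delta>"
    and ij: "w i = w j" "\<delta> i = \<delta> j" "i < j"
  shows "periodic_word w"
proof -
  have forward: "w (i + int m) = w (j + int m) \<and> \<delta> (i + int m) = \<delta> (j + int m)"
    if w: "codes n u w \<delta>" and ij: "w i = w j" "\<delta> i = \<delta> j" for w \<delta> i j m
  proof (induction m)
    case 0
    then show ?case using ij by simp
  next
    case (Suc m)
    then show ?case using next_state_determined[OF n u w, of "i + int m" "j + int m"]
      by (simp add: algebra_simps)
  qed
  have "w (k + (j - i)) = w k" for k
  proof (cases "i \<le> k")
    case True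
    then show ?thesis using forward[OF w ij(1,2), of "nat (k - i)"] by (simp add: algebra_simps)
  next
    case False
    then show ?thesis
      using forward[OF codes_reverse[OF w], of "- i" "- j" "nat (i - k)"] ij
      by (simp add: algebra_simps)
  qed
  then show ?thesis using ij(3) unfolding periodic_word_def by (intro exI[of _ "j - i"]) simp
qed

text \<open>
  The offset changes by a fixed amount over each period, and it is bounded, so this amount is zero.
\<close>

lemma offsets_periodic:
  assumes n: "n \<ge> 3" and w: "codes n v w \<delta>" and per: "\<And>k. w (k + m) = w k"
  shows "\<delta> (k + m) = \<delta> k"
proof -
  define D where "D k = \<delta> (k + m) - \<delta> k" for k
  have "D (k + 1) = D k" for k
    using codesD(3)[OF w, of k] codesD(3)[OF w, of "k + m"] per[of k] per[of "k + 1"]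
    by (simp add: D_def algebra_simps)
  then have step: "D (k + 1) = D k" for k .
  have const: "D (k + int j) = D k" for k j
  proof (induction j)
    case (Suc j)
    then show ?case using step[of "k + int j"] by (simp add: algebra_simps)
  qed simp
  have const: "D j = D 0" for j
    using const[of 0 "nat j"] const[of j "nat (- j)"] by (cases "0 \<le> j") auto
  have lin: "\<delta> (int j * m) = \<delta> 0 + real j * D 0" for j
  proof (induction j)
    case (Suc j)
    have "\<delta> (int (Suc j) * m) = \<delta> (int j * m) + D (int j * m)"
      by (simp add: D_def algebra_simps)
    then show ?case using Suc const[of "int j * m"] by (simp add: algebra_simps)
  qed simp
  define M where "M = tan (pi / (2 * real n)) * cmod v"
  have t: "0 < tan (pi / (2 * real n))" using half_angle_bounds[OF n] by simp
  have bound: "\<bar>\<delta> k\<bar> \<le> M" for k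
  proof -
    have "\<bar>Im (v * letter_dir n (w k))\<bar> \<le> cmod (v * letter_dir n (w k))" by (rule abs_Im_le_cmod)
    also have "\<dots> = cmod v" by (simp add: norm_mult letter_dir_def)
    finally have "tan (pi / (2 * real n)) * \<bar>Im (v * letter_dir n (w k))\<bar> \<le> M"
      unfolding M_def using t by (intro mult_left_mono) auto
    then show ?thesis using codesD(2)[OF w, of k] by linarith
  qed
  have "D 0 = 0"
  proof (rule ccontr)
    assume "D 0 \<noteq> 0"
    then obtain j where j: "2 * M < real j * \<bar>D 0\<bar>"
      using reals_Archimedean3[of "\<bar>D 0\<bar>"] by auto
    have "real j * \<bar>D 0\<bar> = \<bar>\<delta> (int j * m) - \<delta> 0\<bar>" using lin[of j] by (simp add: abs_mult)
    also have "\<dots> \<le> 2 * M" using bound[of "int j * m"] bound[of 0] by linarith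
    finally show False using j by simp
  qed
  then show ?thesis using const[of k] by (simp add: D_def)
qed

text \<open>
  If the derived word were periodic, so would be its offsets, which up to sign are offsets of the
  original word. A letter with its offset would recur, and the original word would be periodic.
\<close>

lemma derived_exists:
  assumes n: "n \<ge> 3" and u: "base_cone n u" and w: "codes n u w \<delta>" and np: "\<not> periodic_word w"
  obtains w' \<delta>' where "derived_sequence w w'" "codes n (farey_matrix n u) w' \<delta>'" "\<not> periodic_word w'"
proof -
  obtain f :: "int \<Rightarrow> int" where f: "strict_mono f" "range f = sandwiched w"
    using int_set_enumeration[OF sandwiched_unbounded_above[OF n u w] sandwiched_unbounded_below[OF n u w]] .
  note c = derived_codes[OF n u w f]
  have "\<not> periodic_word (w \<circ> f)"
  proof
    assume "periodic_word (w \<circ> f)"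
    then obtain m where m: "0 < m" "\<And>k. (w \<circ> f) (k + m) = (w \<circ> f) k"
      unfolding periodic_word_def by blast
    have "\<delta> (f 0) = \<delta> (f m)" using offsets_periodic[OF n c m(2), of 0] by simp
    moreover have "w (f 0) = w (f m)" using m(2)[of 0] by simp
    moreover have "f 0 < f m" using m(1) f(1) by (simp add: strict_mono_less)
    ultimately show False using repeated_state_periodic[OF n u w] np by blast
  qed
  then show ?thesis using that f c unfolding derived_sequence_def by blast
qed

section \<open>The dihedral symmetries\<close>

lemma cis_add_2pi: "cis (x + 2 * pi) = cis x"
  by (simp flip: cis_mult)

lemma vertex_add_period:
  assumes "n > 0"
  shows "vertex n R (j + 2 * n) = vertex n R j"
proof -
  have "pi / 2 + pi / (2 * real n) - real j * pi / real n
      = (pi / 2 + pi / (2 * real n) - real (j + 2 * n) * pi / real n) + 2 * pi"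
    using assms by (simp add: field_simps)
  then have "cis (pi / 2 + pi / (2 * real n) - real j * pi / real n)
      = cis (pi / 2 + pi / (2 * real n) - real (j + 2 * n) * pi / real n)"
    by (metis cis_add_2pi)
  then show ?thesis unfolding vertex_def by simp
qed

lemma vertex_mod:
  assumes "n > 0"
  shows "vertex n R (j mod (2 * n)) = vertex n R j"
proof -
  have "vertex n R (i + q * (2 * n)) = vertex n R i" for i q
  proof (induction q)
    case (Suc q)
    then show ?case using vertex_add_period[OF assms, of R "i + q * (2 * n)"]
      by (simp add: algebra_simps)
  qed simp
  then show ?thesis using mod_mult_div_eq[of j "2 * n"] by (metis mult.commute)
qed

lemma side_mod: "n > 0 \<Longrightarrow> side n R (j mod (2 * n)) = side n R j"
  unfolding side_def by (metis mod_Suc_eq vertex_mod)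

lemma side_label_mod: "side_label n (j mod (2 * n)) = side_label n j"
  by (simp add: side_label_def mod_mod_cancel)

lemma side_translation_polar:
  assumes "n > 0"
  shows "side_translation n R j = of_real (2 * R * cos (pi / (2 * real n))) * cis (pi / 2 - real j * pi / real n)"
proof -
  define a where "a = pi / 2 - real j * pi / real n"
  define b where "b = pi / (2 * real n)"
  have "pi / 2 + pi / (2 * real n) - real (Suc j) * pi / real n = a - b"
    using assms by (simp add: a_def b_def field_simps)
  moreover have "pi / 2 + pi / (2 * real n) - real j * pi / real n = a + b" by (simp add: a_def b_def)
  ultimately have "side_translation n R j = of_real R * cis (a + b) + of_real R * cis (a - b)"
    by (simp add: side_translation_def vertex_def)
  also have "\<dots> = of_real (2 * R * cos b) * cis a"
    by (simp add: complex_eq_iff cos_add cos_diff sin_add sin_diff algebra_simps)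
  finally show ?thesis by (simp add: a_def b_def)
qed

lemma side_label_cong:
  assumes n3: "n \<ge> 3" and R: "R > 0" and eq: "side n R i = side n R j"
  shows "side_label n i = side_label n j"
proof -
  have n: "n > 0" using n3 by simp
  have "{vertex n R i, vertex n R (Suc i)} = {vertex n R j, vertex n R (Suc j)}"
    using eq by (simp add: side_def)
  then have "side_translation n R i = side_translation n R j"
    unfolding side_translation_def by (auto simp: doubleton_eq_iff add.commute)
  then have "cis (pi / 2 - real i * pi / real n) = cis (pi / 2 - real j * pi / real n)"
    using side_translation_polar[OF n, of R] half_angle_bounds[OF n3] R by simp
  then have "cis (pi / 2 - real i * pi / real n) / cis (pi / 2 - real j * pi / real n) = 1" by simp
  then have "cis (real j * pi / real n - real i * pi / real n) = 1" by (simp add: cis_divide)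
  then have "cos (real j * pi / real n - real i * pi / real n) = 1" by (simp add: complex_eq_iff)
  then obtain q :: int where q: "real j * pi / real n - real i * pi / real n = of_int q * 2 * pi"
    using cos_one_2pi_int by auto
  have "real j * pi / real n - real i * pi / real n = (real j - real i) / real n * pi"
    by (simp add: diff_divide_distrib left_diff_distrib)
  then have "(real j - real i) / real n * pi = (of_int q * 2) * pi" using q by (simp only:)
  then have "(real j - real i) / real n = of_int q * 2" using pi_gt_zero by (simp only: mult_cancel_right) simp
  then have "real j - real i = of_int (q * 2) * real n" using n by (simp add: field_simps)
  then have "of_int (int j - int i) = (of_int (q * 2 * int n) :: real)" by simp
  then have "int j - int i = q * 2 * int n" by (simp only: of_int_eq_iff)
  then have "int j = int i + (q * 2) * int n" by simp
  then have "int j mod int n = int i mod int n" by simp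
  then show ?thesis unfolding side_label_def by (metis of_nat_eq_iff zmod_int)
qed

text \<open>
  The index, modulo \<open>2 * n\<close>, of the image of side \<open>j\<close> under the isometry of sector \<open>i\<close>. A reflection
  sends \<open>j\<close> to \<open>n - (i + 1) div 2 - j\<close>; the further \<open>2 * n\<close> keeps the difference nonnegative.
\<close>

definition image_side :: "nat \<Rightarrow> nat \<Rightarrow> nat \<Rightarrow> nat" where
  "image_side n i j = (if even i then j + i div 2 else 3 * n - (i + 1) div 2 - j)"

lemma sector_isometry_side:
  assumes n: "n > 0" and i: "i < 2 * n" and j: "j < 2 * n"
  shows "sector_isometry n i ` side n R j = side n R (image_side n i j)"
proof -
  have lin: "linear (sector_isometry n i)"
    by (rule linearI) (auto simp: sector_isometry_def algebra_simps scaleR_conv_of_real)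
  have rot: "cis a * (of_real R * cis b) = of_real R * cis (a + b)" for a b
    by (simp add: mult.left_commute cis_mult)
  have img: "sector_isometry n i ` side n R j
      = closed_segment (sector_isometry n i (vertex n R j)) (sector_isometry n i (vertex n R (Suc j)))"
    unfolding side_def using closed_segment_linear_image[OF lin] by simp
  show ?thesis
  proof (cases "even i")
    case True
    then obtain h where h: "i = 2 * h" by blast
    have "sector_isometry n i (vertex n R k) = vertex n R (k + h)" for k
    proof -
      have "- (real i * pi / (2 * real n)) + (pi / 2 + pi / (2 * real n) - real k * pi / real n)
          = pi / 2 + pi / (2 * real n) - real (k + h) * pi / real n"
        using n by (simp add: h field_simps)
      from this[symmetric] show ?thesis using True rot
        unfolding sector_isometry_def vertex_def by presburger
    qed
    then show ?thesis using True unfolding img by (simp add: image_side_def side_def h)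
  next
    case False
    then obtain h where h: "i = 2 * h + 1" by (elim oddE)
    have h2: "(i + 1) div 2 = h + 1" using h by simp
    have isom: "sector_isometry n i (vertex n R k) = vertex n R (3 * n - h - k)" if "k \<le> 2 * n" for k
    proof -
      have le: "h + k \<le> 3 * n" using that i h by simp
      have "(real i + 1) * pi / (2 * real n) + - (pi / 2 + pi / (2 * real n) - real k * pi / real n)
          = pi / 2 + pi / (2 * real n) - real (3 * n - h - k) * pi / real n + 2 * pi"
        using n le by (simp add: h of_nat_diff field_simps)
      moreover have "cis (\<dots>) = cis (pi / 2 + pi / (2 * real n) - real (3 * n - h - k) * pi / real n)"
        by (rule cis_add_2pi)
      ultimately show ?thesis using False rot
        unfolding sector_isometry_def vertex_def complex_cnj_mult complex_cnj_complex_of_real cis_cnj by presburger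
    qed
    have "3 * n - h - j = Suc (image_side n i j)" "3 * n - h - Suc j = image_side n i j"
      using False i j h unfolding image_side_def h2 by auto
    then show ?thesis using isom[of j] isom[of "Suc j"] j
      unfolding img by (simp add: side_def closed_segment_commute)
  qed
qed

lemma label_perm_eq:
  assumes n: "n \<ge> 3" and R: "R > 0" and i: "i < 2 * n" and l: "l \<in> {1..n}"
  shows "label_perm n R i l = side_label n (image_side n i (l - 1))"
proof -
  have n0: "n > 0" using n by simp
  have lab: "side_label n (image_side n i j) = side_label n (image_side n i (l - 1))"
    if "j < 2 * n" "side_label n j = l" for j
  proof -
    have "j = l - 1 \<or> j = l - 1 + n"
      using that l by (cases "j < n") (auto simp: side_label_def le_mod_geq)
    moreover have "image_side n i (l - 1) = image_side n i (l - 1 + n) + n" if "odd i"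
      using that i l by (auto simp: image_side_def)
    moreover have "image_side n i (l - 1 + n) = image_side n i (l - 1) + n" if "even i"
      using that by (simp add: image_side_def)
    ultimately show ?thesis
      unfolding side_label_def by (cases "even i") auto
  qed
  show ?thesis unfolding label_perm_def
  proof (rule the_equality)
    show "\<forall>j<2 * n. side_label n j = l \<longrightarrow>
        (\<exists>j'<2 * n. side_label n j' = side_label n (image_side n i (l - 1))
          \<and> sector_isometry n i ` side n R j = side n R j')"
    proof (intro allI impI)
      fix j assume j: "j < 2 * n" "side_label n j = l"
      show "\<exists>j'<2 * n. side_label n j' = side_label n (image_side n i (l - 1))
          \<and> sector_isometry n i ` side n R j = side n R j'"
        using lab[OF j] sector_isometry_side[OF n0 i j(1), of R] n0
        by (intro exI[of _ "image_side n i j mod (2 * n)"]) (simp add: side_label_mod side_mod)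
    qed
  next
    fix l' assume l': "\<forall>j<2 * n. side_label n j = l \<longrightarrow>
        (\<exists>j'<2 * n. side_label n j' = l' \<and> sector_isometry n i ` side n R j = side n R j')"
    have j: "l - 1 < 2 * n" "side_label n (l - 1) = l" using l by (auto simp: side_label_def)
    then obtain j' where "side_label n j' = l'" "side n R (image_side n i (l - 1)) = side n R j'"
      using l' sector_isometry_side[OF n0 i j(1), of R] by metis
    then show "l' = side_label n (image_side n i (l - 1))"
      using side_label_cong[OF n R] by metis
  qed
qed

lemma label_perm_range:
  assumes "n \<ge> 3" "R > 0" "i < 2 * n" "l \<in> {1..n}"
  shows "label_perm n R i l \<in> {1..n}"
  using assms(1) unfolding label_perm_eq[OF assms] side_label_def by (simp add: Suc_leI)

lemma label_perm_residue:
  assumes "n \<ge> 3" "R > 0" "i < 2 * n" "l \<in> {1..n}"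
  shows "int (label_perm n R i l) - 1
    = (if even i then int l - 1 + int i div 2 else - (int l - 1) - (int i + 1) div 2) mod int n"
proof -
  have "(i + 1) div 2 \<le> n" using assms(3) by linarith
  then have le: "(i + 1) div 2 + (l - 1) \<le> 3 * n" using assms(4) by auto
  have "int (image_side n i (l - 1)) = (if even i then int l - 1 + int i div 2
      else - (int l - 1) - (int i + 1) div 2 + 3 * int n)"
    using assms(4) le unfolding image_side_def by (auto simp: of_nat_diff zdiv_int)
  then have "int (image_side n i (l - 1)) mod int n = (if even i then int l - 1 + int i div 2
      else - (int l - 1) - (int i + 1) div 2) mod int n"
    by simp
  then show ?thesis unfolding label_perm_eq[OF assms] side_label_def by (simp add: zmod_int)
qed

lemma label_perm_inj_on:
  assumes "n \<ge> 3" "R > 0" "i < 2 * n"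
  shows "inj_on (label_perm n R i) {1..n}"
proof (rule inj_onI)
  fix l m assume lm: "l \<in> {1..n}" "m \<in> {1..n}" "label_perm n R i l = label_perm n R i m"
  have "int n dvd int l - int m"
  proof (cases "even i")
    case True
    then have "(int l - 1 + int i div 2) mod int n = (int m - 1 + int i div 2) mod int n"
      using label_perm_residue[OF assms lm(1)] label_perm_residue[OF assms lm(2)] lm(3) by simp
    then show ?thesis by (simp add: mod_eq_dvd_iff)
  next
    case False
    then have "(- (int l - 1) - (int i + 1) div 2) mod int n = (- (int m - 1) - (int i + 1) div 2) mod int n"
      using label_perm_residue[OF assms lm(1)] label_perm_residue[OF assms lm(2)] lm(3) by simp
    then have "int n dvd int m - int l" by (simp add: mod_eq_dvd_iff)
    then show ?thesis by (simp add: dvd_diff_commute)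
  qed
  moreover have "\<bar>int l - int m\<bar> < int n" using lm by auto
  ultimately show "l = m" using zdvd_not_zless[of "\<bar>int l - int m\<bar>" "int n"] by (cases "l = m") auto
qed

lemma letter_dir_side_label:
  assumes "n > 0"
  shows "letter_dir n (side_label n j) = cis (real j * pi / real n)
    \<or> letter_dir n (side_label n j) = - cis (real j * pi / real n)"
proof -
  define q where "q = j div n"
  have "real j = real (j mod n) + real q * real n"
    by (metis q_def mod_div_mult_eq of_nat_add of_nat_mult)
  then have "real j * pi / real n = real (j mod n) * pi / real n + real q * pi"
    using assms by (simp add: field_simps)
  then have "cis (real j * pi / real n) = letter_dir n (side_label n j) * cis (real q * pi)"
    by (simp add: letter_dir_def side_label_def cis_mult)
  also have "cis (real q * pi) = (-1) ^ q" by (simp add: Complex.DeMoivre[symmetric])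
  finally have "cis (real j * pi / real n) = letter_dir n (side_label n j) * (-1) ^ q" .
  then show ?thesis by (cases "even q") auto
qed

text \<open>
  A rotation keeps the offsets of a trajectory, a reflection changes their signs. The isometry and the
  relabelling cancel in the product that defines centre and width, up to a conjugation and up to a
  sign that reflects the choice between opposite sides.
\<close>

lemma codes_sector_isometry:
  assumes n: "n \<ge> 3" and R: "R > 0" and i: "i < 2 * n" and w: "codes n v w \<delta>"
  shows "\<exists>\<delta>'. codes n (sector_isometry n i v) (label_perm n R i \<circ> w) \<delta>'"
proof -
  define g where "g l = sector_isometry n i v * letter_dir n (label_perm n R i l)" for l
  define s :: real where "s = (if even i then 1 else - 1)"
  have g: "\<bar>Im (g l)\<bar> = \<bar>Im (v * letter_dir n l)\<bar> \<and> centre (g l) = s * centre (v * letter_dir n l)"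
    if l: "l \<in> {1..n}" for l
  proof -
    define j where "j = image_side n i (l - 1)"
    define z where "z = (if even i then v * letter_dir n l else cnj (v * letter_dir n l))"
    have "sector_isometry n i v * cis (real j * pi / real n) = z \<or>
        sector_isometry n i v * cis (real j * pi / real n) = - z"
    proof (cases "even i")
      case True
      then obtain h where h: "i = 2 * h" by blast
      have "- (real i * pi / (2 * real n)) + real j * pi / real n = (real l - 1) * pi / real n"
        using n l by (simp add: j_def image_side_def h of_nat_diff field_simps)
      then show ?thesis using True
        by (simp add: sector_isometry_def z_def letter_dir_def mult.left_commute cis_mult mult.commute[of _ v] mult.assoc)
    next
      case False
      then obtain h where h: "i = 2 * h + 1" by (elim oddE)
      have "real j = 3 * real n - real (h + 1) - (real l - 1)"
        using False l i h by (simp add: j_def image_side_def of_nat_diff)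
      then have sum: "real h + 1 + real j = 3 * real n - (real l - 1)" by simp
      have "(real i + 1) * pi / (2 * real n) + real j * pi / real n = (real h + 1 + real j) * pi / real n"
        using n by (simp add: h field_simps)
      also have "\<dots> = - ((real l - 1) * pi / real n) + 2 * pi + pi"
        unfolding sum using n by (simp add: field_simps)
      finally have "(real i + 1) * pi / (2 * real n) + real j * pi / real n
          = - ((real l - 1) * pi / real n) + 2 * pi + pi" .
      moreover have "cis (x + 2 * pi + pi) = - cis x" for x
        using cis_add_2pi[of "x + pi"] by (simp add: add_ac flip: cis_mult)
      ultimately have "cis ((real i + 1) * pi / (2 * real n) + real j * pi / real n)
          = - cis (- ((real l - 1) * pi / real n))" by presburger
      then have "cis ((real i + 1) * pi / (2 * real n)) * cis (real j * pi / real n) = - cnj (letter_dir n l)"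
        unfolding cis_mult by (simp add: letter_dir_def cis_cnj)
      then have "sector_isometry n i v * cis (real j * pi / real n) = - z"
        using False by (simp add: sector_isometry_def z_def mult.left_commute mult.assoc mult.commute)
      then show ?thesis ..
    qed
    then have "g l = z \<or> g l = - z"
      using letter_dir_side_label[of n j] n unfolding g_def label_perm_eq[OF n R i l] j_def[symmetric] by auto
    then have "\<bar>Im (g l)\<bar> = \<bar>Im z\<bar> \<and> centre (g l) = centre z" by auto
    then show ?thesis unfolding z_def s_def by (simp add: centre_cnj del: times_complex.sel complex_cnj_mult)
  qed
  have "codes n (sector_isometry n i v) (label_perm n R i \<circ> w) (\<lambda>k. s * \<delta> k)"
    unfolding codes_def
  proof (intro allI conjI)
    fix k
    have l: "w k \<in> {1..n}" "w (k + 1) \<in> {1..n}" using codesD(1)[OF w] by blast+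
    show "(label_perm n R i \<circ> w) k \<in> {1..n}" using label_perm_range[OF n R i l(1)] by simp
    have "\<bar>s * \<delta> k\<bar> = \<bar>\<delta> k\<bar>" by (simp add: s_def)
    then show "\<bar>s * \<delta> k\<bar> < tan (pi / (2 * real n)) * \<bar>Im (sector_isometry n i v * letter_dir n ((label_perm n R i \<circ> w) k))\<bar>"
      using codesD(2)[OF w, of k] g[OF l(1)] unfolding g_def by simp
    have "s * \<delta> k - s * \<delta> (k + 1) = s * (\<delta> k - \<delta> (k + 1))" by (rule right_diff_distrib[symmetric])
    also have "\<dots> = centre (g (w k)) + centre (g (w (k + 1)))"
      unfolding codesD(3)[OF w] using g[OF l(1)] g[OF l(2)] by (simp add: distrib_left)
    finally show "s * \<delta> k - s * \<delta> (k + 1) = centre (sector_isometry n i v * letter_dir n ((label_perm n R i \<circ> w) k))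
        + centre (sector_isometry n i v * letter_dir n ((label_perm n R i \<circ> w) (k + 1)))"
      by (simp add: g_def)
  qed
  then show ?thesis by blast
qed

lemma periodic_label_perm:
  assumes n: "n \<ge> 3" and R: "R > 0" and i: "i < 2 * n" and w: "\<And>k. w k \<in> {1..n}"
  shows "periodic_word (label_perm n R i \<circ> w) \<longleftrightarrow> periodic_word w"
  using inj_onD[OF label_perm_inj_on[OF n R i] _ w w] unfolding periodic_word_def by fastforce

section \<open>The renormalization sequence\<close>

lemma sector_isometry_polar:
  "sector_isometry n i (of_real c * cis \<theta>)
    = of_real c * cis (if even i then \<theta> - real i * (pi / (2 * real n)) else (real i + 1) * (pi / (2 * real n)) - \<theta>)"
  by (simp add: sector_isometry_def cis_mult cis_cnj mult.left_commute)

lemma base_sector_iff: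
  assumes n: "n \<ge> 3" and c: "0 < c" and \<theta>: "0 \<le> \<theta>" "\<theta> \<le> pi" and i: "i < 2 * n"
  shows "base_cone n (sector_isometry n i (of_real c * cis \<theta>)) \<longleftrightarrow>
    real i * (pi / (2 * real n)) < \<theta> \<and> \<theta> < (real i + 1) * (pi / (2 * real n))"
proof -
  define b where "b = pi / (2 * real n)"
  have b: "0 < b" using half_angle_bounds[OF n] by (simp add: b_def)
  have pib: "pi = 2 * real n * b" using n by (simp add: b_def)
  have ib: "0 \<le> real i * b" "real i * b \<le> (2 * real n - 1) * b"
    using i b by (auto intro!: mult_right_mono)
  then have ib': "real i * b + b \<le> pi" "0 \<le> real i * b" unfolding pib by (simp_all add: algebra_simps)
  show ?thesis
  proof (cases "even i")
    case True
    have "base_cone n (sector_isometry n i (of_real c * cis \<theta>)) \<longleftrightarrow> 0 < \<theta> - real i * b \<and> \<theta> - real i * b < b"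
      unfolding sector_isometry_polar b_def[symmetric] using True base_cone_cis[OF n c, of "\<theta> - real i * b"] ib' b \<theta>
      by (simp add: b_def[symmetric])
    then show ?thesis unfolding b_def[symmetric] by (simp add: algebra_simps)
  next
    case False
    then have "1 * b \<le> real i * b" using b by (intro mult_right_mono) (auto elim: oddE)
    then have "- pi < (real i + 1) * b - \<theta>" "(real i + 1) * b - \<theta> \<le> pi"
      using ib' b \<theta> unfolding distrib_right mult_1_left by linarith+
    then have "base_cone n (sector_isometry n i (of_real c * cis \<theta>)) \<longleftrightarrow>
        0 < (real i + 1) * b - \<theta> \<and> (real i + 1) * b - \<theta> < b"
      unfolding sector_isometry_polar b_def[symmetric] using False base_cone_cis[OF n c, of "(real i + 1) * b - \<theta>"]
      by (simp add: b_def[symmetric])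
    then show ?thesis unfolding b_def[symmetric] by (auto simp: algebra_simps)
  qed
qed

text \<open>
  The class of words in which renormalization takes place: it contains the words of nonperiodic
  trajectories and is preserved by normalizing, deriving and applying the Farey matrix.
\<close>

definition aperiodic_coding :: "nat \<Rightarrow> complex \<Rightarrow> (int \<Rightarrow> nat) \<Rightarrow> bool" where
  "aperiodic_coding n v w \<longleftrightarrow>
     0 \<le> Im v \<and> v \<noteq> 0 \<and> \<not> periodic_word w \<and> (\<exists>\<delta>. codes n v w \<delta>)"

lemma upper_half_polar:
  assumes "0 \<le> Im v" "v \<noteq> 0"
  obtains c \<theta> where "0 < c" "0 \<le> \<theta>" "\<theta> \<le> pi" "v = of_real c * cis \<theta>"
proof -
  have "v = of_real (cmod v) * cis (Arg v)" "0 < cmod v"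
    using assms by (simp_all add: cis_Arg sgn_eq)
  moreover have "0 \<le> Arg v" "Arg v \<le> pi"
    using assms Arg_le_pi by (auto simp: Arg_less_0)
  ultimately show ?thesis using that by blast
qed

lemma closed_sector_index:
  assumes n: "n \<ge> 3" and \<theta>: "0 \<le> \<theta>" "\<theta> \<le> pi"
  obtains i where "i < 2 * n" "\<theta> \<in> sector n i"
proof -
  define b where "b = pi / (2 * real n)"
  have b: "0 < b" using half_angle_bounds[OF n] by (simp add: b_def)
  have pib: "pi = 2 * real n * b" using n by (simp add: b_def)
  define i where "i = nat \<lfloor>\<theta> / b\<rfloor>"
  have "0 \<le> \<theta> / b" using \<theta> b by simp
  then have "real i \<le> \<theta> / b" "\<theta> / b < real i + 1" unfolding i_def by linarith+
  then have i: "real i * b \<le> \<theta>" "\<theta> < (real i + 1) * b" using b by (simp_all add: field_simps)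
  have form: "real j * b = real j * pi / (2 * real n)" "(real j + 1) * b = (real j + 1) * pi / (2 * real n)" for j
    by (simp_all add: b_def)
  show ?thesis
  proof (cases "i < 2 * n - 1")
    case True
    then have "\<theta> \<in> sector n i" using i unfolding form sector_def by simp
    then show ?thesis using that[of i] True by simp
  next
    case False
    then have "real (2 * n - 1) * b \<le> real i * b" using b by (intro mult_right_mono) auto
    then have "real (2 * n - 1) * b \<le> \<theta>" using i by simp
    then have "\<theta> \<in> sector n (2 * n - 1)" using \<theta> n unfolding form sector_def by simp
    then show ?thesis using that[of "2 * n - 1"] n by simp
  qed
qed

lemma sector_subset_closed_sector:
  assumes "n > 0" "i < 2 * n"
  shows "sector n i \<subseteq> closed_sector n i"
proof (cases "Suc i = 2 * n")
  case True
  then have eq: "real i + 1 = 2 * real n" by linarith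
  have "(real i + 1) * pi / (2 * real n) = pi" unfolding eq using assms(1) by simp
  then show ?thesis using True by (auto simp: sector_def closed_sector_def)
next
  case False
  then show ?thesis by (auto simp: sector_def closed_sector_def)
qed

text \<open>
  Every direction in the upper half plane lies in some closed sector; a nonperiodic word rules out
  the boundary directions.
\<close>

lemma aperiodic_base_sector:
  fixes R :: real
  assumes n: "n \<ge> 3" and R: "R > 0" and w: "aperiodic_coding n v w"
  shows "\<exists>i<2 * n. base_cone n (sector_isometry n i v)"
proof -
  define b where "b = pi / (2 * real n)"
  obtain c \<theta> where v: "0 < c" "0 \<le> \<theta>" "\<theta> \<le> pi" "v = of_real c * cis \<theta>"
    using upper_half_polar w unfolding aperiodic_coding_def by metis
  obtain i where i: "i < 2 * n" "\<theta> \<in> sector n i" using closed_sector_index[OF n v(2,3)] .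
  then have "\<theta> \<in> closed_sector n i" using sector_subset_closed_sector[of n i] n by auto
  then have \<theta>: "real i * b \<le> \<theta>" "\<theta> \<le> (real i + 1) * b" by (auto simp: closed_sector_def b_def)
  obtain \<delta> where \<delta>: "codes n v w \<delta>" and np: "\<not> periodic_word w" using w unfolding aperiodic_coding_def by blast
  obtain \<delta>' where \<delta>': "codes n (sector_isometry n i v) (label_perm n R i \<circ> w) \<delta>'"
    using codes_sector_isometry[OF n R i(1) \<delta>] by blast
  define \<psi> where "\<psi> = (if even i then \<theta> - real i * b else (real i + 1) * b - \<theta>)"
  have "codes n (of_real c * cis \<psi>) (label_perm n R i \<circ> w) \<delta>'"
    using \<delta>' unfolding v(4) sector_isometry_polar \<psi>_def b_def .
  then have "\<not> (\<psi> = 0 \<or> \<psi> = b)"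
    using boundary_direction_periodic[OF n v(1)] periodic_label_perm[OF n R i(1), of w, OF codesD(1)[OF \<delta>]] np
    unfolding b_def by blast
  then have "\<theta> \<noteq> real i * b" "\<theta> \<noteq> (real i + 1) * b"
    by (auto simp: \<psi>_def algebra_simps split: if_splits)
  then have "base_cone n (sector_isometry n i v)"
    using \<theta> unfolding v(4) base_sector_iff[OF n v(1-3) i(1)] b_def by linarith
  then show ?thesis using i(1) by blast
qed

lemma base_sector_unique:
  assumes n: "n \<ge> 3" and v: "0 \<le> Im v" and i: "i < 2 * n" "base_cone n (sector_isometry n i v)"
    and j: "j < 2 * n" "base_cone n (sector_isometry n j v)"
  shows "i = j"
proof -
  have "v \<noteq> 0" using i(2) by (auto simp: base_cone_def sector_isometry_def split: if_splits)
  then obtain c \<theta> where c: "0 < c" "0 \<le> \<theta>" "\<theta> \<le> pi" "v = of_real c * cis \<theta>"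
    using upper_half_polar[OF v] by metis
  define b where "b = pi / (2 * real n)"
  have b: "0 < b" using half_angle_bounds[OF n] by (simp add: b_def)
  have "real i * b < \<theta>" "\<theta> < (real i + 1) * b" "real j * b < \<theta>" "\<theta> < (real j + 1) * b"
    using i j unfolding c(4) base_sector_iff[OF n c(1-3) i(1)] base_sector_iff[OF n c(1-3) j(1)] b_def by blast+
  then have "real i * b < (real j + 1) * b" "real j * b < (real i + 1) * b" by linarith+
  then have "real i < real j + 1" "real j < real i + 1" using b by (simp_all only: mult_less_cancel_right_pos)
  then show ?thesis by linarith
qed

lemma renormalization_step:
  fixes R :: real
  assumes n: "n \<ge> 3" and R: "R > 0" and w: "aperiodic_coding n v w"
  shows "\<exists>i<2 * n. base_cone n (sector_isometry n i v) \<and>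
    (\<exists>w'. derived_sequence (label_perm n R i \<circ> w) w' \<and>
      aperiodic_coding n (farey_matrix n (sector_isometry n i v)) w')"
proof -
  obtain i where i: "i < 2 * n" and base: "base_cone n (sector_isometry n i v)"
    using aperiodic_base_sector[OF n R w] by blast
  obtain \<delta> where \<delta>: "codes n v w \<delta>" and np: "\<not> periodic_word w" using w unfolding aperiodic_coding_def by blast
  obtain \<delta>' where \<delta>': "codes n (sector_isometry n i v) (label_perm n R i \<circ> w) \<delta>'"
    using codes_sector_isometry[OF n R i \<delta>] by blast
  have "\<not> periodic_word (label_perm n R i \<circ> w)"
    using periodic_label_perm[OF n R i, of w, OF codesD(1)[OF \<delta>]] np by blast
  from derived_exists[OF n base \<delta>' this] obtain w' \<delta>'' where
    w': "derived_sequence (label_perm n R i \<circ> w) w'"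
      "codes n (farey_matrix n (sector_isometry n i v)) w' \<delta>''" "\<not> periodic_word w'" .
  have "0 < Im (farey_matrix n (sector_isometry n i v))"
    using base by (simp add: farey_matrix_def base_cone_def)
  then have "aperiodic_coding n (farey_matrix n (sector_isometry n i v)) w'"
    using w' unfolding aperiodic_coding_def by auto
  then show ?thesis using i base w'(1) by blast
qed

lemma renormalization_sequence:
  fixes R :: real
  assumes n: "n \<ge> 3" and R: "R > 0" and w: "aperiodic_coding n v w"
  obtains d V W where "V 0 = v" "W 0 = w" "\<And>k. d k < 2 * n" "\<And>k. aperiodic_coding n (V k) (W k)"
    "\<And>k. base_cone n (sector_isometry n (d k) (V k))"
    "\<And>k. derived_sequence (label_perm n R (d k) \<circ> W k) (W (Suc k))"
    "\<And>k. V (Suc k) = farey_matrix n (sector_isometry n (d k) (V k))"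
proof -
  define Q where "Q i x y \<longleftrightarrow> i < 2 * n \<and> base_cone n (sector_isometry n i (fst x)) \<and>
    derived_sequence (label_perm n R i \<circ> snd x) (snd y) \<and>
    fst y = farey_matrix n (sector_isometry n i (fst x))" for i x y
  have "\<exists>f. \<forall>k. ((k = 0 \<longrightarrow> f k = (v, w)) \<and> aperiodic_coding n (fst (f k)) (snd (f k))) \<and> (\<exists>i. Q i (f k) (f (Suc k)))"
  proof (rule dependent_nat_choice)
    show "\<exists>x. ((0::nat) = 0 \<longrightarrow> x = (v, w)) \<and> aperiodic_coding n (fst x) (snd x)" using w by simp
  next
    fix x and k :: nat
    assume "(k = 0 \<longrightarrow> x = (v, w)) \<and> aperiodic_coding n (fst x) (snd x)"
    then obtain i w' where "i < 2 * n" "base_cone n (sector_isometry n i (fst x))"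
      "derived_sequence (label_perm n R i \<circ> snd x) w'"
      "aperiodic_coding n (farey_matrix n (sector_isometry n i (fst x))) w'"
      using renormalization_step[OF n R] by blast
    then show "\<exists>y. ((Suc k = 0 \<longrightarrow> y = (v, w)) \<and> aperiodic_coding n (fst y) (snd y)) \<and> (\<exists>i. Q i x y)"
      unfolding Q_def by (intro exI[of _ "(farey_matrix n (sector_isometry n i (fst x)), w')"]) auto
  qed
  then obtain f where f: "f 0 = (v, w)" "\<And>k. aperiodic_coding n (fst (f k)) (snd (f k))"
    "\<And>k. \<exists>i. Q i (f k) (f (Suc k))" by blast
  obtain d where d: "\<And>k. Q (d k) (f k) (f (Suc k))" using f(3) by metis
  show ?thesis
    using that[of "\<lambda>k. fst (f k)" "\<lambda>k. snd (f k)" d] f(1,2) d unfolding Q_def by auto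
qed

section \<open>A nonperiodic word contains a doubled letter\<close>

text \<open>
  In diagram \<open>0\<close> the letters form the path \<open>1, n, 2, n - 1, \<dots>\<close> with a loop at its far end. The small
  letters are those at odd places, so only the loop joins two letters of the same kind.
\<close>

definition small_letter :: "nat \<Rightarrow> nat \<Rightarrow> bool" where
  "small_letter n l \<longleftrightarrow> 2 * l \<le> n + 1"

lemma small_letters_alternate:
  assumes n: "n \<ge> 3" and u: "base_cone n u" and w: "codes n u w \<delta>" and ne: "w k \<noteq> w (k + 1)"
  shows "small_letter n (w (k + 1)) \<longleftrightarrow> \<not> small_letter n (w k)"
  using transition_sums[OF n u w, of k] ne unfolding small_letter_def by linarith

text \<open>
  Between two consecutive sandwiched letters the word moves along the path of diagram \<open>0\<close> without turning.
  After an even positive number of steps it is at a different letter of the same kind; after an odd number it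
  is at a letter of the other kind, because without doubled letters the two kinds alternate.
\<close>

lemma derived_no_double_letter:
  assumes n: "n \<ge> 3" and u: "base_cone n u" and w: "codes n u w \<delta>" and ne: "\<And>k. w k \<noteq> w (k + 1)"
    and w': "derived_sequence w w'"
  shows "w' k \<noteq> w' (k + 1)"
proof -
  obtain f where f: "strict_mono f" "range f = sandwiched w" "w' = w \<circ> f"
    using w' unfolding derived_sequence_def by blast
  define s where "s i = w i + w (i + 1)" for i
  have s: "s i = n + 1 \<or> s i = n + 2" for i
    unfolding s_def by (rule transition_sums[OF n u w])
  define i where "i = f k"
  have lt: "i < f (k + 1)" using f(1) by (simp add: strict_mono_def i_def)
  define m where "m = nat (f (k + 1) - i)"
  have m: "f (k + 1) = i + int m" "0 < m" using lt by (simp_all add: m_def)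
  have alt: "s (j + 1) \<noteq> s j" if "i \<le> j" "j + 1 < i + int m" for j
  proof -
    have "j + 1 \<notin> sandwiched w"
    proof
      assume "j + 1 \<in> sandwiched w"
      then obtain k' where "j + 1 = f k'" using f(2) by auto
      then have "f k < f k'" "f k' < f (k + 1)" using that m(1) by (auto simp: i_def)
      then show False using f(1) by (simp add: strict_mono_less)
    qed
    then show ?thesis by (simp add: sandwiched_def s_def)
  qed
  have "w (i + int m) \<noteq> w i"
  proof (cases "even m")
    case True
    then obtain h where h: "m = 2 * h" by blast
    have "s (i + 2 * int j) = s i \<and> int (w (i + 2 * int j)) = int (w i) + int j * (int (s (i + 1)) - int (s i))"
      if "j < h" for j
      using that
    proof (induction j)
      case 0
      then show ?case by simp
    next
      case (Suc j)
      define a where "a = i + 2 * int j"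
      have IH: "s a = s i" "int (w a) = int (w i) + int j * (int (s (i + 1)) - int (s i))"
        using Suc by (auto simp: a_def)
      have "s (a + 1) \<noteq> s a" "s (a + 2) \<noteq> s (a + 1)" "s (i + 1) \<noteq> s i"
        using alt[of a] alt[of "a + 1"] alt[of i] Suc.prems h by (auto simp: a_def add.assoc)
      then have "s (a + 1) = s (i + 1)" "s (a + 2) = s i"
        using s[of a] s[of "a + 1"] s[of "a + 2"] s[of i] s[of "i + 1"] IH(1) by auto
      moreover have "int (w (a + 2)) = int (w a) + (int (s (a + 1)) - int (s a))"
        by (simp add: s_def add.assoc)
      ultimately have "s (a + 2) = s i \<and> int (w (a + 2)) = int (w i) + int (Suc j) * (int (s (i + 1)) - int (s i))"
        using IH by (simp add: algebra_simps)
      then show ?case by (simp add: a_def algebra_simps)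
    qed
    from this[of "h - 1"] have a: "s (i + 2 * int (h - 1)) = s i"
      "int (w (i + 2 * int (h - 1))) = int (w i) + int (h - 1) * (int (s (i + 1)) - int (s i))"
      using m(2) h by auto
    define a where "a = i + 2 * int (h - 1)"
    have am: "i + int m = a + 2" using m(2) h by (simp add: a_def of_nat_diff)
    have "s (a + 1) \<noteq> s a" "s (i + 1) \<noteq> s i"
      using alt[of a] alt[of i] m(2) h am by (auto simp: a_def)
    then have "s (a + 1) = s (i + 1)" "s a = s i"
      using s[of a] s[of "a + 1"] s[of i] s[of "i + 1"] a(1) unfolding a_def by auto
    moreover have "int (w (a + 2)) = int (w a) + (int (s (a + 1)) - int (s a))"
      by (simp add: s_def add.assoc)
    ultimately have "int (w (a + 2)) = int (w i) + int h * (int (s (i + 1)) - int (s i))"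
      using a(2) m(2) h unfolding a_def[symmetric] by (simp add: of_nat_diff algebra_simps)
    then show ?thesis using \<open>s (i + 1) \<noteq> s i\<close> m(2) h am by auto
  next
    case False
    have "small_letter n (w (i + int j)) \<longleftrightarrow> (even j = small_letter n (w i))" for j
    proof (induction j)
      case (Suc j)
      then show ?case using small_letters_alternate[OF n u w ne, of "i + int j"] by (auto simp: algebra_simps)
    qed simp
    then show ?thesis using False by metis
  qed
  then show ?thesis unfolding f(3) i_def using m(1) i_def by (metis comp_apply)
qed

text \<open>
  The letters \<open>a\<close> and \<open>b\<close> are the largest small and the least large letter in \<open>S\<close>. If their sum is \<open>n + 1\<close>
  or \<open>n + 2\<close> they are the last two letters of \<open>S\<close> on the path of diagram \<open>0\<close>: the last one is \<open>b\<close> in the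
  first case and \<open>a\<close> in the second.
\<close>

definition central_gap :: "nat \<Rightarrow> nat \<Rightarrow> nat \<Rightarrow> nat set \<Rightarrow> bool" where
  "central_gap n a b S \<longleftrightarrow>
     a \<in> S \<and> b \<in> S \<and> 2 * a \<le> n + 1 \<and> n + 1 < 2 * b \<and> (\<forall>l\<in>S. l \<le> a \<or> b \<le> l)"

lemma central_gap_exists:
  assumes n: "n \<ge> 3" and u: "base_cone n u" and w: "codes n u w \<delta>" and ne: "\<And>k. w k \<noteq> w (k + 1)"
  obtains a b where "central_gap n a b (range w)" "a + b = n + 1 \<or> a + b = n + 2"
proof -
  define A where "A = {l \<in> range w. small_letter n l}"
  define B where "B = {l \<in> range w. \<not> small_letter n l}"
  have sub: "range w \<subseteq> {1..n}" using codesD(1)[OF w] by auto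
  then have fin: "finite A" "finite B"
    unfolding A_def B_def using finite_subset[OF sub] by auto
  have alt: "small_letter n (w (k + 1)) \<longleftrightarrow> \<not> small_letter n (w k)" for k
    using small_letters_alternate[OF n u w ne] .
  have nonempty: "A \<noteq> {}" "B \<noteq> {}" using alt[of 0] unfolding A_def B_def by auto
  define a where "a = Max A"
  define b where "b = Min B"
  have a: "a \<in> A" and a_max: "\<And>l. l \<in> A \<Longrightarrow> l \<le> a" using fin nonempty by (auto simp: a_def)
  have b: "b \<in> B" and b_min: "\<And>l. l \<in> B \<Longrightarrow> b \<le> l" using fin nonempty by (auto simp: b_def)
  have "l \<le> a \<or> b \<le> l" if "l \<in> range w" for l
    using a_max[of l] b_min[of l] that by (cases "small_letter n l") (simp_all add: A_def B_def)
  then have "central_gap n a b (range w)"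
    using a b unfolding central_gap_def by (simp add: A_def B_def small_letter_def)
  moreover have "a + b \<le> n + 2"
  proof -
    obtain i where i: "a = w i" "small_letter n (w i)" using a by (auto simp: A_def)
    then have "w (i + 1) \<in> B" using alt[of i] by (simp add: B_def)
    then have "b \<le> w (i + 1)" by (rule b_min)
    then show ?thesis using transition_sums[OF n u w, of i] i(1) by linarith
  qed
  moreover have "n + 1 \<le> a + b"
  proof -
    obtain j where j: "b = w j" "\<not> small_letter n (w j)" using b by (auto simp: B_def)
    then have "w (j + 1) \<in> A" using alt[of j] by (simp add: A_def)
    then have "w (j + 1) \<le> a" by (rule a_max)
    then show ?thesis using transition_sums[OF n u w, of j] j(1) by linarith
  qed
  ultimately show ?thesis using that by (metis Suc_eq_plus1 add_2_eq_Suc' le_Suc_eq le_antisym)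
qed

lemma label_perm_1:
  assumes "n \<ge> 3" "R > 0" "l \<in> {1..n}"
  shows "label_perm n R 1 l = n + 1 - l"
proof -
  have "label_perm n R 1 l = (3 * n - 1 - (l - 1)) mod n + 1"
    using label_perm_eq[of n R 1 l] assms by (simp add: image_side_def side_label_def)
  also have "3 * n - 1 - (l - 1) = (n - l) + 2 * n" using assms by auto
  also have "\<dots> mod n = (n - l) mod n" by (rule mod_mult_self1)
  also have "(n - l) mod n = n - l" using assms by auto
  finally show ?thesis using assms by auto
qed

lemma label_perm_last:
  assumes "n \<ge> 3" "R > 0" "l \<in> {1..n}"
  shows "label_perm n R (2 * n - 1) l = (if l = 1 then 1 else n + 2 - l)"
proof -
  have "label_perm n R (2 * n - 1) l = (3 * n - n - (l - 1)) mod n + 1"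
    using label_perm_eq[of n R "2 * n - 1" l] assms by (simp add: image_side_def side_label_def)
  also have "3 * n - n - (l - 1) = (if l = 1 then 2 * n else (n + 1 - l) + n)" using assms by auto
  also have "\<dots> mod n = (if l = 1 then 0 else n + 1 - l)"
  proof (cases "l = 1")
    case False
    have "((n + 1 - l) + n) mod n = (n + 1 - l) mod n" by (rule mod_add_self2)
    also have "\<dots> = n + 1 - l" using False assms(3) by auto
    finally show ?thesis using False by simp
  qed simp
  finally show ?thesis using assms by auto
qed

text \<open>
  Relabelling after the next step preserves the gap. The relabelling of diagram \<open>1\<close> exchanges the letters
  of sum \<open>n + 1\<close>, that of diagram \<open>2 * n - 1\<close> those of sum \<open>n + 2\<close>; the hypothesis on \<open>a + b\<close> makes
  \<open>a\<close> and \<open>b\<close> such a pair.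
\<close>

lemma central_gap_perm_1:
  assumes n: "n \<ge> 3" and R: "R > 0" and S: "S \<subseteq> {1..n}" and gap: "central_gap n a b S" and ab: "a + b = n + 1"
  shows "central_gap n a b (label_perm n R 1 ` S)"
proof -
  have eq: "label_perm n R 1 ` S = (\<lambda>l. n + 1 - l) ` S"
    using S label_perm_1[OF n R] by (intro image_cong) auto
  have g: "a \<in> S" "b \<in> S" "2 * a \<le> n + 1" "n + 1 < 2 * b" "\<And>l. l \<in> S \<Longrightarrow> l \<le> a \<or> b \<le> l"
    using gap unfolding central_gap_def by auto
  have "a = n + 1 - b" "b = n + 1 - a" using ab by auto
  then have "a \<in> (\<lambda>l. n + 1 - l) ` S" "b \<in> (\<lambda>l. n + 1 - l) ` S" using g(1,2) by blast+
  moreover have "n + 1 - l \<le> a \<or> b \<le> n + 1 - l" if "l \<in> S" for l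
    using g(5)[OF that] ab by linarith
  ultimately show ?thesis unfolding eq central_gap_def using g(3,4) by blast
qed

lemma central_gap_perm_last:
  assumes n: "n \<ge> 3" and R: "R > 0" and S: "S \<subseteq> {1..n}" and gap: "central_gap n a b S" and ab: "a + b = n + 2"
  shows "central_gap n a b (label_perm n R (2 * n - 1) ` S)"
proof -
  define p where "p l = (if l = 1 then 1 else n + 2 - l)" for l
  have eq: "label_perm n R (2 * n - 1) ` S = p ` S"
    using S label_perm_last[OF n R] unfolding p_def by (intro image_cong) auto
  have g: "a \<in> S" "b \<in> S" "2 * a \<le> n + 1" "n + 1 < 2 * b" "\<And>l. l \<in> S \<Longrightarrow> l \<le> a \<or> b \<le> l"
    using gap unfolding central_gap_def by auto
  have bn: "b \<le> n" using g(2) S by auto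
  then have "a = p b" "b = p a" using ab g(3,4) n by (auto simp: p_def)
  then have "a \<in> p ` S" "b \<in> p ` S" using g(1,2) by blast+
  moreover have "p l \<le> a \<or> b \<le> p l" if "l \<in> S" for l
    using g(5)[OF that] ab bn unfolding p_def by auto
  ultimately show ?thesis unfolding eq central_gap_def using g(3,4) by blast
qed

text \<open>
  The Farey matrix followed by the isometry of sector \<open>1\<close> is a parabolic map fixing the direction
  \<open>pi / (2 * real n)\<close>: the component across this direction is kept.
\<close>

lemma sector_isometry_1_farey:
  fixes u :: complex
  assumes n: "n \<ge> 3"
  defines "b \<equiv> pi / (2 * real n)"
  defines "z \<equiv> sector_isometry n 1 (farey_matrix n u)"
  shows "Im z = Im u - 2 * sin b * cos b * (Re u - cot b * Im u)"
    and "Re z - cot b * Im z = Re u - cot b * Im u"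
proof -
  note b = half_angle_bounds[OF n, folded b_def]
  define E where "E = Re u - cot b * Im u"
  have c2: "cos (b + b) = 2 * (cos b * cos b) - 1"
    using sin_cos_squared_add[of b] unfolding cos_add power2_eq_square by linarith
  have c2': "cos (b + b) = 1 - 2 * (sin b * sin b)"
    using sin_cos_squared_add[of b] unfolding cos_add power2_eq_square by linarith
  have s2: "sin (b + b) = 2 * (sin b * cos b)" unfolding sin_add by simp
  have "(real 1 + 1) * pi / (2 * real n) = b + b" by (simp add: b_def)
  then have z: "z = cis (b + b) * cnj (farey_matrix n u)" by (simp add: z_def sector_isometry_def)
  have f: "Re (farey_matrix n u) = cot b * Im u - E" "Im (farey_matrix n u) = Im u"
    by (simp_all add: farey_matrix_def b_def[symmetric] E_def)
  have cs: "cot b * sin b = cos b" using b by (simp add: cot_def)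
  have "Im z = sin (b + b) * (cot b * Im u - E) - cos (b + b) * Im u"
    unfolding z by (simp add: f)
  also have "\<dots> = 2 * (cot b * sin b) * cos b * Im u - 2 * sin b * cos b * E - (2 * (cos b * cos b) - 1) * Im u"
    unfolding s2 unfolding c2 by (simp add: algebra_simps)
  also have "\<dots> = Im u - 2 * sin b * cos b * E" unfolding cs by (simp add: algebra_simps)
  finally show Im: "Im z = Im u - 2 * sin b * cos b * (Re u - cot b * Im u)" by (simp add: E_def)
  have "Re z = cos (b + b) * (cot b * Im u - E) + sin (b + b) * Im u"
    unfolding z by (simp add: f)
  also have "\<dots> = cot b * Im u - 2 * (cot b * sin b) * sin b * Im u - (1 - 2 * (sin b * sin b)) * E + 2 * sin b * cos b * Im u"
    unfolding s2 unfolding c2' by (simp add: algebra_simps)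
  also have "\<dots> = cot b * Im u - E + 2 * (sin b * sin b) * E"
    unfolding cs by (simp add: algebra_simps)
  finally have Re: "Re z = cot b * Im u - E + 2 * (sin b * sin b) * E" .
  have "cot b * Im z = cot b * Im u - 2 * (cot b * sin b) * cos b * E"
    unfolding Im E_def[symmetric] by (simp add: algebra_simps)
  also have "\<dots> = cot b * Im u - 2 * (cos b * cos b) * E" unfolding cs by simp
  finally have cotIm: "cot b * Im z = cot b * Im u - 2 * (cos b * cos b) * E" .
  have "2 * (sin b * sin b) * E + 2 * (cos b * cos b) * E = 2 * (sin b * sin b + cos b * cos b) * E"
    by (simp add: algebra_simps del: sin_cos_squared_add3)
  also have "\<dots> = 2 * E" using sin_cos_squared_add[of b] by (simp add: power2_eq_square)
  finally show "Re z - cot b * Im z = Re u - cot b * Im u"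
    unfolding Re cotIm E_def[symmetric] by linarith
qed

text \<open>
  For the last sector the composite is a parabolic map fixing the horizontal.
\<close>

lemma sector_isometry_last_farey:
  fixes u :: complex
  assumes n: "n \<ge> 3"
  defines "z \<equiv> sector_isometry n (2 * n - 1) (farey_matrix n u)"
  shows "Im z = Im u" and "Re z = Re u - 2 * cot (pi / (2 * real n)) * Im u"
proof -
  have "(real (2 * n - 1) + 1) * pi / (2 * real n) = pi" using n by (simp add: of_nat_diff)
  moreover have "odd (2 * n - 1)" using n by simp
  ultimately have "z = - cnj (farey_matrix n u)" by (simp add: z_def sector_isometry_def)
  then show "Im z = Im u" "Re z = Re u - 2 * cot (pi / (2 * real n)) * Im u"
    by (simp_all add: farey_matrix_def)
qed

text \<open>
  For a direction pointing upwards the exit sides among the sides \<open>0, \<dots>, n - 1\<close> form an initial segment.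
\<close>

lemma letter_side_sign:
  assumes n: "n \<ge> 3" and ab: "a \<in> {1..n}" "b \<in> {1..n}" "a < b" and z: "0 < Im z"
    and b: "0 \<le> Im (z * letter_dir n b)"
  shows "0 < Im (z * letter_dir n a)"
proof -
  define x where "x = (real a - 1) * pi / real n"
  define y where "y = (real b - 1) * pi / real n"
  have pos: "0 < pi / (2 * real n)" using half_angle_bounds[OF n] by simp
  have "0 \<le> x" unfolding x_def by (rule letter_angle_bounds(1)[OF n ab(1)])
  moreover have "x < y" using ab(3) n by (auto simp: x_def y_def intro!: divide_strict_right_mono)
  moreover have "y < pi" using letter_angle_bounds(2)[OF n ab(2), folded y_def] pos by linarith
  ultimately have x: "0 \<le> x" "x < y" "y < pi" by blast+
  have sy: "0 < sin y" using x by (intro sin_gt_zero) auto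
  have e: "letter_dir n a = cis x" "letter_dir n b = cis y"
    by (simp_all add: letter_dir_def x_def y_def)
  have "Im (z * letter_dir n a) * sin y = Im (z * letter_dir n b) * sin x + Im z * sin (y - x)"
    unfolding e by (simp add: sin_diff algebra_simps)
  moreover have "0 \<le> Im (z * letter_dir n b) * sin x"
    using b x by (intro mult_nonneg_nonneg sin_ge_zero) auto
  moreover have "0 < Im z * sin (y - x)" using z x by (intro mult_pos_pos sin_gt_zero) auto
  ultimately have "0 < Im (z * letter_dir n a) * sin y" by linarith
  then show ?thesis using sy by (simp only: zero_less_mult_pos2)
qed

text \<open>
  Let \<open>q\<close> be the last and \<open>r\<close> the last but one of the occurring letters on the path. A word without
  doubled letters can leave \<open>q\<close> only towards \<open>r\<close>, so every \<open>q\<close> is sandwiched. The sign of the new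
  width at \<open>q\<close> forces the same sign at \<open>r\<close>. As \<open>r\<close> occurs sandwiched as well, it does so between two
  letters \<open>q\<close>. Hence \<open>r\<close> and \<open>q\<close> are neighbours in the derived word, and the bound on the
  displacement between them leaves only one sector for the image direction.
\<close>

lemma central_gap_next_sector:
  assumes n: "n \<ge> 3" and u: "base_cone n u" and w: "codes n u w \<delta>" and ne: "\<And>k. w k \<noteq> w (k + 1)"
    and all: "range w \<subseteq> w ` sandwiched w" and gap: "central_gap n a b (range w)"
  shows "a + b = n + 1 \<Longrightarrow> base_cone n (sector_isometry n 1 (farey_matrix n u))"
    and "a + b = n + 2 \<Longrightarrow> base_cone n (sector_isometry n (2 * n - 1) (farey_matrix n u))"
proof -
  define v where "v = farey_matrix n u"
  define \<beta> where "\<beta> = pi / (2 * real n)"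
  note \<beta> = half_angle_bounds[OF n, folded \<beta>_def]
  have uY: "0 < Im u" and uX: "0 < Re u - cot \<beta> * Im u" using u by (auto simp: base_cone_def \<beta>_def)
  have v: "Re v = 2 * cot \<beta> * Im u - Re u" "Im v = Im u" by (simp_all add: v_def \<beta>_def farey_matrix_def)
  have g: "a \<in> range w" "b \<in> range w" "2 * a \<le> n + 1" "n + 1 < 2 * b" "\<And>l. l \<in> range w \<Longrightarrow> l \<le> a \<or> b \<le> l"
    using gap unfolding central_gap_def by auto
  have abn: "a \<in> {1..n}" "b \<in> {1..n}" using g(1,2) codesD(1)[OF w] by auto
  have ab: "a < b" using g by simp
  have pos: "0 < Im (u * letter_dir n (w j))" for j
    using Im_letter_dir_pos[OF n codesD(1)[OF w] u] .
  have width: "w k + w (k + 1) = n + 1 \<Longrightarrow> \<bar>\<delta> k\<bar> < tan \<beta> * Im (v * letter_dir n (w k))"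
    "w k + w (k + 1) = n + 2 \<Longrightarrow> \<bar>\<delta> k\<bar> < - tan \<beta> * Im (v * letter_dir n (w k))" if "k \<in> sandwiched w" for k
    using sandwiched_width[OF n u w that] unfolding v_def \<beta>_def by blast+
  have sign: "w k + w (k + 1) = n + 1 \<Longrightarrow> 0 < Im (v * letter_dir n (w k))"
    "w k + w (k + 1) = n + 2 \<Longrightarrow> Im (v * letter_dir n (w k)) < 0" if k: "k \<in> sandwiched w" for k
  proof -
    show "0 < Im (v * letter_dir n (w k))" if "w k + w (k + 1) = n + 1"
    proof -
      have "0 < tan \<beta> * Im (v * letter_dir n (w k))" using width(1)[OF k that] by linarith
      then show ?thesis using \<beta>(5) by (simp only: zero_less_mult_pos)
    qed
    show "Im (v * letter_dir n (w k)) < 0" if "w k + w (k + 1) = n + 2"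
    proof -
      have "0 < tan \<beta> * (- Im (v * letter_dir n (w k)))" using width(2)[OF k that] by linarith
      then have "0 < - Im (v * letter_dir n (w k))" using \<beta>(5) by (simp only: zero_less_mult_pos)
      then show ?thesis by simp
    qed
  qed
  have vpos: "0 < Im v" using uY v(2) by simp
  have sums: "w k + w (k + 1) = n + 1 \<or> w k + w (k + 1) = n + 2" for k
    by (rule transition_sums[OF n u w])
  have diff: "\<delta> k - \<delta> (k + 1) = Re (u * letter_dir n (w k)) + Re (u * letter_dir n (w (k + 1)))" for k
    using codesD(3)[OF w, of k] pos by (simp add: centre_def)
  show "base_cone n (sector_isometry n 1 (farey_matrix n u))" if s: "a + b = n + 1"
  proof -
    have after: "w (k + 1) = a" if "w k = b" for k
      using sums[of k] ne[of k] g(5)[of "w (k + 1)"] that s ab by auto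
    have before: "w (k - 1) = a" if "w k = b" for k
      using sums[of "k - 1"] ne[of "k - 1"] g(5)[of "w (k - 1)"] that s ab by auto
    have sw: "k \<in> sandwiched w" if "w k = b" for k
      using after[OF that] before[OF that] by (simp add: sandwiched_def)
    obtain j where j: "w j = b" using g(2) by auto
    have "0 < Im (v * letter_dir n b)" using sign(1)[OF sw[OF j]] j after[OF j] s by (simp only: add.commute)
    then have a_pos: "0 < Im (v * letter_dir n a)"
      by (intro letter_side_sign[OF n abn ab vpos] less_imp_le)
    obtain i where i: "w i = a" "i \<in> sandwiched w" using subsetD[OF all g(1)] by blast
    have "w i + w (i + 1) = n + 1" using sums[of i] sign(2)[OF i(2)] i(1) a_pos by auto
    then have ib: "w (i + 1) = b" using i(1) s by simp
    have "w (i + 1) + w (i + 1 + 1) = n + 1" using ib after[OF ib] s by simp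
    from width(1)[OF sw[OF ib] this] width(1)[OF i(2) \<open>w i + w (i + 1) = n + 1\<close>]
    have "\<bar>\<delta> i\<bar> < tan \<beta> * Im (v * letter_dir n a)" "\<bar>\<delta> (i + 1)\<bar> < tan \<beta> * Im (v * letter_dir n b)"
      using i(1) ib by simp_all
    then have "Re (u * letter_dir n a) + Re (u * letter_dir n b)
        < tan \<beta> * (Im (v * letter_dir n a) + Im (v * letter_dir n b))"
      using diff[of i] i(1) ib unfolding distrib_left by simp
    moreover define S where "S = sin ((real a - 1) * pi / real n + \<beta>)"
    have ln: "a \<le> n" "b \<le> n" using abn by auto
    note p = letter_dir_pair_lower[OF n s ln, folded \<beta>_def, folded S_def]
    ultimately have "2 * S * (Re u * sin \<beta> - Im u * cos \<beta>) < 2 * S * (tan \<beta> * (Im v * sin \<beta> + Re v * cos \<beta>))"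
      unfolding p(3) p(4) by (simp add: mult_ac)
    then have lt: "Re u * sin \<beta> - Im u * cos \<beta> < tan \<beta> * (Im v * sin \<beta> + Re v * cos \<beta>)"
      using p(2) by (simp only: mult_less_cancel_left_pos mult_pos_pos zero_less_numeral)
    define E where "E = Re u - cot \<beta> * Im u"
    have cs: "cot \<beta> * sin \<beta> = cos \<beta>" "tan \<beta> * cos \<beta> = sin \<beta>" using \<beta> by (simp_all add: cot_def tan_def)
    have X: "Re u = E + cot \<beta> * Im u" by (simp add: E_def)
    have l: "Re u * sin \<beta> - Im u * cos \<beta> = E * sin \<beta>"
      unfolding X using cs(1) by (simp add: algebra_simps)
    have r: "tan \<beta> * (Im v * sin \<beta> + Re v * cos \<beta>) = tan \<beta> * sin \<beta> * Im u + cos \<beta> * Im u - E * sin \<beta>"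
    proof -
      have "tan \<beta> * (Im v * sin \<beta> + Re v * cos \<beta>) = tan \<beta> * sin \<beta> * Im u + (tan \<beta> * cos \<beta>) * Re v"
        unfolding v(2) by (simp add: algebra_simps)
      also have "(tan \<beta> * cos \<beta>) * Re v = (cot \<beta> * sin \<beta>) * Im u - E * sin \<beta>"
        unfolding cs(2) v(1) X by (simp add: algebra_simps)
      finally show ?thesis unfolding cs(1) by simp
    qed
    have "cos \<beta> * (2 * E * sin \<beta>) < cos \<beta> * (tan \<beta> * sin \<beta> * Im u + cos \<beta> * Im u)"
      using lt unfolding l r using \<beta>(4) by (intro mult_strict_left_mono) auto
    also have "\<dots> = (tan \<beta> * cos \<beta>) * sin \<beta> * Im u + cos \<beta> * cos \<beta> * Im u" by (simp add: algebra_simps)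
    also have "\<dots> = (sin \<beta> * sin \<beta> + cos \<beta> * cos \<beta>) * Im u" unfolding cs(2) by (simp only: distrib_right)
    also have "\<dots> = Im u" using sin_cos_squared_add[of \<beta>] by (simp add: power2_eq_square)
    finally have "2 * sin \<beta> * cos \<beta> * E < Im u" by (simp add: mult_ac)
    then have "0 < Im (sector_isometry n 1 (farey_matrix n u))"
      using sector_isometry_1_farey(1)[OF n, of u] unfolding \<beta>_def[symmetric] E_def[symmetric] by simp
    then show ?thesis
      using sector_isometry_1_farey(2)[OF n, of u] uX unfolding base_cone_def \<beta>_def[symmetric] by linarith
  qed
  show "base_cone n (sector_isometry n (2 * n - 1) (farey_matrix n u))" if s: "a + b = n + 2"
  proof -
    have after: "w (k + 1) = b" if "w k = a" for k
      using sums[of k] ne[of k] g(5)[of "w (k + 1)"] that s ab by auto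
    have before: "w (k - 1) = b" if "w k = a" for k
      using sums[of "k - 1"] ne[of "k - 1"] g(5)[of "w (k - 1)"] that s ab by auto
    have sw: "k \<in> sandwiched w" if "w k = a" for k
      using after[OF that] before[OF that] by (simp add: sandwiched_def)
    obtain j where j: "w j = a" using g(1) by auto
    have a_neg: "Im (v * letter_dir n a) < 0" using sign(2)[OF sw[OF j]] j after[OF j] s by (simp only:)
    have b_neg: "Im (v * letter_dir n b) < 0"
      using letter_side_sign[OF n abn ab vpos] a_neg by (meson not_le order_less_asym)
    obtain i where i: "w i = b" "i \<in> sandwiched w" using subsetD[OF all g(2)] by blast
    have sum: "w i + w (i + 1) = n + 2" using sums[of i] sign(1)[OF i(2)] i(1) b_neg by auto
    then have ia: "w (i + 1) = a" using i(1) s by simp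
    have "w (i + 1) + w (i + 1 + 1) = n + 2" using ia after[OF ia] s by simp
    from width(2)[OF sw[OF ia] this] width(2)[OF i(2) sum]
    have "\<bar>\<delta> i\<bar> < - tan \<beta> * Im (v * letter_dir n b)" "\<bar>\<delta> (i + 1)\<bar> < - tan \<beta> * Im (v * letter_dir n a)"
      using i(1) ia by simp_all
    then have "- (Re (u * letter_dir n a) + Re (u * letter_dir n b))
        < - tan \<beta> * (Im (v * letter_dir n a) + Im (v * letter_dir n b))"
      using diff[of i] i(1) ia unfolding distrib_left by simp
    moreover define S where "S = sin ((real a - 1) * pi / real n)"
    have ln: "a \<le> n" "b \<le> n" using abn by auto
    note p = letter_dir_pair_upper[OF n s ln, folded S_def]
    ultimately have "2 * S * Im u < 2 * S * (- tan \<beta> * Re v)"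
      unfolding p(3) p(4) by (simp add: mult_ac)
    then have lt: "Im u < - tan \<beta> * Re v"
      using p(2) by (simp only: mult_less_cancel_left_pos mult_pos_pos zero_less_numeral)
    have "cot \<beta> * Im u < cot \<beta> * (- tan \<beta> * Re v)" using lt \<beta> by (intro mult_strict_left_mono) auto
    also have "\<dots> = - Re v" using \<beta> by (simp add: cot_def tan_def)
    finally show ?thesis
      using uY sector_isometry_last_farey[OF n, of u] v(1) unfolding base_cone_def \<beta>_def[symmetric] by simp
  qed
qed

lemma eventually_constant_card:
  fixes S :: "nat \<Rightarrow> nat"
  assumes "\<And>k. S (Suc k) \<le> S k"
  obtains K where "\<And>k. k \<ge> K \<Longrightarrow> S k = S K"
proof -
  obtain K where K: "\<And>k. S K \<le> S k" using ex_has_least_nat[of "\<lambda>_. True" 0 S] by auto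
  have "S k = S K" if "k \<ge> K" for k
    using lift_Suc_antimono_le[of S K k] assms that K[of k] by force
  then show ?thesis using that by blast
qed

text \<open>
  Suppose that no letter is doubled. Then this persists under renormalization, and the alphabets of the
  words can only shrink, so that from some step on deriving loses no letter. From there on the gap between
  small and large letters is preserved, and the next sector is always \<open>1\<close> or always the last one. The
  direction is then moved forever by the same parabolic map, which pushes it out of the base
  sector after finitely many steps.
\<close>

theorem double_letter_occurs:
  fixes R :: real
  assumes n: "n \<ge> 3" and R: "R > 0" and w: "aperiodic_coding n v w"
  shows "\<exists>k. w k = w (k + 1)"
proof (rule ccontr)
  assume none: "\<nexists>k. w k = w (k + 1)"
  obtain d V W where init: "V 0 = v" "W 0 = w" and d: "\<And>k. d k < 2 * n"
    and ap: "\<And>k. aperiodic_coding n (V k) (W k)"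
    and base: "\<And>k. base_cone n (sector_isometry n (d k) (V k))"
    and der: "\<And>k. derived_sequence (label_perm n R (d k) \<circ> W k) (W (Suc k))"
    and V: "\<And>k. V (Suc k) = farey_matrix n (sector_isometry n (d k) (V k))"
    using renormalization_sequence[OF n R w] by blast
  define U where "U k = label_perm n R (d k) \<circ> W k" for k
  define u where "u k = sector_isometry n (d k) (V k)" for k
  have Wrange: "W k i \<in> {1..n}" for k i
    using ap[of k] codesD(1) unfolding aperiodic_coding_def by blast
  have "\<exists>\<delta>. codes n (u k) (U k) \<delta>" for k
    using ap[of k] codes_sector_isometry[OF n R d[of k]] unfolding aperiodic_coding_def u_def U_def by blast
  then obtain \<delta> where \<delta>: "\<And>k. codes n (u k) (U k) (\<delta> k)" by metis
  note base' = base[folded u_def]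
  have U_ne: "U k i \<noteq> U k (i + 1)" if "\<And>i. W k i \<noteq> W k (i + 1)" for k i
    using inj_onD[OF label_perm_inj_on[OF n R d[of k]] _ Wrange Wrange, of k i k "i + 1"] that[of i]
    unfolding U_def by auto
  have W_ne: "W k i \<noteq> W k (i + 1)" for k i
  proof (induction k arbitrary: i)
    case 0
    then show ?case using none init(2) by simp
  next
    case (Suc k)
    show ?case
      by (rule derived_no_double_letter[OF n base' \<delta> U_ne[OF Suc] der[of k, folded U_def]])
  qed
  note U_ne = U_ne[OF W_ne]
  have fin: "finite (range (W k))" for k
    using Wrange[of k] by (intro finite_subset[of "range (W k)" "{1..n}"]) auto
  have rangeU: "range (U k) = label_perm n R (d k) ` range (W k)" for k
    by (auto simp: U_def image_iff)
  have cardU: "card (range (U k)) = card (range (W k))" for k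
    unfolding rangeU using Wrange[of k]
    by (intro card_image inj_on_subset[OF label_perm_inj_on[OF n R d[of k]]]) auto
  have der': "range (W (Suc k)) = U k ` sandwiched (U k)" for k
    using der[of k] unfolding derived_sequence_def U_def[symmetric] by (metis image_comp)
  then have sub: "range (W (Suc k)) \<subseteq> range (U k)" for k by auto
  have finU: "finite (range (U k))" for k unfolding rangeU using fin by simp
  have "card (range (W (Suc k))) \<le> card (range (W k))" for k
    using card_mono[OF finU sub] cardU by metis
  then obtain K where K: "\<And>k. k \<ge> K \<Longrightarrow> card (range (W k)) = card (range (W K))"
    using eventually_constant_card[of "\<lambda>k. card (range (W k))"] by metis
  have stable: "range (W (Suc k)) = range (U k)" if "k \<ge> K" for k
    using card_subset_eq[OF finU sub] cardU[of k] K[of k] K[of "Suc k"] that by simp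
  have all: "range (U k) \<subseteq> U k ` sandwiched (U k)" if "k \<ge> K" for k
    using stable[OF that] der'[of k] by simp
  have Urange: "range (U k) \<subseteq> {1..n}" for k using codesD(1)[OF \<delta>] by auto
  have imV: "0 \<le> Im (V k)" for k using ap[of k] by (simp add: aperiodic_coding_def)
  have next_d: "d (Suc k) = i" if "i < 2 * n" "base_cone n (sector_isometry n i (farey_matrix n (u k)))" for k i
    using base_sector_unique[OF n imV d base] that unfolding u_def V[symmetric] by metis
  have next_U: "range (U (Suc k)) = label_perm n R (d (Suc k)) ` range (U k)" if "k \<ge> K" for k
    using rangeU[of "Suc k"] stable[OF that] by simp
  have next_u: "u (Suc k) = sector_isometry n (d (Suc k)) (farey_matrix n (u k))" for k
    by (simp add: u_def V)
  obtain a b where gap: "central_gap n a b (range (U K))" and ab: "a + b = n + 1 \<or> a + b = n + 2"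
    using central_gap_exists[OF n base' \<delta> U_ne] by metis
  define \<beta> where "\<beta> = pi / (2 * real n)"
  note \<beta> = half_angle_bounds[OF n, folded \<beta>_def]
  have Y: "0 < Im (u k)" and XY: "0 < Re (u k) - cot \<beta> * Im (u k)" for k
    using base'[of k] by (auto simp: base_cone_def \<beta>_def)
  from ab show False
  proof
    assume s: "a + b = n + 1"
    define D where "D = 2 * sin \<beta> * cos \<beta> * (Re (u K) - cot \<beta> * Im (u K))"
    have ind: "central_gap n a b (range (U (K + m))) \<and> Re (u (K + m)) - cot \<beta> * Im (u (K + m)) = Re (u K) - cot \<beta> * Im (u K)
        \<and> Im (u (K + m)) = Im (u K) - real m * D" for m
    proof (induction m)
      case 0
      then show ?case using gap by simp
    next
      case (Suc m)
      have d1: "d (Suc (K + m)) = 1"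
        using next_d[of 1] central_gap_next_sector(1)[OF n base' \<delta> U_ne all _ s, of "K + m"] Suc n by simp
      have u1: "u (Suc (K + m)) = sector_isometry n 1 (farey_matrix n (u (K + m)))"
        using next_u[of "K + m"] d1 by simp
      have g1: "central_gap n a b (range (U (Suc (K + m))))"
        unfolding next_U[OF le_add1] d1 using central_gap_perm_1[OF n R Urange _ s] Suc by blast
      have E: "Re (u (K + m)) - cot \<beta> * Im (u (K + m)) = Re (u K) - cot \<beta> * Im (u K)"
        and I: "Im (u (K + m)) = Im (u K) - real m * D" using Suc by blast+
      note step = sector_isometry_1_farey[OF n, of "u (K + m)", folded \<beta>_def u1, unfolded E]
      have "Im (u (Suc (K + m))) = Im (u K) - real (Suc m) * D"
        using step(1) I by (simp add: D_def[symmetric] distrib_right)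
      then show ?case using g1 step(2) by simp
    qed
    have "0 < D" using \<beta> XY[of K] by (simp add: D_def)
    then obtain m where "Im (u K) < real m * D" using reals_Archimedean3 by blast
    then show False using ind[of m] Y[of "K + m"] by (simp add: D_def)
  next
    assume s: "a + b = n + 2"
    define D where "D = 2 * cot \<beta> * Im (u K)"
    have ind: "central_gap n a b (range (U (K + m))) \<and> Im (u (K + m)) = Im (u K)
        \<and> Re (u (K + m)) = Re (u K) - real m * D" for m
    proof (induction m)
      case 0
      then show ?case using gap by simp
    next
      case (Suc m)
      have d1: "d (Suc (K + m)) = 2 * n - 1"
        using next_d[of "2 * n - 1"] central_gap_next_sector(2)[OF n base' \<delta> U_ne all _ s, of "K + m"] Suc n by simp
      have u1: "u (Suc (K + m)) = sector_isometry n (2 * n - 1) (farey_matrix n (u (K + m)))"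
        using next_u[of "K + m"] d1 by simp
      have g1: "central_gap n a b (range (U (Suc (K + m))))"
        unfolding next_U[OF le_add1] d1 using central_gap_perm_last[OF n R Urange _ s] Suc by blast
      have I: "Im (u (K + m)) = Im (u K)" and X: "Re (u (K + m)) = Re (u K) - real m * D"
        using Suc by blast+
      note step = sector_isometry_last_farey[OF n, of "u (K + m)", folded \<beta>_def u1, unfolded I]
      have "Re (u (Suc (K + m))) = Re (u K) - real (Suc m) * D"
        using step(2) X by (simp add: D_def[symmetric] distrib_right)
      then show ?case using g1 step(1) by simp
    qed
    have "0 < D" using \<beta> Y[of K] by (simp add: D_def)
    then obtain m where m: "Re (u K) < real m * D" using reals_Archimedean3 by blast
    have "0 \<le> cot \<beta> * Im (u (K + m))" using \<beta> Y[of "K + m"] by simp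
    then show False using m ind[of m] XY[of "K + m"] by (simp add: D_def)
  qed
qed

section \<open>From trajectories to codings\<close>

text \<open>
  The cosines of the odd multiples of half the central angle are, up to the factor \<open>R\<close>, the components
  of the vertices along an outer normal. The greatest value is attained at the two end points of the
  side only.
\<close>

lemma cos_odd_multiple_le:
  assumes n: "n \<ge> 3"
  defines "b \<equiv> pi / (2 * real n)"
  shows "cos ((2 * of_int m + 1) * b) \<le> cos b"
    and "cos ((2 * of_int m + 1) * b) = cos b \<Longrightarrow> m mod (2 * int n) = 0 \<or> m mod (2 * int n) = 2 * int n - 1"
proof -
  note b = half_angle_bounds[OF n, folded b_def]
  have nb: "2 * real n * b = pi" using n by (simp add: b_def)
  define r where "r = m mod (2 * int n)"
  define q where "q = m div (2 * int n)"
  have r: "0 \<le> r" "r < 2 * int n" using n by (simp_all add: r_def)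
  have m: "of_int m = of_int q * (2 * real n) + (of_int r :: real)"
  proof -
    have "m = q * (2 * int n) + r" by (simp only: q_def r_def div_mult_mod_eq)
    then have "(of_int m :: real) = of_int (q * (2 * int n) + r)" by simp
    then show ?thesis by simp
  qed
  have arg: "(2 * of_int m + 1) * b = (2 * of_int r + 1) * b + 2 * pi * of_int q"
    unfolding m nb[symmetric] by (simp add: algebra_simps)
  have eq: "cos ((2 * of_int m + 1) * b) = cos ((2 * of_int r + 1) * b)"
    unfolding arg cos_add[of _ "2 * pi * of_int q"] by (simp only: cos_int_2pin sin_int_2pin mult_1_right mult_zero_right diff_zero)
  have diff: "cos b - cos ((2 * of_int r + 1) * b) = 2 * sin ((of_int r + 1) * b) * sin (of_int r * b)"
  proof -
    have "(b + (2 * of_int r + 1) * b) / 2 = (of_int r + 1) * b"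
      "((2 * of_int r + 1) * b - b) / 2 = of_int r * b" by (simp_all add: field_simps)
    then show ?thesis unfolding cos_diff_cos by simp
  qed
  have le: "of_int r * b \<le> pi - b" "(of_int r + 1) * b \<le> pi"
  proof -
    have "of_int r \<le> 2 * real n - 1" using r by linarith
    then have "of_int r * b \<le> (2 * real n - 1) * b" using b by (intro mult_right_mono) auto
    also have "\<dots> = pi - b" using nb by (simp add: algebra_simps)
    finally show "of_int r * b \<le> pi - b" .
    then show "(of_int r + 1) * b \<le> pi" by (simp add: algebra_simps)
  qed
  have "0 \<le> sin ((of_int r + 1) * b)" "0 \<le> sin (of_int r * b)"
    using r b le by (auto intro!: sin_ge_zero)
  then have "0 \<le> 2 * sin ((of_int r + 1) * b) * sin (of_int r * b)" by simp
  then show "cos ((2 * of_int m + 1) * b) \<le> cos b" using diff eq by linarith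
  assume "cos ((2 * of_int m + 1) * b) = cos b"
  then have zero: "sin ((of_int r + 1) * b) = 0 \<or> sin (of_int r * b) = 0" using diff eq by simp
  show "m mod (2 * int n) = 0 \<or> m mod (2 * int n) = 2 * int n - 1"
  proof (rule ccontr)
    assume "\<not> ?thesis"
    then have r': "0 < r" "r + 1 < 2 * int n" using r by (auto simp: r_def[symmetric])
    have "(of_int r + 1) * b < (2 * real n) * b" using r' b by (intro mult_strict_right_mono) linarith+
    then have "0 < sin ((of_int r + 1) * b)" using r b nb by (intro sin_gt_zero) auto
    moreover have "0 < sin (of_int r * b)" using r' b le by (intro sin_gt_zero) auto
    ultimately show False using zero by simp
  qed
qed

text \<open>
  The component of \<open>z\<close> along the outer normal of side \<open>j\<close>.
\<close>

definition height :: "nat \<Rightarrow> nat \<Rightarrow> complex \<Rightarrow> real" where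
  "height n j z = Re (z * cis (real j * pi / real n - pi / 2))"

lemma height_add: "height n j (x + y) = height n j x + height n j y"
  by (simp add: height_def algebra_simps)

lemma height_scaleR: "height n j (c *\<^sub>R x) = c * height n j x"
  by (simp add: height_def algebra_simps)

lemma height_vertex:
  assumes "n \<ge> 3"
  shows "height n j (vertex n R i) = R * cos ((2 * of_int (int j - int i) + 1) * (pi / (2 * real n)))"
proof -
  have "pi / 2 + pi / (2 * real n) - real i * pi / real n + (real j * pi / real n - pi / 2)
      = (2 * of_int (int j - int i) + 1) * (pi / (2 * real n))"
    using assms by (simp add: field_simps)
  then have "vertex n R i * cis (real j * pi / real n - pi / 2)
      = of_real R * cis ((2 * of_int (int j - int i) + 1) * (pi / (2 * real n)))"
    unfolding vertex_def mult.assoc cis_mult by (simp only:)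
  then show ?thesis unfolding height_def by simp
qed

lemma height_vertex_le:
  assumes n: "n \<ge> 3" and R: "R > 0"
  shows "height n j (vertex n R i) \<le> R * cos (pi / (2 * real n))"
  unfolding height_vertex[OF n] by (rule mult_left_mono[OF cos_odd_multiple_le(1)[OF n] less_imp_le[OF R]])

lemma height_ngon_le:
  assumes n: "n \<ge> 3" and R: "R > 0" and z: "z \<in> ngon n R"
  shows "height n j z \<le> R * cos (pi / (2 * real n))"
proof -
  define H where "H = {z. height n j z \<le> R * cos (pi / (2 * real n))}"
  have "convex H"
    unfolding convex_def H_def
  proof safe
    fix x y u v assume xy: "height n j x \<le> R * cos (pi / (2 * real n))" "height n j y \<le> R * cos (pi / (2 * real n))"
      and uv: "(0::real) \<le> u" "0 \<le> v" "u + v = 1"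
    have "u * height n j x + v * height n j y \<le> u * (R * cos (pi / (2 * real n))) + v * (R * cos (pi / (2 * real n)))"
      using xy uv by (intro add_mono mult_left_mono) auto
    also have "\<dots> = (u + v) * (R * cos (pi / (2 * real n)))" by (rule distrib_right[symmetric])
    finally show "height n j (u *\<^sub>R x + v *\<^sub>R y) \<le> R * cos (pi / (2 * real n))"
      using uv by (simp add: height_add height_scaleR)
  qed
  moreover have "vertex n R ` {..<2 * n} \<subseteq> H"
    unfolding H_def using height_vertex_le[OF n R] by auto
  ultimately have "ngon n R \<subseteq> H" unfolding ngon_def by (rule hull_minimal[rotated])
  then show ?thesis using z by (auto simp: H_def)
qed

lemma height_interior_less:
  assumes n: "n \<ge> 3" and R: "R > 0" and z: "z \<in> interior (ngon n R)"
  shows "height n j z < R * cos (pi / (2 * real n))"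
proof -
  obtain e where e: "0 < e" "ball z e \<subseteq> ngon n R" using z by (auto simp: mem_interior)
  define d where "d = (e / 2) *\<^sub>R cis (pi / 2 - real j * pi / real n)"
  have "z + d \<in> ball z e" using e(1) by (simp add: d_def dist_norm norm_mult)
  then have "height n j (z + d) \<le> R * cos (pi / (2 * real n))"
    using e(2) height_ngon_le[OF n R] by auto
  moreover have "height n j d = e / 2"
    unfolding d_def height_scaleR by (simp add: height_def cis_mult)
  ultimately show ?thesis using e(1) by (simp add: height_add)
qed

lemma height_side:
  assumes n: "n \<ge> 3" and z: "z \<in> side n R j"
  shows "height n j z = R * cos (pi / (2 * real n))"
proof -
  obtain u where u: "z = (1 - u) *\<^sub>R vertex n R j + u *\<^sub>R vertex n R (Suc j)"
    using z unfolding side_def by (auto simp: in_segment)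
  have "height n j (vertex n R j) = R * cos (pi / (2 * real n))"
    using height_vertex[OF n, of j R j] by simp
  moreover have "height n j (vertex n R (Suc j)) = R * cos (pi / (2 * real n))"
    using height_vertex[OF n, of j R "Suc j"] cos_minus[of "pi / (2 * real n)"] by simp
  ultimately show ?thesis unfolding u height_add height_scaleR by (simp add: algebra_simps)
qed

text \<open>
  A point in the relative interior of a side is a proper convex combination of its end points. If it is
  at maximal height over another side, so are both end points, which therefore span that side too.
\<close>

lemma side_label_of_open_side:
  assumes n: "n \<ge> 3" and R: "R > 0" and z: "z \<in> open_side n R i" "z \<in> side n R j"
  shows "side_label n j = side_label n i"
proof -
  define \<rho> where "\<rho> = R * cos (pi / (2 * real n))"
  obtain u where u: "0 < u" "u < 1" "z = (1 - u) *\<^sub>R vertex n R i + u *\<^sub>R vertex n R (Suc i)"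
    using z(1) unfolding open_side_def by (auto simp: in_segment)
  have le: "height n j (vertex n R k) \<le> \<rho>" for k
    using height_vertex_le[OF n R] unfolding \<rho>_def .
  have sum: "(1 - u) * height n j (vertex n R i) + u * height n j (vertex n R (Suc i)) = \<rho>"
    using height_side[OF n z(2)] unfolding u(3) height_add height_scaleR \<rho>_def .
  have "height n j (vertex n R i) = \<rho> \<and> height n j (vertex n R (Suc i)) = \<rho>"
  proof -
    have "(1 - u) * (\<rho> - height n j (vertex n R i)) + u * (\<rho> - height n j (vertex n R (Suc i))) = 0"
      using sum by (simp add: algebra_simps)
    moreover have "0 \<le> (1 - u) * (\<rho> - height n j (vertex n R i))" "0 \<le> u * (\<rho> - height n j (vertex n R (Suc i)))"
      using le u by (auto intro!: mult_nonneg_nonneg)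
    ultimately have "(1 - u) * (\<rho> - height n j (vertex n R i)) = 0" "u * (\<rho> - height n j (vertex n R (Suc i))) = 0"
      by linarith+
    then show ?thesis using u by simp
  qed
  then have "(int j - int i) mod (2 * int n) = 0 \<or> (int j - int i) mod (2 * int n) = 2 * int n - 1"
    "(int j - int (Suc i)) mod (2 * int n) = 0 \<or> (int j - int (Suc i)) mod (2 * int n) = 2 * int n - 1"
    using height_vertex[OF n, of j R i] height_vertex[OF n, of j R "Suc i"] R
      cos_odd_multiple_le(2)[OF n, of "int j - int i"] cos_odd_multiple_le(2)[OF n, of "int j - int (Suc i)"]
    unfolding \<rho>_def by auto
  moreover have "(int j - int (Suc i)) mod (2 * int n) = 2 * int n - 2" if "(int j - int i) mod (2 * int n) = 2 * int n - 1"
  proof -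
    have "(int j - int (Suc i)) mod (2 * int n) = ((int j - int i) mod (2 * int n) - 1) mod (2 * int n)"
      by (simp only: mod_diff_left_eq of_nat_Suc diff_diff_eq add.commute)
    also have "\<dots> = (2 * int n - 2) mod (2 * int n)"
      unfolding that by (simp only: diff_diff_eq one_add_one)
    also have "\<dots> = 2 * int n - 2" using n by (intro mod_pos_pos_trivial) auto
    finally show ?thesis .
  qed
  ultimately have "(int j - int i) mod (2 * int n) = 0" using n by auto
  then have "2 * int n dvd int j - int i" by (rule mod_eq_0_iff_dvd[THEN iffD1])
  then have "int n dvd int j - int i" by (rule dvd_mult_right)
  then have "int j mod int n = int i mod int n" by (simp add: mod_eq_dvd_iff)
  then show ?thesis unfolding side_label_def by (metis of_nat_eq_iff zmod_int)
qed

lemma vertex_opposite: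
  assumes "n > 0"
  shows "vertex n R (j + n) = - vertex n R j"
proof -
  have eq: "pi / 2 + pi / (2 * real n) - real j * pi / real n
      = (pi / 2 + pi / (2 * real n) - real (j + n) * pi / real n) + pi"
    using assms by (simp add: field_simps)
  have neg: "cis (x + pi) = - cis x" for x by (simp flip: cis_mult)
  show ?thesis unfolding vertex_def eq neg by (simp only: mult_minus_right minus_minus)
qed

text \<open>
  Seen along the direction \<open>\<phi>\<close>, half of side \<open>j\<close> has the length on the right.
\<close>

lemma exit_offset:
  assumes n: "n \<ge> 3" and R: "R > 0" and q: "q \<in> open_side n R j" and s: "0 < sin (real j * pi / real n + \<phi>)"
  shows "\<bar>Im ((q - side_translation n R j / 2) * cis (- \<phi>))\<bar>
    < R * sin (pi / (2 * real n)) * sin (real j * pi / real n + \<phi>)"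
proof -
  define a where "a = pi / 2 - real j * pi / real n"
  define b where "b = pi / (2 * real n)"
  note b = half_angle_bounds[OF n, folded b_def]
  obtain u where u: "0 < u" "u < 1" "q = (1 - u) *\<^sub>R vertex n R j + u *\<^sub>R vertex n R (Suc j)"
    using q unfolding open_side_def by (auto simp: in_segment)
  have "pi / 2 + pi / (2 * real n) - real (Suc j) * pi / real n = a - b"
    using n by (simp add: a_def b_def field_simps)
  moreover have "pi / 2 + pi / (2 * real n) - real j * pi / real n = a + b" by (simp add: a_def b_def)
  ultimately have v: "vertex n R j = of_real R * cis (a + b)" "vertex n R (Suc j) = of_real R * cis (a - b)"
    unfolding vertex_def by (simp_all only:)
  have "q - side_translation n R j / 2 = of_real (1 / 2 - u) * (vertex n R j - vertex n R (Suc j))"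
    unfolding u(3) side_translation_def by (simp add: scaleR_conv_of_real algebra_simps add_divide_distrib)
  also have "\<dots> = of_real ((1 / 2 - u) * R) * (cis (a + b) - cis (a - b))"
    unfolding v by (simp add: algebra_simps)
  finally have eq: "q - side_translation n R j / 2 = of_real ((1 / 2 - u) * R) * (cis (a + b) - cis (a - b))" .
  have rot: "cis (a + b) * cis (- \<phi>) = cis (a - \<phi> + b)" "cis (a - b) * cis (- \<phi>) = cis (a - \<phi> - b)"
    unfolding cis_mult by (simp_all add: algebra_simps)
  have "(q - side_translation n R j / 2) * cis (- \<phi>)
      = of_real ((1 / 2 - u) * R) * (cis (a - \<phi> + b) - cis (a - \<phi> - b))"
    unfolding eq by (simp only: mult.assoc left_diff_distrib rot)
  then have "Im ((q - side_translation n R j / 2) * cis (- \<phi>))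
      = (1 / 2 - u) * R * (sin (a - \<phi> + b) - sin (a - \<phi> - b))" by simp
  also have "sin (a - \<phi> + b) - sin (a - \<phi> - b) = 2 * cos (a - \<phi>) * sin b"
    unfolding sin_add[of "a - \<phi>" b] sin_diff[of "a - \<phi>" b] by simp
  also have "cos (a - \<phi>) = sin (real j * pi / real n + \<phi>)"
    by (simp add: a_def sin_cos_eq algebra_simps)
  finally have eq: "Im ((q - side_translation n R j / 2) * cis (- \<phi>))
      = (1 - 2 * u) * (R * sin b * sin (real j * pi / real n + \<phi>))" by (simp add: algebra_simps)
  have pos: "0 < R * sin b * sin (real j * pi / real n + \<phi>)" using R b s by simp
  have "\<bar>1 - 2 * u\<bar> < 1" using u by auto
  from mult_strict_right_mono[OF this pos] show ?thesis
    unfolding eq abs_mult[of "1 - 2 * u"] abs_of_pos[OF pos] by (simp add: b_def)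
qed

text \<open>
  The trajectory meets the exit side from below its supporting line, which fixes the sign of the normal
  component of the direction. The re-entry point is the exit point minus twice the midpoint of the
  exit side; it lies in the relative interior of the opposite side, so its label is that of
  the exit side.
\<close>

theorem trajectory_codes:
  assumes n: "n \<ge> 3" and R: "R > 0" and traj: "linear_trajectory n R \<phi> p t" and cut: "cutting_sequence n R p t w"
  shows "\<exists>\<delta>. codes n (cis \<phi>) w \<delta>"
proof -
  have n0: "n > 0" using n by simp
  define b where "b = pi / (2 * real n)"
  note b = half_angle_bounds[OF n, folded b_def]
  \<comment> \<open>the apothem\<close>
  define \<rho> where "\<rho> = R * cos b"
  have \<rho>: "0 < \<rho>" using R b by (simp add: \<rho>_def)
  have mono: "strict_mono t" using traj unfolding linear_trajectory_def by blast
  obtain c where c: "0 < c" and flow: "\<And>k s. t k < s \<and> s < t (k + 1) \<Longrightarrow>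
        p s = p (t k) + of_real (c * (s - t k)) * cis \<phi> \<and> p s \<in> interior (ngon n R)"
    and hit: "\<And>k. \<exists>j<2 * n. \<exists>q\<in>open_side n R j.
        q = p (t k) + of_real (c * (t (k + 1) - t k)) * cis \<phi> \<and> p (t (k + 1)) = q - side_translation n R j"
    using traj unfolding linear_trajectory_def by blast
  have "\<forall>k. \<exists>j q. q \<in> open_side n R j \<and>
        q = p (t k) + of_real (c * (t (k + 1) - t k)) * cis \<phi> \<and> p (t (k + 1)) = q - side_translation n R j"
    using hit by blast
  from choice[OF this] obtain J where "\<forall>k. \<exists>q. q \<in> open_side n R (J k) \<and>
        q = p (t k) + of_real (c * (t (k + 1) - t k)) * cis \<phi> \<and> p (t (k + 1)) = q - side_translation n R (J k)" ..
  from choice[OF this] obtain q where Jq: "\<And>k. q k \<in> open_side n R (J k)"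
    "\<And>k. q k = p (t k) + of_real (c * (t (k + 1) - t k)) * cis \<phi>"
    "\<And>k. p (t (k + 1)) = q k - side_translation n R (J k)" by blast
  define \<psi> where "\<psi> k = real (J k) * pi / real n + \<phi>" for k
  have exit: "0 < sin (\<psi> k)" for k
  proof -
    \<comment> \<open>any time before the exit would do\<close>
    define s where "s = (t k + t (k + 1)) / 2"
    have s: "t k < s" "s < t (k + 1)" using mono by (auto simp: s_def strict_mono_def field_simps)
    have "q k \<in> side n R (J k)" using Jq(1)[of k] unfolding open_side_def side_def by (simp add: open_segment_def)
    then have hq: "height n (J k) (q k) = \<rho>" using height_side[OF n] by (simp add: \<rho>_def b_def)
    have hp: "height n (J k) (p s) < \<rho>"
      unfolding \<rho>_def b_def using s by (intro height_interior_less[OF n R] conjunct2[OF flow]) simp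
    have "p s = p (t k) + of_real (c * (s - t k)) * cis \<phi>" using flow[of k s] s by blast
    then have "q k = p s + (c * (t (k + 1) - s)) *\<^sub>R cis \<phi>"
      unfolding Jq(2) by (simp add: scaleR_conv_of_real algebra_simps)
    then have "height n (J k) (q k) = height n (J k) (p s) + c * (t (k + 1) - s) * height n (J k) (cis \<phi>)"
      by (simp add: height_add height_scaleR)
    then have "0 < c * (t (k + 1) - s) * height n (J k) (cis \<phi>)" using hq hp by simp
    moreover have "0 < c * (t (k + 1) - s)" using c s by simp
    ultimately have "0 < height n (J k) (cis \<phi>)" by (simp only: zero_less_mult_pos)
    also have "height n (J k) (cis \<phi>) = cos (\<phi> + (real (J k) * pi / real n - pi / 2))"
      unfolding height_def cis_mult cis.sel ..
    also have "\<phi> + (real (J k) * pi / real n - pi / 2) = - (pi / 2 - \<psi> k)" by (simp add: \<psi>_def)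
    also have "cos \<dots> = sin (\<psi> k)" unfolding cos_minus by (simp add: cos_diff)
    finally show ?thesis .
  qed
  have label: "w (k + 1) = side_label n (J k)" for k
  proof -
    obtain j where j: "p (t (k + 1)) \<in> side n R j" "w (k + 1) = side_label n j"
      using cut unfolding cutting_sequence_def by blast
    obtain u where u: "vertex n R (J k) \<noteq> vertex n R (Suc (J k))" "0 < u" "u < 1"
      "q k = (1 - u) *\<^sub>R vertex n R (J k) + u *\<^sub>R vertex n R (Suc (J k))"
      using Jq(1)[of k] unfolding open_side_def by (auto simp: in_segment)
    have v: "vertex n R (J k + n) = - vertex n R (J k)" "vertex n R (Suc (J k + n)) = - vertex n R (Suc (J k))"
      using vertex_opposite[OF n0, of R "J k"] vertex_opposite[OF n0, of R "Suc (J k)"] by simp_all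
    have "p (t (k + 1)) = (1 - (1 - u)) *\<^sub>R vertex n R (J k + n) + (1 - u) *\<^sub>R vertex n R (Suc (J k + n))"
      unfolding Jq(3) u(4) side_translation_def v by (simp add: algebra_simps)
    then have "p (t (k + 1)) \<in> open_side n R (J k + n)"
      unfolding open_side_def in_segment v using u(1-3) by (intro conjI exI[of _ "1 - u"]) auto
    then have "side_label n j = side_label n (J k + n)" using side_label_of_open_side[OF n R _ j(1)] by blast
    then show ?thesis using j(2) by (simp add: side_label_def)
  qed
  define \<eta> where "\<eta> z = Im (z * cis (- \<phi>))" for z
  have \<eta>_diff: "\<eta> (x - y) = \<eta> x - \<eta> y" for x y by (simp add: \<eta>_def algebra_simps)
  have \<eta>_half: "\<eta> (x / 2) = \<eta> x / 2" for x by (simp add: \<eta>_def)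
  have \<eta>_T: "\<eta> (side_translation n R (J k)) = 2 * \<rho> * cos (\<psi> k)" for k
  proof -
    have "\<eta> (side_translation n R (J k)) = 2 * R * cos b * sin (pi / 2 - real (J k) * pi / real n + - \<phi>)"
      unfolding \<eta>_def side_translation_polar[OF n0] mult.assoc cis_mult b_def by simp
    also have "pi / 2 - real (J k) * pi / real n + - \<phi> = pi / 2 - \<psi> k" by (simp add: \<psi>_def)
    also have "sin \<dots> = cos (\<psi> k)" by (simp add: sin_diff)
    finally show ?thesis by (simp add: \<rho>_def)
  qed
  have \<eta>_q: "\<eta> (q (k + 1)) = \<eta> (q k) - 2 * \<rho> * cos (\<psi> k)" for k
  proof -
    have "of_real x * cis \<phi> * cis (- \<phi>) = of_real x" for x by (simp add: mult.assoc cis_mult)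
    then have "\<eta> (of_real x * cis \<phi>) = 0" for x unfolding \<eta>_def by (simp only: Im_complex_of_real)
    then have "\<eta> (q (k + 1)) = \<eta> (p (t (k + 1)))"
      unfolding Jq(2)[of "k + 1"] \<eta>_def by (simp only: distrib_right plus_complex.sel)
    then show ?thesis unfolding Jq(3) \<eta>_diff \<eta>_T .
  qed
  \<comment> \<open>the letter at time \<open>t k\<close> belongs to the exit in the preceding flight, hence the index \<open>k - 1\<close>\<close>
  define \<delta> where "\<delta> k = (\<eta> (q (k - 1)) - \<rho> * cos (\<psi> (k - 1))) / \<rho>" for k
  have e: "\<bar>Im (cis \<phi> * letter_dir n (w k))\<bar> = sin (\<psi> (k - 1))
      \<and> centre (cis \<phi> * letter_dir n (w k)) = cos (\<psi> (k - 1))" for k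
  proof -
    have "w k = side_label n (J (k - 1))" using label[of "k - 1"] by simp
    then have "cis \<phi> * letter_dir n (w k) = cis (\<psi> (k - 1)) \<or> cis \<phi> * letter_dir n (w k) = - cis (\<psi> (k - 1))"
      using letter_dir_side_label[OF n0, of "J (k - 1)"] by (auto simp: cis_mult \<psi>_def add.commute)
    moreover have "\<bar>Im (cis (\<psi> (k - 1)))\<bar> = sin (\<psi> (k - 1))" "centre (cis (\<psi> (k - 1))) = cos (\<psi> (k - 1))"
      using exit[of "k - 1"] by (simp_all add: centre_def)
    ultimately show ?thesis by (metis abs_minus_cancel centre_minus uminus_complex.sel(2))
  qed
  have "codes n (cis \<phi>) w \<delta>"
    unfolding codes_def
  proof (intro allI conjI)
    fix k
    have "w k = side_label n (J (k - 1))" using label[of "k - 1"] by simp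
    then show "w k \<in> {1..n}" using n0 by (simp add: side_label_def Suc_leI)
    have "\<bar>\<eta> (q (k - 1) - side_translation n R (J (k - 1)) / 2)\<bar> < R * sin b * sin (\<psi> (k - 1))"
      using exit_offset[OF n R Jq(1), of "k - 1" \<phi>] exit[of "k - 1"] unfolding \<eta>_def b_def \<psi>_def by blast
    moreover have "\<eta> (q (k - 1) - side_translation n R (J (k - 1)) / 2) = \<rho> * \<delta> k"
      unfolding \<eta>_diff \<eta>_half \<eta>_T \<delta>_def using \<rho> by simp
    moreover have "R * sin b * sin (\<psi> (k - 1)) = \<rho> * (tan b * sin (\<psi> (k - 1)))"
      using b by (simp add: \<rho>_def tan_def)
    ultimately have "\<rho> * \<bar>\<delta> k\<bar> < \<rho> * (tan b * sin (\<psi> (k - 1)))" using \<rho> by (simp add: abs_mult)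
    then have "\<bar>\<delta> k\<bar> < tan b * sin (\<psi> (k - 1))" using \<rho> by (simp only: mult_less_cancel_left_pos)
    then show "\<bar>\<delta> k\<bar> < tan (pi / (2 * real n)) * \<bar>Im (cis \<phi> * letter_dir n (w k))\<bar>"
      using e[of k] by (simp add: b_def)
    have prev: "\<eta> (q (k - 1)) = \<eta> (q k) + 2 * \<rho> * cos (\<psi> (k - 1))" using \<eta>_q[of "k - 1"] by simp
    have "\<delta> k - \<delta> (k + 1) = cos (\<psi> (k - 1)) + cos (\<psi> k)"
      using \<rho> by (simp add: \<delta>_def prev diff_divide_distrib add_divide_distrib)
    then show "\<delta> k - \<delta> (k + 1) = centre (cis \<phi> * letter_dir n (w k)) + centre (cis \<phi> * letter_dir n (w (k + 1)))"
      using e[of k] e[of "k + 1"] by simp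
  qed
  then show ?thesis by blast
qed

section \<open>Uniqueness of the direction with a given itinerary\<close>

text \<open>
  Adjacent sectors have isometries of opposite parity that send their common end point to the same
  end point of the base sector. Hence the Farey map is well defined on all of \<open>{0..pi}\<close>.
\<close>

lemma sector_isometry_closed_sector_agree:
  assumes n: "n \<ge> 3" and i: "\<theta> \<in> closed_sector n i" and j: "\<theta> \<in> closed_sector n j"
  shows "sector_isometry n i (cis \<theta>) = sector_isometry n j (cis \<theta>)"
proof -
  define b where "b = pi / (2 * real n)"
  have b: "0 < b" using half_angle_bounds[OF n] by (simp add: b_def)
  have iso: "sector_isometry n i (cis \<theta>) = cis (if even i then \<theta> - real i * b else (real i + 1) * b - \<theta>)" for i
    using sector_isometry_polar[of n i 1 \<theta>] by (simp add: b_def)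
  have less: "sector_isometry n i (cis \<theta>) = sector_isometry n j (cis \<theta>)"
    if "i < j" "\<theta> \<le> (real i + 1) * b" "real j * b \<le> \<theta>" for i j
  proof -
    have "real j * b \<le> (real i + 1) * b" using that by linarith
    then have "real j \<le> real i + 1" using b by (simp only: mult_le_cancel_right_pos)
    then have ji: "j = Suc i" using that(1) by linarith
    then have "\<theta> = (real i + 1) * b" using that by (simp add: algebra_simps)
    then show ?thesis unfolding iso by (simp add: ji algebra_simps)
  qed
  have "real i * b \<le> \<theta>" "\<theta> \<le> (real i + 1) * b" "real j * b \<le> \<theta>" "\<theta> \<le> (real j + 1) * b"
    using i j by (auto simp: closed_sector_def b_def)
  then show ?thesis using less[of i j] less[of j i] linorder_neqE_nat by metis
qed

lemma closed_sector_cone: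
  assumes n: "n \<ge> 3" and c: "0 < c" and \<theta>: "\<theta> \<in> closed_sector n i"
  defines "z \<equiv> sector_isometry n i (of_real c * cis \<theta>)"
  shows "0 \<le> Im z" and "cot (pi / (2 * real n)) * Im z \<le> Re z" and "0 < Im z \<or> 0 < Re z"
proof -
  define b where "b = pi / (2 * real n)"
  note b = half_angle_bounds[OF n, folded b_def]
  define \<psi> where "\<psi> = (if even i then \<theta> - real i * b else (real i + 1) * b - \<theta>)"
  have z: "z = of_real c * cis \<psi>" unfolding z_def sector_isometry_polar \<psi>_def b_def ..
  have "real i * b \<le> \<theta>" "\<theta> \<le> (real i + 1) * b" using \<theta> by (auto simp: closed_sector_def b_def)
  then have \<psi>: "0 \<le> \<psi>" "\<psi> \<le> b" by (auto simp: \<psi>_def algebra_simps)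
  have s: "0 \<le> sin \<psi>" "0 \<le> sin (b - \<psi>)" using \<psi> b by (auto intro!: sin_ge_zero)
  have co: "0 < cos \<psi>" using \<psi> b by (intro cos_gt_zero_pi) auto
  show "0 \<le> Im z" unfolding z using c s by simp
  show "0 < Im z \<or> 0 < Re z" unfolding z using c co by simp
  have "cot b * sin \<psi> \<le> cos \<psi>" using s(2) b by (simp add: sin_diff cot_def field_simps)
  then have "c * (cot b * sin \<psi>) \<le> c * cos \<psi>" using c by simp
  then show "cot (pi / (2 * real n)) * Im z \<le> Re z"
    unfolding z b_def[symmetric] by (simp add: mult.left_commute)
qed

lemma sector_isometry_scale: "sector_isometry n i (of_real c * z) = of_real c * sector_isometry n i z"
  by (simp add: sector_isometry_def mult.left_commute)

lemma farey_matrix_scale: "farey_matrix n (of_real c * z) = of_real c * farey_matrix n z"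
  by (simp add: farey_matrix_def complex_eq_iff algebra_simps)

lemma farey_map_direction:
  assumes n: "n \<ge> 3" and i: "i < 2 * n" and \<theta>: "\<theta> \<in> closed_sector n i" and c: "0 < c"
  shows "\<exists>c'>0. farey_matrix n (sector_isometry n i (of_real c * cis \<theta>)) = of_real c' * cis (farey_map n \<theta>)"
    and "0 < farey_map n \<theta> \<and> farey_map n \<theta> \<le> pi"
proof -
  define z where "z = sector_isometry n i (cis \<theta>)"
  define y where "y = farey_matrix n z"
  have zc: "0 \<le> Im z" "0 < Im z \<or> 0 < Re z"
    using closed_sector_cone[OF n zero_less_one \<theta>] by (simp_all add: z_def)
  have y: "Im y = Im z" "Im z = 0 \<longrightarrow> Re y < 0"
    using zc by (auto simp: y_def farey_matrix_def)
  then have y0: "y \<noteq> 0" using zc by (metis complex.sel less_irrefl zero_complex.sel)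
  define \<phi> where "\<phi> = Arg y"
  define r where "r = cmod y"
  have eq: "y = of_real r * cis \<phi>" and pos: "0 < r"
    using y0 by (simp_all add: r_def \<phi>_def cis_Arg sgn_eq)
  have "\<phi> \<noteq> 0" using y zc by (auto simp: \<phi>_def Arg_eq_0 complex_is_Real_iff)
  moreover have "0 \<le> \<phi>" using y(1) zc by (simp add: \<phi>_def Arg_less_0)
  ultimately have \<phi>: "0 < \<phi>" "\<phi> \<le> pi" using Arg_le_pi by (auto simp: \<phi>_def)
  have F: "farey_map n \<theta> = \<phi>"
    unfolding farey_map_def
  proof (rule the_equality)
    have "\<exists>c::real. c \<noteq> 0 \<and> farey_matrix n (sector_isometry n j (cis \<theta>)) = of_real c * cis \<phi>"
      if "\<theta> \<in> closed_sector n j" for j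
      using eq pos unfolding sector_isometry_closed_sector_agree[OF n that \<theta>] z_def[symmetric] y_def[symmetric]
      by (intro exI[of _ "r"]) simp
    then show "0 < \<phi> \<and> \<phi> \<le> pi \<and> (\<forall>j<2 * n. \<theta> \<in> closed_sector n j \<longrightarrow>
        (\<exists>c::real. c \<noteq> 0 \<and> farey_matrix n (sector_isometry n j (cis \<theta>)) = of_real c * cis \<phi>))"
      using \<phi> by blast
  next
    fix \<phi>' assume \<phi>': "0 < \<phi>' \<and> \<phi>' \<le> pi \<and> (\<forall>j<2 * n. \<theta> \<in> closed_sector n j \<longrightarrow>
        (\<exists>c::real. c \<noteq> 0 \<and> farey_matrix n (sector_isometry n j (cis \<theta>)) = of_real c * cis \<phi>'))"
    then obtain c' :: real where "y = of_real c' * cis \<phi>'"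
      using i \<theta> unfolding y_def z_def by blast
    then have "of_real r * cis \<phi> * cis (- \<phi>') = of_real c' * cis \<phi>' * cis (- \<phi>')" using eq by (simp only:)
    then have "of_real r * cis (\<phi> - \<phi>') = of_real c'" by (simp add: mult.assoc cis_mult)
    then have "Im (of_real r * cis (\<phi> - \<phi>')) = Im (of_real c')" by (simp only:)
    then have "sin (\<phi> - \<phi>') = 0" using pos by simp
    moreover have "- pi < \<phi> - \<phi>'" "\<phi> - \<phi>' < pi" using \<phi> \<phi>' by linarith+
    ultimately have "\<phi> - \<phi>' = 0" using sin_eq_0_pi by blast
    then show "\<phi>' = \<phi>" by simp
  qed
  show "0 < farey_map n \<theta> \<and> farey_map n \<theta> \<le> pi" using \<phi> F by simp
  have "farey_matrix n (sector_isometry n i (of_real c * cis \<theta>)) = of_real (c * r) * cis (farey_map n \<theta>)"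
    unfolding sector_isometry_scale farey_matrix_scale F z_def[symmetric] y_def[symmetric]
    by (subst eq) (simp add: mult.assoc)
  then show "\<exists>c'>0. farey_matrix n (sector_isometry n i (of_real c * cis \<theta>)) = of_real c' * cis (farey_map n \<theta>)"
    using c pos by (intro exI[of _ "c * r"]) simp
qed

text \<open>
  The signed area of the parallelogram spanned by two vectors.
\<close>

definition cross :: "complex \<Rightarrow> complex \<Rightarrow> real" where
  "cross x y = Re x * Im y - Im x * Re y"

lemma sector_isometry_inner: "sector_isometry n i x \<bullet> sector_isometry n i y = x \<bullet> y"
proof -
  have 1: "(cis a * x) \<bullet> (cis a * y) = x \<bullet> y" for a x y
  proof -
    have "(cis a * x) \<bullet> (cis a * y) = ((cos a)\<^sup>2 + (sin a)\<^sup>2) * (x \<bullet> y)"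
      by (simp add: inner_complex_def power2_eq_square algebra_simps del: sin_cos_squared_add3)
    then show ?thesis by simp
  qed
  have 2: "cnj x \<bullet> cnj y = x \<bullet> y" by (simp add: inner_complex_def)
  show ?thesis by (simp add: sector_isometry_def 1 2)
qed

lemma sector_isometry_cross: "\<bar>cross (sector_isometry n i x) (sector_isometry n i y)\<bar> = \<bar>cross x y\<bar>"
proof -
  have 1: "cross (cis a * x) (cis a * y) = cross x y" for a x y
  proof -
    have "cross (cis a * x) (cis a * y) = ((cos a)\<^sup>2 + (sin a)\<^sup>2) * cross x y"
      by (simp add: cross_def power2_eq_square algebra_simps del: sin_cos_squared_add3)
    then show ?thesis by simp
  qed
  have 2: "cross (cnj x) (cnj y) = - cross x y" by (simp add: cross_def)
  show ?thesis by (simp add: sector_isometry_def 1 2)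
qed

lemma farey_matrix_cross: "cross (farey_matrix n x) (farey_matrix n y) = - cross x y"
  by (simp add: cross_def farey_matrix_def algebra_simps)

text \<open>
  With \<open>x = y\<close> this says that the Farey matrix shortens the vectors in the interior of the base sector.
\<close>

lemma farey_matrix_inner:
  fixes x y :: complex and n :: nat
  defines "\<kappa> \<equiv> cot (pi / (2 * real n))"
  shows "farey_matrix n x \<bullet> farey_matrix n y
    = x \<bullet> y - 2 * \<kappa> * (Im x * (Re y - \<kappa> * Im y) + Im y * (Re x - \<kappa> * Im x))"
  unfolding \<kappa>_def by (simp add: inner_complex_def farey_matrix_def algebra_simps)

text \<open>
  Both terms subtracted in the formula for the inner product are nonnegative on the base sector, and
  their difference is the cross product.
\<close>

lemma farey_step_inner_decrease:
  assumes n: "n \<ge> 3"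
    and x: "0 \<le> Im x" "cot (pi / (2 * real n)) * Im x \<le> Re x"
    and y: "0 \<le> Im y" "cot (pi / (2 * real n)) * Im y \<le> Re y"
  shows "farey_matrix n x \<bullet> farey_matrix n y \<le> x \<bullet> y - 2 * cot (pi / (2 * real n)) * \<bar>cross x y\<bar>"
    and "0 \<le> x \<bullet> y"
proof -
  define \<kappa> where "\<kappa> = cot (pi / (2 * real n))"
  have \<kappa>: "0 < \<kappa>" using half_angle_bounds[OF n] by (simp add: \<kappa>_def)
  have p: "0 \<le> Im x * (Re y - \<kappa> * Im y)" "0 \<le> Im y * (Re x - \<kappa> * Im x)"
    using x y by (simp_all add: \<kappa>_def)
  have "cross x y = Im y * (Re x - \<kappa> * Im x) - Im x * (Re y - \<kappa> * Im y)"
    by (simp add: cross_def algebra_simps)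
  then have "\<bar>cross x y\<bar> \<le> Im x * (Re y - \<kappa> * Im y) + Im y * (Re x - \<kappa> * Im x)" using p by linarith
  then have "2 * \<kappa> * \<bar>cross x y\<bar> \<le> 2 * \<kappa> * (Im x * (Re y - \<kappa> * Im y) + Im y * (Re x - \<kappa> * Im x))"
    using \<kappa> by (intro mult_left_mono) auto
  then show "farey_matrix n x \<bullet> farey_matrix n y \<le> x \<bullet> y - 2 * cot (pi / (2 * real n)) * \<bar>cross x y\<bar>"
    unfolding farey_matrix_inner \<kappa>_def[symmetric] by linarith
  have "0 \<le> \<kappa> * Im x" "0 \<le> \<kappa> * Im y" using x y \<kappa> by simp_all
  then have "0 \<le> Re x" "0 \<le> Re y" using x y unfolding \<kappa>_def by linarith+
  then show "0 \<le> x \<bullet> y" using x y by (simp add: inner_complex_def)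
qed

text \<open>
  Two directions with the same itinerary are moved by the same sequence of linear maps. These preserve the
  absolute value of the cross product, whereas the inner product drops at every step by at
  least a fixed multiple of it. Since the inner product stays nonnegative, the cross product is zero.
\<close>

theorem itinerary_injective:
  assumes n: "n \<ge> 3" and \<theta>: "\<theta> \<in> {0..pi}" "\<theta>' \<in> {0..pi}"
    and s: "itinerary n \<theta> s" "itinerary n \<theta>' s"
  shows "\<theta> = \<theta>'"
proof -
  define g where "g k z = farey_matrix n (sector_isometry n (s k) z)" for k z
  define V where "V \<alpha> = rec_nat (cis \<alpha>) g" for \<alpha>
  have V: "V \<alpha> 0 = cis \<alpha>" "V \<alpha> (Suc k) = g k (V \<alpha> k)" for \<alpha> k by (simp_all add: V_def)
  have s2: "s k < 2 * n" for k using s(1) by (simp add: itinerary_def)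
  have closed: "(farey_map n ^^ k) \<alpha> \<in> closed_sector n (s k)" if "itinerary n \<alpha> s" for \<alpha> k
    using that sector_subset_closed_sector[of n "s k"] n unfolding itinerary_def by auto
  have dir: "\<exists>c>0. V \<alpha> k = of_real c * cis ((farey_map n ^^ k) \<alpha>)" if "itinerary n \<alpha> s" for \<alpha> k
  proof (induction k)
    case 0
    then show ?case using V(1) by (intro exI[of _ 1]) simp
  next
    case (Suc k)
    then obtain c where "0 < c" "V \<alpha> k = of_real c * cis ((farey_map n ^^ k) \<alpha>)" by blast
    then show ?case
      using farey_map_direction(1)[OF n s2 closed[OF that, of k], of c] unfolding V(2) g_def by simp
  qed
  define x where "x \<alpha> k = sector_isometry n (s k) (V \<alpha> k)" for \<alpha> k
  have cone: "0 \<le> Im (x \<alpha> k)" "cot (pi / (2 * real n)) * Im (x \<alpha> k) \<le> Re (x \<alpha> k)" if "itinerary n \<alpha> s" for \<alpha> k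
    using dir[OF that, of k] closed_sector_cone[OF n _ closed[OF that, of k]] unfolding x_def by auto
  define D where "D = 2 * cot (pi / (2 * real n)) * \<bar>cross (cis \<theta>) (cis \<theta>')\<bar>"
  have cross: "\<bar>cross (V \<theta> k) (V \<theta>' k)\<bar> = \<bar>cross (cis \<theta>) (cis \<theta>')\<bar>" for k
    by (induction k) (simp_all add: V g_def farey_matrix_cross sector_isometry_cross)
  have inner: "V \<theta> (Suc k) \<bullet> V \<theta>' (Suc k) \<le> V \<theta> k \<bullet> V \<theta>' k - D" "0 \<le> V \<theta> k \<bullet> V \<theta>' k" for k
    using farey_step_inner_decrease[OF n cone[OF s(1)] cone[OF s(2)], of k k]
    unfolding x_def V(2) g_def D_def by (simp_all add: sector_isometry_inner sector_isometry_cross cross)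
  have bound: "V \<theta> k \<bullet> V \<theta>' k \<le> cis \<theta> \<bullet> cis \<theta>' - real k * D" for k
  proof (induction k)
    case (Suc k)
    then show ?case using inner(1)[of k] by (simp add: algebra_simps)
  qed (simp add: V)
  have "D = 0"
  proof (rule ccontr)
    assume "D \<noteq> 0"
    moreover have "0 \<le> D" using half_angle_bounds[OF n] by (simp add: D_def)
    ultimately obtain k where "cis \<theta> \<bullet> cis \<theta>' < real k * D"
      using reals_Archimedean3[of D] by auto
    then show False using bound[of k] inner(2)[of k] by linarith
  qed
  then have "cross (cis \<theta>) (cis \<theta>') = 0" using half_angle_bounds[OF n] by (simp add: D_def)
  then have "sin (\<theta>' - \<theta>) = 0" by (simp add: cross_def sin_diff algebra_simps)
  moreover have "- pi < \<theta>' - \<theta>" "\<theta>' - \<theta> < pi"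
  proof -
    have "(real (s 0) + 1) * pi / (2 * real n) - real (s 0) * pi / (2 * real n) = pi / (2 * real n)"
      by (simp add: add_divide_distrib distrib_right)
    moreover have "pi / (2 * real n) < pi" using half_angle_bounds[OF n] by linarith
    moreover have "real (s 0) * pi / (2 * real n) \<le> \<theta>" "\<theta> \<le> (real (s 0) + 1) * pi / (2 * real n)"
      "real (s 0) * pi / (2 * real n) \<le> \<theta>'" "\<theta>' \<le> (real (s 0) + 1) * pi / (2 * real n)"
      using closed[OF s(1), of 0] closed[OF s(2), of 0] by (simp_all add: closed_sector_def)
    ultimately show "- pi < \<theta>' - \<theta>" "\<theta>' - \<theta> < pi" by linarith+
  qed
  ultimately have "\<theta>' - \<theta> = 0" using sin_eq_0_pi by blast
  then show ?thesis by simp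
qed

section \<open>Uniqueness of the diagram\<close>

text \<open>
  Counting labels from zero, the relabelling of diagram \<open>i\<close> is \<open>x \<mapsto> x + i div 2\<close> or
  \<open>x \<mapsto> - x - (i + 1) div 2\<close> modulo \<open>n\<close>. In either case the condition on sums of consecutive letters becomes the
  same condition with \<open>i\<close> added.
\<close>

lemma admissible_sum_residue:
  fixes R :: real
  assumes n: "n \<ge> 3" and R: "R > 0" and i: "i < 2 * n" and w: "\<And>k. w k \<in> {1..n}" and adm: "admissible n R i w"
  shows "(int (w k) + int (w (k + 1)) + int i) mod int n \<in> {1, 2}"
proof -
  define a where "a l = (if even i then int l - 1 + int i div 2 else - (int l - 1) - (int i + 1) div 2)" for l
  define s where "s = int (w k) + int (w (k + 1)) + int i"
  have a: "int (label_perm n R i (w j)) = a (w j) mod int n + 1" for j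
    using label_perm_residue[OF n R i w] unfolding a_def by (simp add: algebra_simps)
  have "label_perm n R i (w k) + label_perm n R i (w (k + 1)) \<in> {n + 1, n + 2}"
    using adm unfolding admissible_def admissible0_def by simp
  then have "int (label_perm n R i (w k)) + int (label_perm n R i (w (k + 1))) \<in> {int n + 1, int n + 2}"
    by auto
  then have "a (w k) mod int n + a (w (k + 1)) mod int n \<in> {int n - 1, int n}" unfolding a by auto
  then have "(a (w k) mod int n + a (w (k + 1)) mod int n) mod int n \<in> {(int n - 1) mod int n, 0}" by auto
  then have sum: "(a (w k) + a (w (k + 1))) mod int n \<in> {(- 1) mod int n, 0}"
    by (simp add: mod_add_eq)
  have two: "1 mod int n = 1" "2 mod int n = 2" using n by simp_all
  show ?thesis
  proof (cases "even i")
    case True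
    have "a (w k) + a (w (k + 1)) = s - 2" using True by (auto simp: a_def s_def)
    then have "(s - 2) mod int n = (1 - 2) mod int n \<or> (s - 2) mod int n = (2 - 2) mod int n" using sum by auto
    then have "s mod int n = 1 mod int n \<or> s mod int n = 2 mod int n" unfolding mod_eq_dvd_iff by simp
    then show ?thesis unfolding s_def[symmetric] two by auto
  next
    case False
    have "a (w k) + a (w (k + 1)) = 1 - s" using False by (auto simp: a_def s_def elim!: oddE)
    then have "(1 - s) mod int n = (1 - 2) mod int n \<or> (1 - s) mod int n = (1 - 1) mod int n" using sum by auto
    then have "2 mod int n = s mod int n \<or> 1 mod int n = s mod int n" unfolding mod_eq_dvd_iff by simp
    then show ?thesis unfolding s_def[symmetric] two by auto
  qed
qed

text \<open>
  The diagrams \<open>i\<close> and \<open>i + n\<close> allow the same sums modulo \<open>n\<close>; they differ in their loops. A doubled letter must be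
  sent to the middle letter \<open>n div 2 + 1\<close> by both relabellings, and these send no letter to the same
  middle place.
\<close>

lemma opposite_diagrams_exclude_double_letter:
  fixes R :: real
  assumes n: "n \<ge> 3" and R: "R > 0" and i: "i < n" and l: "l \<in> {1..n}"
    and adm: "2 * label_perm n R i l \<in> {n + 1, n + 2}" "2 * label_perm n R (i + n) l \<in> {n + 1, n + 2}"
  shows False
proof -
  define z where "z = int (label_perm n R i l) - 1"
  define z' where "z' = int (label_perm n R (i + n) l) - 1"
  have i2: "i < 2 * n" "i + n < 2 * n" using i by simp_all
  have z: "z = (if even i then int l - 1 + int i div 2 else - (int l - 1) - (int i + 1) div 2) mod int n"
    unfolding z_def by (rule label_perm_residue[OF n R i2(1) l])
  have z': "z' = (if even (i + n) then int l - 1 + int (i + n) div 2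
      else - (int l - 1) - (int (i + n) + 1) div 2) mod int n"
    unfolding z'_def by (rule label_perm_residue[OF n R i2(2) l])
  have bounds: "2 * z \<in> {int n - 1, int n}" "2 * z' \<in> {int n - 1, int n}"
    using adm unfolding z_def z'_def by auto
  have no: "\<not> int n dvd h" if "0 < h" "h < int n" for h using that zdvd_not_zless by blast
  show False
  proof (cases "even n")
    case True
    then obtain h where h: "n = 2 * h" by blast
    have zz: "z = int h" "z' = int h" using bounds h by auto
    have "int n dvd int h"
    proof (cases "even i")
      case True
      have "z' mod int n = (z + int h) mod int n"
        using True h unfolding z z' by (auto simp: mod_simps algebra_simps)
      then show ?thesis unfolding zz mod_eq_dvd_iff by simp
    next
      case False
      have "z' mod int n = (z - int h) mod int n"
        using False h unfolding z z' by (auto simp: mod_simps algebra_simps elim!: oddE)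
      then show ?thesis unfolding zz mod_eq_dvd_iff by simp
    qed
    then show False using no[of "int h"] h n by simp
  next
    case False
    then obtain h where h: "n = 2 * h + 1" by (elim oddE)
    have zz: "z = int h" "z' = int h" using bounds h by auto
    show False
    proof (cases "even i")
      case True
      then obtain g where g: "i = 2 * g" by blast
      have e: "(int (i + n) + 1) div 2 = int g + int h + 1" "int i div 2 = int g" using g h by simp_all
      have "(z + z') mod int n = ((int l - 1 + int g) + (- (int l - 1) - (int g + int h + 1))) mod int n"
        unfolding z z' e using True h by (simp only: mod_add_eq) simp
      also have "(int l - 1 + int g) + (- (int l - 1) - (int g + int h + 1)) = - int h - 1" by simp
      finally have "int n dvd (z + z') - (- int h - 1)" by (simp only: mod_eq_dvd_iff)
      then have "int n dvd int h + int n" unfolding zz h by (simp add: algebra_simps)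
      then have "int n dvd int h" by simp
      then show False using no[of "int h"] h n by simp
    next
      case False
      then obtain g where g: "i = 2 * g + 1" by (elim oddE)
      have e: "int (i + n) div 2 = int g + int h + 1" "(int i + 1) div 2 = int g + 1" using g h by simp_all
      have "(z + z') mod int n = ((- (int l - 1) - (int g + 1)) + (int l - 1 + (int g + int h + 1))) mod int n"
        unfolding z z' e using False h by (simp only: mod_add_eq) simp
      also have "(- (int l - 1) - (int g + 1)) + (int l - 1 + (int g + int h + 1)) = int h" by simp
      finally have "int n dvd (z + z') - int h" by (simp only: mod_eq_dvd_iff)
      then have "int n dvd int h" unfolding zz by simp
      then show False using no[of "int h"] h n by simp
    qed
  qed
qed

text \<open>
  Diagrams that are incongruent modulo \<open>n\<close> share at most one residue for the sum of consecutive letters, and a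
  word with constant sum modulo \<open>n\<close> has period two. Opposite diagrams are told apart by a doubled letter.
\<close>

theorem admissible_diagram_unique:
  fixes R :: real
  assumes n: "n \<ge> 3" and R: "R > 0" and w: "aperiodic_coding n v w"
    and i: "i < 2 * n" "admissible n R i w" and j: "j < 2 * n" "admissible n R j w"
  shows "i = j"
proof (rule ccontr)
  assume ne: "i \<noteq> j"
  have np: "\<not> periodic_word w" and wn: "\<And>k. w k \<in> {1..n}"
    using w codesD(1) unfolding aperiodic_coding_def by blast+
  define s where "s k = int (w k) + int (w (k + 1))" for k
  have ri: "(s k + int i) mod int n \<in> {1, 2}" and rj: "(s k + int j) mod int n \<in> {1, 2}" for k
    using admissible_sum_residue[OF n R i(1) wn i(2), of k] admissible_sum_residue[OF n R j(1) wn j(2), of k]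
    unfolding s_def by blast+
  show False
  proof (cases "int n dvd int i - int j")
    case True
    have opp: "i = j + n \<or> j = i + n"
    proof -
      obtain q where q: "int i - int j = int n * q" using True by blast
      have "\<bar>int i - int j\<bar> < 2 * int n" using i(1) j(1) by linarith
      then have "int n * \<bar>q\<bar> < int n * 2" unfolding q by (simp add: abs_mult)
      then have "\<bar>q\<bar> < 2" using n by (simp only: mult_less_cancel_left_pos)
      moreover have "q \<noteq> 0" using q ne by auto
      ultimately have "q = 1 \<or> q = -1" by linarith
      then show ?thesis using q by auto
    qed
    obtain k where k: "w k = w (k + 1)" using double_letter_occurs[OF n R w] by blast
    have double: "2 * label_perm n R h (w k) \<in> {n + 1, n + 2}" if "admissible n R h w" for h
    proof -
      have "label_perm n R h (w k) + label_perm n R h (w (k + 1)) \<in> {n + 1, n + 2}"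
        using that unfolding admissible_def admissible0_def by simp
      then show ?thesis using k by (simp add: mult_2)
    qed
    have no: False if "h < n" "admissible n R h w" "admissible n R (h + n) w" for h
      using opposite_diagrams_exclude_double_letter[OF n R that(1) wn double[OF that(2)] double[OF that(3)]] .
    show False using opp no[of i] no[of j] i j by auto
  next
    case False
    have const: "(s k + int i) mod int n = (s k' + int i) mod int n" for k k'
    proof -
      have apart: "(s k + int i) mod int n \<noteq> (s k + int j) mod int n" for k
        using False by (simp add: mod_eq_dvd_iff)
      have "\<not> ((s k + int i) mod int n = 1 \<and> (s k' + int i) mod int n = 2)" for k k'
      proof
        assume a: "(s k + int i) mod int n = 1 \<and> (s k' + int i) mod int n = 2"
        then have b: "(s k + int j) mod int n = 2" "(s k' + int j) mod int n = 1"
          using apart[of k] apart[of k'] rj[of k] rj[of k'] by auto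
        have "((s k + int i) - (s k + int j)) mod int n = (1 - 2) mod int n"
          using a b by (metis mod_diff_eq)
        moreover have "((s k' + int i) - (s k' + int j)) mod int n = (2 - 1) mod int n"
          using a b by (metis mod_diff_eq)
        ultimately have "(- 1) mod int n = 1 mod int n" by simp
        then have "int n dvd 2" by (simp add: mod_eq_dvd_iff)
        then show False using n zdvd_imp_le by force
      qed
      then show ?thesis using ri[of k] ri[of k'] by (metis insertE singletonD)
    qed
    have "w (k + 2) = w k" for k
    proof -
      have "int n dvd (s (k + 1) + int i) - (s k + int i)" using const[of "k + 1" k] by (simp only: mod_eq_dvd_iff)
      also have "(s (k + 1) + int i) - (s k + int i) = int (w (k + 2)) - int (w k)" by (simp add: s_def add.assoc)
      finally have "int n dvd int (w (k + 2)) - int (w k)" .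
      then have "int n dvd \<bar>int (w (k + 2)) - int (w k)\<bar>" by simp
      moreover have "\<bar>int (w (k + 2)) - int (w k)\<bar> < int n" using wn[of k] wn[of "k + 2"] by auto
      ultimately show ?thesis using zdvd_not_zless[of "\<bar>int (w (k + 2)) - int (w k)\<bar>" "int n"] by fastforce
    qed
    then show False using np unfolding periodic_word_def by (auto dest: spec[of _ "2::int"])
  qed
qed

lemma admissible_of_base_sector:
  fixes R :: real
  assumes n: "n \<ge> 3" and R: "R > 0" and i: "i < 2 * n" and w: "codes n v w \<delta>"
    and base: "base_cone n (sector_isometry n i v)"
  shows "admissible n R i w"
proof -
  obtain \<delta>' where \<delta>': "codes n (sector_isometry n i v) (label_perm n R i \<circ> w) \<delta>'"
    using codes_sector_isometry[OF n R i w] by blast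
  show ?thesis unfolding admissible_def admissible0_def
    using transition_sums[OF n base \<delta>'] by simp
qed

text \<open>
  The same sequence of diagrams and derived words serves every direction that codes \<open>w\<close>, because a word
  that is admissible in only one diagram leaves only one sector for its direction. The words are given in advance
  since a derived word is determined only up to a shift.
\<close>

lemma itinerary_of_coding:
  fixes R :: real
  assumes n: "n \<ge> 3" and R: "R > 0" and \<theta>: "\<theta> \<in> {0..pi}" and w: "codes n (cis \<theta>) (W 0) \<delta>"
    and d: "\<And>k. d k < 2 * n" and der: "\<And>k. derived_sequence (label_perm n R (d k) \<circ> W k) (W (Suc k))"
    and np: "\<And>k. \<not> periodic_word (W k)" and unique: "\<And>k i. i < 2 * n \<Longrightarrow> admissible n R i (W k) \<Longrightarrow> i = d k"
  shows "itinerary n \<theta> d"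
proof -
  define T where "T k = (farey_map n ^^ k) \<theta>" for k
  have sector: "base_cone n (sector_isometry n (d k) (of_real c * cis (T k)))
      \<and> T k \<in> sector n (d k) \<and> T k \<in> closed_sector n (d k)"
    if c: "0 < c" "0 \<le> T k" "T k \<le> pi" "codes n (of_real c * cis (T k)) (W k) \<delta>" for k c \<delta>
  proof -
    have "0 \<le> sin (T k)" using c(2,3) by (rule sin_ge_zero)
    then have "aperiodic_coding n (of_real c * cis (T k)) (W k)"
      using c np[of k] unfolding aperiodic_coding_def by auto
    then obtain i where i: "i < 2 * n" "base_cone n (sector_isometry n i (of_real c * cis (T k)))"
      using aperiodic_base_sector[OF n R] by blast
    then have "i = d k" using unique admissible_of_base_sector[OF n R i(1) c(4) i(2)] by blast
    then have base: "base_cone n (sector_isometry n (d k) (of_real c * cis (T k)))" using i(2) by simp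
    then have "real (d k) * (pi / (2 * real n)) < T k" "T k < (real (d k) + 1) * (pi / (2 * real n))"
      unfolding base_sector_iff[OF n c(1-3) d] by blast+
    then have "T k \<in> sector n (d k)" using c(3) by (simp add: sector_def)
    then show ?thesis using base sector_subset_closed_sector[of n "d k"] n d by auto
  qed
  have ex: "\<exists>c>0. 0 \<le> T k \<and> T k \<le> pi \<and> (\<exists>\<delta>. codes n (of_real c * cis (T k)) (W k) \<delta>)" for k
  proof (induction k)
    case 0
    then show ?case using \<theta> w by (intro exI[of _ 1]) (auto simp: T_def)
  next
    case (Suc k)
    then obtain c \<delta> where c: "0 < c" "0 \<le> T k" "T k \<le> pi" "codes n (of_real c * cis (T k)) (W k) \<delta>" by blast
    note sec = sector[OF c]
    obtain \<delta>' where \<delta>': "codes n (sector_isometry n (d k) (of_real c * cis (T k))) (label_perm n R (d k) \<circ> W k) \<delta>'"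
      using codes_sector_isometry[OF n R d c(4)] by blast
    obtain f where f: "strict_mono f" "range f = sandwiched (label_perm n R (d k) \<circ> W k)"
      "W (Suc k) = label_perm n R (d k) \<circ> W k \<circ> f"
      using der[of k] unfolding derived_sequence_def by blast
    have "codes n (farey_matrix n (sector_isometry n (d k) (of_real c * cis (T k)))) (W (Suc k)) (\<lambda>i. - \<delta>' (f i))"
      unfolding f(3) using sec by (intro derived_codes[OF n _ \<delta>' f(1,2)]) blast
    moreover obtain c' where "0 < c'"
      "farey_matrix n (sector_isometry n (d k) (of_real c * cis (T k))) = of_real c' * cis (T (Suc k))"
      using farey_map_direction(1)[OF n d _ c(1), of "T k" k] sec by (auto simp: T_def)
    moreover have "0 \<le> T (Suc k)" "T (Suc k) \<le> pi"
      using farey_map_direction(2)[OF n d _ c(1), of "T k" k] sec by (simp_all add: T_def)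
    ultimately show ?case by metis
  qed
  show ?thesis unfolding itinerary_def T_def[symmetric] using d ex sector by blast
qed

text \<open>
  The direction of a trajectory may first be replaced by its opposite. The words and diagrams come from the
  renormalization sequence of one trajectory; the itinerary of any other trajectory with the same word is
  found along the same words.
\<close>

theorem theorem6p2p2:
  fixes n :: nat and R :: real and w :: "int \<Rightarrow> nat"
  assumes "n \<ge> 3" and "R > 0"
    and "\<exists>\<phi> p t. linear_trajectory n R \<phi> p t \<and> cutting_sequence n R p t w"
    and "\<not> periodic_word w"
  shows "\<exists>(d :: nat \<Rightarrow> nat) (W :: nat \<Rightarrow> int \<Rightarrow> nat).
    W 0 = w \<and>
    (\<forall>k. d k < 2 * n \<and> admissible n R (d k) (W k) \<and>
         (\<forall>i<2 * n. admissible n R i (W k) \<longrightarrow> i = d k) \<and>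
         derived_sequence (label_perm n R (d k) \<circ> W k) (W (Suc k))) \<and>
    (\<exists>\<theta>\<in>{0..pi}.
         itinerary n \<theta> d \<and>
         (\<forall>\<theta>'\<in>{0..pi}. itinerary n \<theta>' d \<longrightarrow> \<theta>' = \<theta>) \<and>
         (\<forall>\<phi>\<in>{0..pi}. \<forall>p t. linear_trajectory n R \<phi> p t \<and> cutting_sequence n R p t w \<longrightarrow> \<phi> = \<theta>))"
proof -
  note n = assms(1) and R = assms(2) and np = assms(4)
  obtain \<phi> \<delta> where \<phi>: "codes n (cis \<phi>) w \<delta>" using assms(3) trajectory_codes[OF n R] by blast
  obtain v where v: "cmod v = 1" "0 \<le> Im v" "codes n v w \<delta>"
    using \<phi> codes_minus[of n "cis \<phi>" w \<delta>] that[of "cis \<phi>"] that[of "- cis \<phi>"]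
    by (cases "0 \<le> Im (cis \<phi>)") auto
  define \<theta> where "\<theta> = Arg v"
  have "v \<noteq> 0" using v(1) by auto
  then have v\<theta>: "v = cis \<theta>" using v(1) by (simp add: \<theta>_def cis_Arg sgn_eq)
  have \<theta>: "\<theta> \<in> {0..pi}" using v(2) Arg_le_pi by (simp add: \<theta>_def Arg_less_0)
  have "aperiodic_coding n v w" using v \<open>v \<noteq> 0\<close> np unfolding aperiodic_coding_def by blast
  from renormalization_sequence[OF n R this] obtain d V W where init: "V 0 = v" "W 0 = w"
    and d: "\<And>k. d k < 2 * n" and ap: "\<And>k. aperiodic_coding n (V k) (W k)"
    and base: "\<And>k. base_cone n (sector_isometry n (d k) (V k))"
    and der: "\<And>k. derived_sequence (label_perm n R (d k) \<circ> W k) (W (Suc k))"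
    by blast
  have adm: "admissible n R (d k) (W k)" for k
    using ap[of k] admissible_of_base_sector[OF n R d _ base, of k] unfolding aperiodic_coding_def by blast
  have unique: "i = d k" if "i < 2 * n" "admissible n R i (W k)" for i k
    using admissible_diagram_unique[OF n R ap that d adm] .
  have npk: "\<not> periodic_word (W k)" for k using ap[of k] by (simp add: aperiodic_coding_def)
  have it: "itinerary n \<alpha> d" if "\<alpha> \<in> {0..pi}" "codes n (cis \<alpha>) w \<epsilon>" for \<alpha> \<epsilon>
    using itinerary_of_coding[where W = W and d = d, OF n R that(1) _ d der npk unique, of \<epsilon>] that(2) init(2) by simp
  have it\<theta>: "itinerary n \<theta> d" using it[OF \<theta>] v(3) unfolding v\<theta> .
  have "\<theta>' = \<theta>" if "\<theta>' \<in> {0..pi}" "itinerary n \<theta>' d" for \<theta>'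
    using itinerary_injective[OF n that(1) \<theta> that(2) it\<theta>] .
  moreover have "\<alpha> = \<theta>"
    if \<alpha>: "\<alpha> \<in> {0..pi}" and "linear_trajectory n R \<alpha> p t" "cutting_sequence n R p t w" for \<alpha> p t
    using trajectory_codes[OF n R that(2,3)] it[OF \<alpha>] itinerary_injective[OF n \<alpha> \<theta> _ it\<theta>] by blast
  ultimately show ?thesis
    using init(2) d adm unique der \<theta> it\<theta> by (intro exI[of _ d] exI[of _ W]) blast
qed

end
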